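(* Let $G=SL_{n+1}(\mathbb C)$ and $\mathbf i=\mathbf i_0=(1,2,\ldots,n,\,1,2,\ldots,n-1,\,\ldots,\,1,2,3,\,1,2,\,1)$. Identify the variables $c_{m,l}$ with the variables $Y_{m,l}$ of the monomial crystal $\mathcal Y(p)$ of type $A_n$, where $p_{i,j}=1$ for $i<j$ and $p_{i,j}=0$ for $i>j$. Then for $j=1,\dots,n$ and $t\in T$: $$\chi_j(\pi^+(\overline w_0^{-1}t\Theta^-_{\mathbf i}(c)))=\Delta_{w_0\Lambda_j,s_j\Lambda_j}(\Theta^-_{\mathbf i}(c))=\sum_{k=0}^{j-1}\tilde f_k\cdots\tilde f_2\tilde f_1(c_{n-j+1,1}),$$ $$\chi_j(\pi^+(\overline w_0^{-1}\eta(t\Theta^-_{\mathbf i}(c))))=\alpha_j(t)\,\Delta_{w_0s_j\Lambda_j,\Lambda_j}(\Theta^-_{\mathbf i}(c))=\alpha_j(t)\sum_{k=0}^{j-1}\tilde e_k\cdots\tilde e_2\tilde e_1(c_{j,1}^{-1}),$$ where $\tilde e_i,\tilde f_i$ are the crystal operators of $\mathcal Y(p)$ (the $k=0$ terms being $c_{n-j+1,1}$ and $c_{j,1}^{-1}$).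
   Context: Group notation. $T$ is the diagonal torus of $G=SL_{n+1}(\mathbb C)$ with simple roots $\alpha_i$, $U=U^+$ (resp. $U^-$) the upper (resp. lower) unitriangular matrices, $B^-=TU^-$, $\Lambda_i$ the fundamental weights, $s_i$ the simple reflections, $w_0$ the longest Weyl group element. $x_i(c)=\exp(ce_i)$, $y_i(c)=\exp(cf_i)$, $\alpha_i^\vee$ the simple coroots, $\overline s_i=x_i(-1)y_i(1)x_i(-1)$, $\overline w=\overline s_{j_1}\cdots\overline s_{j_l}$ for a reduced expression of $w$. $\chi_i:U\to\mathbb C$ is the additive character with $\chi_i(x_j(c))=\delta_{ij}c$; $\pi^+:B^-U\to U$, $\pi^+(bu)=u$; $\eta$ is the anti-automorphism of $G$ with $\eta(x_i(c))=x_i(c)$, $\eta(y_i(c))=y_i(c)$, $\eta(t)=t^{-1}$. For dominant $\mu$, $\Delta_\mu(u^-tu^+)=\mu(t)$ ($u^\pm\in U^\pm,t\in T$), extended to a regular function on $G$, and $\Delta_{u\mu,v\mu}(g)=\Delta_\mu(\overline u^{-1}g\overline v)$ for Weyl group elements $u,v$. Parametrization: $\mathbf y_i(c)=y_i(c)\alpha_i^\vee(c^{-1})$; for $c=(c_{k,l})_{k,l\ge1,\,k+l\le n+1}\in(\mathbb C^\times)^{n(n+1)/2}$, $\Theta^-_{\mathbf i}(c)=\mathbf y_1(c_{1,1})\mathbf y_2(c_{1,2})\cdots\mathbf y_n(c_{1,n})\,\mathbf y_1(c_{2,1})\cdots\mathbf y_{n-1}(c_{2,n-1})\cdots\mathbf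 y_1(c_{n,1})$. Monomial crystal $\mathcal Y(p)$. Let $(a_{i,j})$ be the Cartan matrix of type $A_n$, $I=\{1,\dots,n\}$. $\mathcal Y$ is the set of Laurent monomials $Y=\prod_{m\in\mathbb Z,i\in I}Y_{m,i}^{l_{m,i}}$ with $l_{m,i}\in\mathbb Z$ zero for all but finitely many $(m,i)$. Put $A_{m,i}=Y_{m,i}Y_{m+1,i}\prod_{j\ne i}Y_{m+p_{j,i},j}^{a_{j,i}}$, $\mathrm{wt}(Y)=\sum_{m,i}l_{m,i}\Lambda_i$, $\varphi_i(Y)=\max_{k\in\mathbb Z}\sum_{m\le k}l_{m,i}$, $\varepsilon_i(Y)=\varphi_i(Y)-\langle h_i,\mathrm{wt}(Y)\rangle$. With $n_f=\min\{k:\varphi_i(Y)=\sum_{m\le k}l_{m,i}\}$ and $n_e=\max\{k:\varphi_i(Y)=\sum_{m\le k}l_{m,i}\}$: $\tilde f_i(Y)=A_{n_f,i}^{-1}Y$ if $\varphi_i(Y)>0$ and $0$ if $\varphi_i(Y)=0$; $\tilde e_i(Y)=A_{n_e,i}Y$ if $\varepsilon_i(Y)>0$ and $0$ if $\varepsilon_i(Y)=0$.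
   Formalization: In the second display the middle minor is taken with index n+1-j in place of j, i.e. Δ_{w_0 s_{n+1-j}Λ_{n+1-j}, Λ_{n+1-j}}; as printed it fails for n=2, j=1, where the minor is 1/c_{2,1}+c_{1,1}/c_{1,2} but the sum is 1/c_{1,1}. *)

theory Defs
  imports
    Complex_Main
    "HOL-Library.FuncSet"
    "HOL-Library.Poly_Mapping"
    "HOL-Combinatorics.Permutations"
    "HOL-Algebra.Group"
    "Jordan_Normal_Form.Determinant"
begin

text \<open>
  The indices of simple roots, fundamental weights and simple reflections run over
  \<open>{1..n}\<close>, and Weyl group elements permute \<open>{1..n+1}\<close>. Matrix entries of
  \<open>Jordan_Normal_Form\<close> are indexed from 0, so row (column) \<open>i\<close> of the
  mathematical text is row (column) \<open>i - 1\<close> here.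
\<close>

definition SL :: "nat \<Rightarrow> complex mat monoid" where
  "SL n = \<lparr>carrier = {g \<in> carrier_mat (n + 1) (n + 1). det g = 1},
           mult = (*), one = 1\<^sub>m (n + 1)\<rparr>"

definition torus :: "nat \<Rightarrow> complex mat set" where
  "torus n = {t \<in> carrier (SL n). diagonal_mat t}"

definition unip_upper :: "nat \<Rightarrow> complex mat set" where
  "unip_upper n = {u \<in> carrier_mat (n + 1) (n + 1).
     upper_triangular u \<and> (\<forall>i < n + 1. u $$ (i, i) = 1)}"

definition unip_lower :: "nat \<Rightarrow> complex mat set" where
  "unip_lower n = {u \<in> carrier_mat (n + 1) (n + 1).
     upper_triangular (transpose_mat u) \<and> (\<forall>i < n + 1. u $$ (i, i) = 1)}"

definition borel_minus :: "nat \<Rightarrow> complex mat set" where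
  "borel_minus n = {t * v |t v. t \<in> torus n \<and> v \<in> unip_lower n}"

definition mat_prod :: "nat \<Rightarrow> complex mat list \<Rightarrow> complex mat" where
  "mat_prod n gs = foldr (*) gs (1\<^sub>m (n + 1))"

text \<open>The matrix exponential, as an entrywise power series.\<close>

definition mat_exp :: "nat \<Rightarrow> complex mat \<Rightarrow> complex mat" where
  "mat_exp n A = mat (n + 1) (n + 1) (\<lambda>(r, s). suminf (\<lambda>k. (A ^\<^sub>m k) $$ (r, s) / fact k))"

definition chev_e :: "nat \<Rightarrow> nat \<Rightarrow> complex mat" where
  "chev_e n i = mat (n + 1) (n + 1) (\<lambda>(r, s). if r + 1 = i \<and> s = i then 1 else 0)"

definition chev_f :: "nat \<Rightarrow> nat \<Rightarrow> complex mat" where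
  "chev_f n i = mat (n + 1) (n + 1) (\<lambda>(r, s). if r = i \<and> s + 1 = i then 1 else 0)"

definition x_root :: "nat \<Rightarrow> nat \<Rightarrow> complex \<Rightarrow> complex mat" where
  "x_root n i c = mat_exp n (c \<cdot>\<^sub>m chev_e n i)"

definition y_root :: "nat \<Rightarrow> nat \<Rightarrow> complex \<Rightarrow> complex mat" where
  "y_root n i c = mat_exp n (c \<cdot>\<^sub>m chev_f n i)"

definition coroot :: "nat \<Rightarrow> nat \<Rightarrow> complex \<Rightarrow> complex mat" where
  "coroot n i c = mat (n + 1) (n + 1)
     (\<lambda>(r, s). if r \<noteq> s then 0 else if r + 1 = i then c else if r = i then inverse c else 1)"

definition simple_root :: "nat \<Rightarrow> complex mat \<Rightarrow> complex" where
  "simple_root i t = t $$ (i - 1, i - 1) / t $$ (i, i)"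

definition weyl_group :: "nat \<Rightarrow> (nat \<Rightarrow> nat) set" where
  "weyl_group n = {w. w permutes {1..n + 1}}"

definition simple_refl :: "nat \<Rightarrow> nat \<Rightarrow> nat" where
  "simple_refl i = Transposition.transpose i (i + 1)"

definition is_word :: "nat \<Rightarrow> (nat \<Rightarrow> nat) \<Rightarrow> nat list \<Rightarrow> bool" where
  "is_word n w js \<longleftrightarrow> set js \<subseteq> {1..n} \<and> w = foldr (\<lambda>j v. simple_refl j \<circ> v) js id"

definition weyl_length :: "nat \<Rightarrow> (nat \<Rightarrow> nat) \<Rightarrow> nat" where
  "weyl_length n w = (LEAST l. \<exists>js. is_word n w js \<and> length js = l)"

definition is_reduced_word :: "nat \<Rightarrow> (nat \<Rightarrow> nat) \<Rightarrow> nat list \<Rightarrow> bool" where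
  "is_reduced_word n w js \<longleftrightarrow> is_word n w js \<and> length js = weyl_length n w"

definition longest_elt :: "nat \<Rightarrow> nat \<Rightarrow> nat" where
  "longest_elt n = (THE w. w \<in> weyl_group n \<and>
     (\<forall>v \<in> weyl_group n. weyl_length n v \<le> weyl_length n w))"

definition refl_lift :: "nat \<Rightarrow> nat \<Rightarrow> complex mat" where
  "refl_lift n i = x_root n i (- 1) * y_root n i 1 * x_root n i (- 1)"

text \<open>By the braid relations the lift does not depend on the reduced word.\<close>

definition weyl_lift :: "nat \<Rightarrow> (nat \<Rightarrow> nat) \<Rightarrow> complex mat" where
  "weyl_lift n w =
     (THE g. \<exists>js. is_reduced_word n w js \<and> g = mat_prod n (map (refl_lift n) js))"

text \<open>
  The group \<open>U\<close> is generated by the \<open>x\<^sub>j(c)\<close>, and \<open>G\<close> by the \<open>x\<^sub>i(c)\<close> and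
  \<open>y\<^sub>i(c)\<close>, so the conditions below determine the respective maps on \<open>U\<close> and \<open>G\<close>;
  \<^const>\<open>extensional\<close> only fixes their values elsewhere.
\<close>

definition chi :: "nat \<Rightarrow> nat \<Rightarrow> complex mat \<Rightarrow> complex" where
  "chi n i = (THE f. f \<in> extensional (unip_upper n) \<and>
     (\<forall>u \<in> unip_upper n. \<forall>v \<in> unip_upper n. f (u * v) = f u + f v) \<and>
     (\<forall>j \<in> {1..n}. \<forall>c. f (x_root n j c) = (if i = j then c else 0)))"

definition borel_minus_U :: "nat \<Rightarrow> complex mat set" where
  "borel_minus_U n = {b * u |b u. b \<in> borel_minus n \<and> u \<in> unip_upper n}"

definition pi_plus :: "nat \<Rightarrow> complex mat \<Rightarrow> complex mat" where
  "pi_plus n g = (THE u. u \<in> unip_upper n \<and> (\<exists>b \<in> borel_minus n. g = b * u))"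

definition eta :: "nat \<Rightarrow> complex mat \<Rightarrow> complex mat" where
  "eta n = (THE h. h \<in> extensional (carrier (SL n)) \<and>
     bij_betw h (carrier (SL n)) (carrier (SL n)) \<and>
     (\<forall>g \<in> carrier (SL n). \<forall>k \<in> carrier (SL n). h (g * k) = h k * h g) \<and>
     (\<forall>i \<in> {1..n}. \<forall>c. h (x_root n i c) = x_root n i c \<and> h (y_root n i c) = y_root n i c) \<and>
     (\<forall>t \<in> torus n. h t = inv\<^bsub>SL n\<^esub> t))"

text \<open>Weights are given by their coefficients with respect to the fundamental weights.\<close>

type_synonym weight = "nat \<Rightarrow> int"

definition fund_weight :: "nat \<Rightarrow> weight" where
  "fund_weight i = (\<lambda>k. if k = i then 1 else 0)"

definition weight_char :: "nat \<Rightarrow> weight \<Rightarrow> complex mat \<Rightarrow> complex" where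
  "weight_char n \<mu> t = (\<Prod>i = 1..n. (\<Prod>k < i. t $$ (k, k)) powi \<mu> i)"

inductive_set poly_functions :: "nat \<Rightarrow> (complex mat \<Rightarrow> complex) set" for n where
  const: "(\<lambda>g. a) \<in> poly_functions n"
| entry: "r < n + 1 \<Longrightarrow> s < n + 1 \<Longrightarrow> (\<lambda>g. g $$ (r, s)) \<in> poly_functions n"
| add: "F \<in> poly_functions n \<Longrightarrow> H \<in> poly_functions n \<Longrightarrow> (\<lambda>g. F g + H g) \<in> poly_functions n"
| mult: "F \<in> poly_functions n \<Longrightarrow> H \<in> poly_functions n \<Longrightarrow> (\<lambda>g. F g * H g) \<in> poly_functions n"

definition regular_functions :: "nat \<Rightarrow> (complex mat \<Rightarrow> complex) set" where
  "regular_functions n = (\<lambda>F. restrict F (carrier (SL n))) ` poly_functions n"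

text \<open>
  For dominant \<open>\<mu>\<close> the regular extension exists, and it is unique because
  \<open>U\<^sup>-TU\<close> is dense in the group.
\<close>

definition Delta :: "nat \<Rightarrow> weight \<Rightarrow> complex mat \<Rightarrow> complex" where
  "Delta n \<mu> = (THE F. F \<in> regular_functions n \<and>
     (\<forall>v \<in> unip_lower n. \<forall>t \<in> torus n. \<forall>u \<in> unip_upper n. F (v * t * u) = weight_char n \<mu> t))"

text \<open>\<open>gen_minor n u v \<mu>\<close> is $\Delta_{u\mu,v\mu}$.\<close>

definition gen_minor ::
  "nat \<Rightarrow> (nat \<Rightarrow> nat) \<Rightarrow> (nat \<Rightarrow> nat) \<Rightarrow> weight \<Rightarrow> complex mat \<Rightarrow> complex" where
  "gen_minor n u v \<mu> g = Delta n \<mu> (inv\<^bsub>SL n\<^esub> (weyl_lift n u) * g * weyl_lift n v)"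

definition y_bold :: "nat \<Rightarrow> nat \<Rightarrow> complex \<Rightarrow> complex mat" where
  "y_bold n i c = y_root n i c * coroot n i (inverse c)"

text \<open>
  The first index of the variables is an integer, as in the monomial crystal; only
  the values \<open>c k l\<close> with \<open>k, l \<ge> 1\<close> and \<open>k + l \<le> n + 1\<close> are coordinates.
\<close>

definition Theta :: "nat \<Rightarrow> (int \<Rightarrow> nat \<Rightarrow> complex) \<Rightarrow> complex mat" where
  "Theta n c = mat_prod n
     (concat (map (\<lambda>k. map (\<lambda>l. y_bold n l (c (int k) l)) [1..<n + 2 - k]) [1..<n + 1]))"

definition cartan :: "nat \<Rightarrow> nat \<Rightarrow> int" where
  "cartan i j = (if i = j then 2 else if i = j + 1 \<or> j = i + 1 then - 1 else 0)"

text \<open>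
  A Laurent monomial in the \<open>Y\<^sub>m\<^sub>,\<^sub>i\<close> is its finitely supported exponent function, and
  the product of monomials is the sum of exponents. The zero of the crystal
  operators is \<^const>\<open>None\<close>. Since \<open>i\<close> ranges over \<open>{1..n}\<close>, monomials are those
  with no other second index in their support.
\<close>

type_synonym monomial = "(int \<times> nat) \<Rightarrow>\<^sub>0 int"

definition Yvar :: "int \<Rightarrow> nat \<Rightarrow> monomial" where
  "Yvar m i = Poly_Mapping.single (m, i) 1"

definition Amon :: "nat \<Rightarrow> (nat \<Rightarrow> nat \<Rightarrow> int) \<Rightarrow> int \<Rightarrow> nat \<Rightarrow> monomial" where
  "Amon n p m i = Yvar m i + Yvar (m + 1) i +
     (\<Sum>j \<in> {1..n} - {i}. Poly_Mapping.single (m + p j i, j) (cartan j i))"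

definition crys_wt :: "monomial \<Rightarrow> weight" where
  "crys_wt Y = (\<lambda>i. \<Sum>m | (m, i) \<in> Poly_Mapping.keys Y. Poly_Mapping.lookup Y (m, i))"

definition partial_exp :: "monomial \<Rightarrow> nat \<Rightarrow> int \<Rightarrow> int" where
  "partial_exp Y i k = (\<Sum>m | m \<le> k \<and> (m, i) \<in> Poly_Mapping.keys Y. Poly_Mapping.lookup Y (m, i))"

text \<open>The partial sums take only finitely many values.\<close>

definition crys_phi :: "nat \<Rightarrow> monomial \<Rightarrow> int" where
  "crys_phi i Y = Max (range (partial_exp Y i))"

text \<open>The pairing of \<open>h\<^sub>i\<close> with a weight is the coefficient of the \<open>i\<close>-th fundamental weight.\<close>

definition crys_eps :: "nat \<Rightarrow> monomial \<Rightarrow> int" where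
  "crys_eps i Y = crys_phi i Y - crys_wt Y i"

definition crys_nf :: "nat \<Rightarrow> monomial \<Rightarrow> int" where
  "crys_nf i Y = (LEAST k. crys_phi i Y = partial_exp Y i k)"

definition crys_ne :: "nat \<Rightarrow> monomial \<Rightarrow> int" where
  "crys_ne i Y = (GREATEST k. crys_phi i Y = partial_exp Y i k)"

definition crys_f :: "nat \<Rightarrow> (nat \<Rightarrow> nat \<Rightarrow> int) \<Rightarrow> nat \<Rightarrow> monomial \<Rightarrow> monomial option" where
  "crys_f n p i Y = (if crys_phi i Y > 0 then Some (Y - Amon n p (crys_nf i Y) i) else None)"

definition crys_e :: "nat \<Rightarrow> (nat \<Rightarrow> nat \<Rightarrow> int) \<Rightarrow> nat \<Rightarrow> monomial \<Rightarrow> monomial option" where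
  "crys_e n p i Y = (if crys_eps i Y > 0 then Some (Y + Amon n p (crys_ne i Y) i) else None)"

text \<open>
  \<open>crys_f_string n p k Y\<close> applies first the operator with index 1 and last the one
  with index \<open>k\<close>; every operator maps the crystal zero to itself.
\<close>

primrec crys_f_string ::
  "nat \<Rightarrow> (nat \<Rightarrow> nat \<Rightarrow> int) \<Rightarrow> nat \<Rightarrow> monomial \<Rightarrow> monomial option" where
  "crys_f_string n p 0 Y = Some Y"
| "crys_f_string n p (Suc k) Y = Option.bind (crys_f_string n p k Y) (crys_f n p (Suc k))"

primrec crys_e_string ::
  "nat \<Rightarrow> (nat \<Rightarrow> nat \<Rightarrow> int) \<Rightarrow> nat \<Rightarrow> monomial \<Rightarrow> monomial option" where
  "crys_e_string n p 0 Y = Some Y"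
| "crys_e_string n p (Suc k) Y = Option.bind (crys_e_string n p k Y) (crys_e n p (Suc k))"

text \<open>The function of \<open>c\<close> obtained by identifying \<open>Y\<^sub>m\<^sub>,\<^sub>l\<close> with \<open>c\<^sub>m\<^sub>,\<^sub>l\<close>.\<close>

definition mon_value :: "(int \<Rightarrow> nat \<Rightarrow> complex) \<Rightarrow> monomial \<Rightarrow> complex" where
  "mon_value c Y = (\<Prod>(m, i) \<in> Poly_Mapping.keys Y. c m i powi Poly_Mapping.lookup Y (m, i))"

definition crys_value :: "(int \<Rightarrow> nat \<Rightarrow> complex) \<Rightarrow> monomial option \<Rightarrow> complex" where
  "crys_value c Z = (case Z of None \<Rightarrow> 0 | Some Y \<Rightarrow> mon_value c Y)"

end

theory Submission
  imports Defs
begin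

text \<open>
  Write \<open>\<Theta>\<close> for \<open>\<Theta>\<^sup>-(c)\<close> and \<open>w\<^sub>0\<close> for the lift of the longest element. Everything follows from a factorization
  \<open>\<Theta> = u w\<^sub>0 v\<close> with \<open>u, v \<in> U\<close>. As \<open>w\<^sub>0\<^sup>-\<^sup>1 U w\<^sub>0 = U\<^sup>-\<close>, the projection of \<open>w\<^sub>0\<^sup>-\<^sup>1 t \<Theta>\<close> to \<open>U\<close> is \<open>v\<close>; as
  \<open>\<eta>(g) = D g\<^sup>-\<^sup>1 D\<close> with \<open>D = diag(1, -1, 1, \<dots>)\<close> fixes \<open>w\<^sub>0\<close>, the projection of \<open>w\<^sub>0\<^sup>-\<^sup>1 \<eta>(t \<Theta>)\<close> is
  \<open>t \<eta>(u) t\<^sup>-\<^sup>1\<close>. So both characters, and the two generalized minors as well, are superdiagonal entries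
  of \<open>v\<close> and \<open>u\<close>.

  Each block \<open>\<^bold>y\<^sub>1(a\<^sub>1) \<dots> \<^bold>y\<^sub>m(a\<^sub>m)\<close> of \<open>\<Theta>\<close> is lower bidiagonal, with diagonal entries \<open>a\<^sub>i / a\<^sub>i\<^sub>+\<^sub>1\<close> and ones below. Hence
  \<open>u\<close> and \<open>v\<close> can be built one block at a time, and every block contributes one monomial to each
  superdiagonal entry of \<open>u\<close> and completes one superdiagonal entry of \<open>v\<close>. The strings
  \<open>f\<^sub>k \<dots> f\<^sub>1 Y\<^sub>m\<^sub>,\<^sub>1 = Y\<^sub>m\<^sub>,\<^sub>k\<^sub>+\<^sub>1 / Y\<^sub>m\<^sub>+\<^sub>1\<^sub>,\<^sub>k\<close> and \<open>e\<^sub>k \<dots> e\<^sub>1 (1 / Y\<^sub>m\<^sub>,\<^sub>1) = Y\<^sub>m\<^sub>-\<^sub>k\<^sub>,\<^sub>k / Y\<^sub>m\<^sub>-\<^sub>k\<^sub>,\<^sub>k\<^sub>+\<^sub>1\<close> run through the same monomials.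

  The characters, \<open>\<eta>\<close>, and the fundamental minors are characterized by their defining properties
  because \<open>U\<close> and \<open>G\<close> are generated by the one-parameter subgroups (and the torus), which also makes
  \<open>B\<^sup>-U\<close> dense: \<open>x\<^sub>i(z)\<close> maps an element of \<open>B\<^sup>-U\<close> back into \<open>B\<^sup>-U\<close> for all but at most one \<open>z\<close>.
\<close>

section \<open>Elementary matrices and the group\<close>

lemma index_mult_mat_sum:
  fixes A B :: "'a :: semiring_0 mat"
  assumes "A \<in> carrier_mat l m" "B \<in> carrier_mat m k" "r < l" "s < k"
  shows "(A * B) $$ (r, s) = (\<Sum>i<m. A $$ (r, i) * B $$ (i, s))"
  using assms by (auto simp: scalar_prod_def atLeast0LessThan intro!: sum.cong)

text \<open>Multiplying by an elementary matrix from the right is a column operation;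
  \<open>cell_x_root_mult\<close> uses it to clear an entry above the diagonal.\<close>

lemma mult_addrow_mat_right:
  fixes A :: "complex mat"
  assumes A: "A \<in> carrier_mat m m" and k: "k < m" and l: "l < m" and r: "r < m" and s: "s < m"
    and "k \<noteq> l"
  shows "(A * addrow_mat m a k l) $$ (r, s) = A $$ (r, s) + (if s = l then a * A $$ (r, k) else 0)"
proof -
  have "(A * addrow_mat m a k l) $$ (r, s)
      = (\<Sum>i<m. A $$ (r, i) * addrow_mat m a k l $$ (i, s))"
    using A r s by (intro index_mult_mat_sum) auto
  also have "\<dots> = (\<Sum>i<m. (if i = s then A $$ (r, s) else 0) +
      (if i = k then (if s = l then a * A $$ (r, k) else 0) else 0))"
    using s k l \<open>k \<noteq> l\<close> by (intro sum.cong) (auto simp: algebra_simps)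
  also have "\<dots> = A $$ (r, s) + (if s = l then a * A $$ (r, k) else 0)"
    using s k by (simp add: sum.distrib)
  finally show ?thesis .
qed

lemma suminf_two_terms:
  fixes f :: "nat \<Rightarrow> complex"
  assumes "\<And>k. k \<ge> 2 \<Longrightarrow> f k = 0"
  shows "suminf f = f 0 + f 1"
proof -
  have "suminf f = sum f {..<2}"
    using assms by (intro suminf_finite) auto
  then show ?thesis by (simp add: numeral_2_eq_2)
qed

text \<open>All powers from the second on vanish, so the entrywise series of \<open>mat_exp\<close>
  stops after its linear term.\<close>

lemma mat_exp_square_zero:
  assumes A: "A \<in> carrier_mat (n + 1) (n + 1)" and sq: "A * A = 0\<^sub>m (n + 1) (n + 1)"
  shows "mat_exp n A = 1\<^sub>m (n + 1) + A"
proof -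
  have pow: "A ^\<^sub>m k = 0\<^sub>m (n + 1) (n + 1)" if k2: "k \<ge> 2" for k
  proof -
    obtain l where k: "k = Suc (Suc l)" using le_Suc_ex[OF k2] by (auto simp: numeral_2_eq_2)
    have "A ^\<^sub>m k = A ^\<^sub>m l * (A * A)"
      using assoc_mult_mat[OF pow_carrier_mat[OF A] A A, of l] by (simp add: k)
    also have "\<dots> = 0\<^sub>m (n + 1) (n + 1)"
      unfolding sq by (rule right_mult_zero_mat[OF pow_carrier_mat[OF A]])
    finally show ?thesis .
  qed
  show ?thesis
  proof (rule eq_matI)
    fix r s assume "r < dim_row (1\<^sub>m (n + 1) + A)" "s < dim_col (1\<^sub>m (n + 1) + A)"
    then have rs: "r < n + 1" "s < n + 1" using A by auto
    have "suminf (\<lambda>k. (A ^\<^sub>m k) $$ (r, s) / fact k)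
        = (A ^\<^sub>m 0) $$ (r, s) / fact 0 + (A ^\<^sub>m 1) $$ (r, s) / fact 1"
      by (rule suminf_two_terms) (use pow rs in auto)
    then show "mat_exp n A $$ (r, s) = (1\<^sub>m (n + 1) + A) $$ (r, s)"
      using A rs by (simp add: mat_exp_def)
  qed (use A in \<open>auto simp: mat_exp_def\<close>)
qed

text \<open>The Chevalley generator squares to zero, so its exponential is an elementary matrix. The
  form \<open>addrow_mat\<close> makes left multiplication a row operation; the simple root
  \<open>i\<close> sits at the zero-based place (i - 1, i).\<close>

lemma x_root_eq: "i \<in> {1..n} \<Longrightarrow> x_root n i c = addrow_mat (n + 1) c (i - 1) i"
proof -
  assume i: "i \<in> {1..n}"
  let ?A = "c \<cdot>\<^sub>m chev_e n i"
  have A: "?A \<in> carrier_mat (n + 1) (n + 1)" by (simp add: chev_e_def)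
  have "?A * ?A = 0\<^sub>m (n + 1) (n + 1)"
  proof (rule eq_matI)
    fix r s assume rs: "r < dim_row (0\<^sub>m (n + 1) (n + 1) :: complex mat)" "s < dim_col (0\<^sub>m (n + 1) (n + 1) :: complex mat)"
    then have "(?A * ?A) $$ (r, s) = (\<Sum>k<n + 1. ?A $$ (r, k) * ?A $$ (k, s))"
      using A by (intro index_mult_mat_sum) auto
    also have "\<dots> = 0" using rs by (intro sum.neutral) (auto simp: chev_e_def)
    finally show "(?A * ?A) $$ (r, s) = 0\<^sub>m (n + 1) (n + 1) $$ (r, s)" using rs by simp
  qed (simp_all add: chev_e_def)
  then have "x_root n i c = 1\<^sub>m (n + 1) + ?A"
    unfolding x_root_def by (intro mat_exp_square_zero A)
  also have "\<dots> = addrow_mat (n + 1) c (i - 1) i"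
    using i by (intro eq_matI) (auto simp: chev_e_def)
  finally show ?thesis .
qed

lemma y_root_eq: "i \<in> {1..n} \<Longrightarrow> y_root n i c = addrow_mat (n + 1) c i (i - 1)"
proof -
  assume i: "i \<in> {1..n}"
  let ?A = "c \<cdot>\<^sub>m chev_f n i"
  have A: "?A \<in> carrier_mat (n + 1) (n + 1)" by (simp add: chev_f_def)
  have "?A * ?A = 0\<^sub>m (n + 1) (n + 1)"
  proof (rule eq_matI)
    fix r s assume rs: "r < dim_row (0\<^sub>m (n + 1) (n + 1) :: complex mat)" "s < dim_col (0\<^sub>m (n + 1) (n + 1) :: complex mat)"
    then have "(?A * ?A) $$ (r, s) = (\<Sum>k<n + 1. ?A $$ (r, k) * ?A $$ (k, s))"
      using A by (intro index_mult_mat_sum) auto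
    also have "\<dots> = 0" using rs by (intro sum.neutral) (auto simp: chev_f_def)
    finally show "(?A * ?A) $$ (r, s) = 0\<^sub>m (n + 1) (n + 1) $$ (r, s)" using rs by simp
  qed (simp_all add: chev_f_def)
  then have "y_root n i c = 1\<^sub>m (n + 1) + ?A"
    unfolding y_root_def by (intro mat_exp_square_zero A)
  also have "\<dots> = addrow_mat (n + 1) c i (i - 1)"
    using i by (intro eq_matI) (auto simp: chev_f_def)
  finally show ?thesis .
qed

text \<open>The two left factors act as row operations on the third. In rows and columns i - 1 and i
  the result is the block with rows (0, -1) and (1, 0); the signs of all later lifts come from this
  -1.\<close>

lemma refl_lift_entry:
  assumes i: "i \<in> {1..n}" and rs: "r < n + 1" "s < n + 1"
  shows "refl_lift n i $$ (r, s) =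
    (if r = i \<and> s = i - 1 then 1 else if r = i - 1 \<and> s = i then - 1
     else if r = s \<and> r \<noteq> i \<and> r \<noteq> i - 1 then 1 else 0)"
proof -
  have C: "addrow_mat (n + 1) a k l \<in> carrier_mat (n + 1) (n + 1)" for a k l by simp
  have eq: "refl_lift n i =
      addrow (- 1) (i - 1) i (addrow 1 i (i - 1) (addrow_mat (n + 1) (- 1) (i - 1) i))"
    using i unfolding refl_lift_def x_root_eq[OF i] y_root_eq[OF i]
    by (subst addrow_mat[of _ "n+1" "n+1"], (simp; fail), (simp; fail),
        subst addrow_mat[of _ "n+1" "n+1"], (simp; fail), (simp add: less_imp_diff_less; fail),
        intro assoc_mult_mat[of _ "n+1" "n+1" _ "n+1" _ "n+1"] C)
  obtain k where k: "i = Suc k" "k < n" using i by (cases i) auto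
  show ?thesis unfolding eq using rs k(2)
    by (cases "r = i"; cases "r = k"; cases "s = i"; cases "s = k") (simp_all add: k(1))
qed

lemma refl_lift_carrier [simp]: "i \<in> {1..n} \<Longrightarrow> refl_lift n i \<in> carrier_mat (n + 1) (n + 1)"
  unfolding refl_lift_def by (intro mult_carrier_mat[of _ _ "n + 1"]) (simp_all add: x_root_eq y_root_eq)

section \<open>The group SL and inverses in it\<close>

lemma SL_simps [simp]:
  "carrier (SL n) = {g \<in> carrier_mat (n + 1) (n + 1). det g = 1}"
  "mult (SL n) = (*)" "one (SL n) = 1\<^sub>m (n + 1)"
  by (auto simp: SL_def)

lemma group_SL: "group (SL n)"
proof (rule groupI)
  fix g assume g: "g \<in> carrier (SL n)"
  then have gc: "g \<in> carrier_mat (n + 1) (n + 1)" "det g \<noteq> 0" by auto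
  then obtain h where h: "h \<in> carrier_mat (n + 1) (n + 1)" "h * g = 1\<^sub>m (n + 1)"
    using det_non_zero_imp_unit[OF gc] unfolding Units_def ring_mat_def by auto
  have "det h * det g = 1" using h gc det_mult by (metis det_one)
  then show "\<exists>h\<in>carrier (SL n). h \<otimes>\<^bsub>SL n\<^esub> g = \<one>\<^bsub>SL n\<^esub>" using h g by auto
next
  fix x y z assume "x \<in> carrier (SL n)" "y \<in> carrier (SL n)" "z \<in> carrier (SL n)"
  then show "x \<otimes>\<^bsub>SL n\<^esub> y \<otimes>\<^bsub>SL n\<^esub> z = x \<otimes>\<^bsub>SL n\<^esub> (y \<otimes>\<^bsub>SL n\<^esub> z)"
    using assoc_mult_mat[of x "n+1" "n+1" y "n+1" z "n+1"] by simp
qed (auto simp: det_mult[of _ "n + 1"])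

lemma inv_SL_eq:
  assumes "h * g = 1\<^sub>m (n + 1)" "g \<in> carrier (SL n)" "h \<in> carrier (SL n)"
  shows "inv\<^bsub>SL n\<^esub> g = h"
  using group.inv_equality[OF group_SL, where y = h and x = g] assms by simp

lemma inv_SL_closed: "g \<in> carrier (SL n) \<Longrightarrow> inv\<^bsub>SL n\<^esub> g \<in> carrier (SL n)"
  by (rule group.inv_closed[OF group_SL])

lemma inv_SL_mult:
  assumes "g \<in> carrier (SL n)"
  shows "inv\<^bsub>SL n\<^esub> g * g = 1\<^sub>m (n + 1)" "g * inv\<^bsub>SL n\<^esub> g = 1\<^sub>m (n + 1)"
  using group.l_inv[OF group_SL assms] group.r_inv[OF group_SL assms] by simp_all

section \<open>Triangular matrices and unipotent generators\<close>

lemma addrow_mat_mult: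
  assumes "A \<in> carrier_mat m k" "l < m"
  shows "addrow_mat m a i l * A = addrow a i l A"
  using addrow_mat[OF assms] by simp

lemma prod_list_diag_mat:
  "A \<in> carrier_mat m m \<Longrightarrow> prod_list (diag_mat A) = (\<Prod>i<m. A $$ (i, i))"
  by (simp add: diag_mat_def prod.list_conv_set_nth atLeast0LessThan)

lemma prod_nonzero_imp:
  fixes f :: "nat \<Rightarrow> complex"
  assumes "(\<Prod>i<m. f i) = 1" "i < m"
  shows "f i \<noteq> 0"
  using assms by (metis finite_lessThan lessThan_iff prod_zero zero_neq_one)

lemma torusD:
  assumes "t \<in> torus n"
  shows "t \<in> carrier_mat (n + 1) (n + 1)" "det t = 1" "t = mat_diag (n + 1) (\<lambda>i. t $$ (i, i))"
    "\<And>r. r < n + 1 \<Longrightarrow> t $$ (r, r) \<noteq> 0"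
proof -
  show t: "t \<in> carrier_mat (n + 1) (n + 1)" and d: "det t = 1"
    using assms by (auto simp: torus_def)
  show "t = mat_diag (n + 1) (\<lambda>i. t $$ (i, i))"
    using assms t by (intro eq_matI) (auto simp: torus_def diagonal_mat_def mat_diag_def)
  have "upper_triangular t"
    using assms t by (auto simp: torus_def diagonal_mat_def)
  then have "prod_list (diag_mat t) = 1"
    using det_upper_triangular[OF _ t] d by simp
  then have "(\<Prod>i<n + 1. t $$ (i, i)) = 1" by (simp only: prod_list_diag_mat[OF t])
  then show "\<And>r. r < n + 1 \<Longrightarrow> t $$ (r, r) \<noteq> 0" by (rule prod_nonzero_imp)
qed

lemma torus_mult_entry:
  assumes "t \<in> torus n" "A \<in> carrier_mat (n + 1) (n + 1)" "r < n + 1" "s < n + 1"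
  shows "(t * A) $$ (r, s) = t $$ (r, r) * A $$ (r, s)"
    "(A * t) $$ (r, s) = A $$ (r, s) * t $$ (s, s)"
proof -
  show "(t * A) $$ (r, s) = t $$ (r, r) * A $$ (r, s)"
    using assms by (subst torusD(3)[OF assms(1)], subst mat_diag_mult_left[OF assms(2)]) simp
  show "(A * t) $$ (r, s) = A $$ (r, s) * t $$ (s, s)"
    using assms by (subst torusD(3)[OF assms(1)], subst mat_diag_mult_right[OF assms(2)]) simp
qed

lemma torusI_diag:
  assumes "(\<Prod>i<n + 1. f i) = 1"
  shows "mat_diag (n + 1) f \<in> torus n"
proof -
  have c: "mat_diag (n + 1) f \<in> carrier_mat (n + 1) (n + 1)" by simp
  have "det (mat_diag (n + 1) f) = (\<Prod>i<n + 1. f i)"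
    using det_upper_triangular[OF _ c] prod_list_diag_mat[OF c]
    by (auto simp: mat_diag_def upper_triangular_def)
  then show ?thesis using assms c by (auto simp: torus_def diagonal_mat_def mat_diag_def)
qed

text \<open>Every row is divided by its diagonal entry. The last clause keeps the zero pattern, so
  one lemma serves lower and upper triangular matrices.\<close>

lemma triangular_factor:
  assumes g: "g \<in> carrier_mat (n + 1) (n + 1)" and d: "(\<Prod>i<n + 1. g $$ (i, i)) = 1"
  shows "\<exists>t \<in> torus n. \<exists>u \<in> carrier_mat (n + 1) (n + 1). g = t * u \<and>
    (\<forall>i < n + 1. u $$ (i, i) = 1) \<and>
    (\<forall>i < n + 1. \<forall>k < n + 1. g $$ (i, k) = 0 \<longrightarrow> u $$ (i, k) = 0)"
proof -
  define t where "t = mat_diag (n + 1) (\<lambda>i. g $$ (i, i))"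
  define u where "u = mat (n + 1) (n + 1) (\<lambda>(i, k). g $$ (i, k) / g $$ (i, i))"
  have nz: "g $$ (i, i) \<noteq> 0" if "i < n + 1" for i
    using prod_nonzero_imp[OF d that] .
  have "t \<in> torus n" unfolding t_def by (rule torusI_diag[OF d])
  moreover have "g = t * u" unfolding t_def
    using g nz by (subst mat_diag_mult_left[of _ _ "n + 1"]) (auto simp: u_def intro!: eq_matI)
  ultimately show ?thesis
    using nz by (intro bexI[of _ t] bexI[of _ u]) (auto simp: u_def)
qed

lemma unip_upperD:
  assumes "u \<in> unip_upper n"
  shows "u \<in> carrier_mat (n + 1) (n + 1)" "\<And>r s. s < r \<Longrightarrow> r < n + 1 \<Longrightarrow> u $$ (r, s) = 0"
    "\<And>r. r < n + 1 \<Longrightarrow> u $$ (r, r) = 1"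
  using assms by (auto simp: unip_upper_def)

lemma unip_upperI:
  assumes "u \<in> carrier_mat (n + 1) (n + 1)"
    "\<And>r s. s < r \<Longrightarrow> r < n + 1 \<Longrightarrow> u $$ (r, s) = 0" "\<And>r. r < n + 1 \<Longrightarrow> u $$ (r, r) = 1"
  shows "u \<in> unip_upper n"
  using assms by (auto simp: unip_upper_def)

lemma unip_lowerD:
  assumes "u \<in> unip_lower n"
  shows "u \<in> carrier_mat (n + 1) (n + 1)" "\<And>r s. r < s \<Longrightarrow> s < n + 1 \<Longrightarrow> u $$ (r, s) = 0"
    "\<And>r. r < n + 1 \<Longrightarrow> u $$ (r, r) = 1"
  using assms by (auto simp: unip_lower_def upper_triangular_def)

lemma unip_lowerI:
  assumes "u \<in> carrier_mat (n + 1) (n + 1)"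
    "\<And>r s. r < s \<Longrightarrow> s < n + 1 \<Longrightarrow> u $$ (r, s) = 0" "\<And>r. r < n + 1 \<Longrightarrow> u $$ (r, r) = 1"
  shows "u \<in> unip_lower n"
  using assms by (auto simp: unip_lower_def upper_triangular_def)

lemma unip_upper_SL: "u \<in> unip_upper n \<Longrightarrow> u \<in> carrier (SL n)"
  using det_upper_triangular[of u "n + 1"] prod_list_diag_mat[of u "n + 1"]
  by (auto simp: unip_upper_def)

lemma unip_lower_SL: "u \<in> unip_lower n \<Longrightarrow> u \<in> carrier (SL n)"
  using det_lower_triangular[of "n + 1" u] prod_list_diag_mat[of u "n + 1"] unip_lowerD[of u n]
  by auto

text \<open>Once \<open>triangular_factor\<close> has split off the diagonal, membership in
  \<open>borel_minus\<close> amounts to being lower triangular of determinant one, so later proofs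
  only check entries.\<close>

lemma borel_minusI:
  assumes g: "g \<in> carrier (SL n)" and low: "\<And>r s. r < s \<Longrightarrow> s < n + 1 \<Longrightarrow> g $$ (r, s) = 0"
  shows "g \<in> borel_minus n"
proof -
  have gc: "g \<in> carrier_mat (n + 1) (n + 1)" using g by auto
  have d: "(\<Prod>i<n + 1. g $$ (i, i)) = 1"
    using det_lower_triangular[OF low gc] prod_list_diag_mat[OF gc] g by simp
  obtain t u where tu: "t \<in> torus n" "u \<in> carrier_mat (n + 1) (n + 1)" "g = t * u"
    "\<forall>i < n + 1. u $$ (i, i) = 1"
    "\<forall>i < n + 1. \<forall>k < n + 1. g $$ (i, k) = 0 \<longrightarrow> u $$ (i, k) = 0"
    using triangular_factor[OF gc d] by blast
  then have "u \<in> unip_lower n" using low by (intro unip_lowerI) auto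
  then show ?thesis using tu unfolding borel_minus_def by blast
qed

lemma borel_minusD:
  assumes "b \<in> borel_minus n"
  shows "b \<in> carrier (SL n)" "\<And>r s. r < s \<Longrightarrow> s < n + 1 \<Longrightarrow> b $$ (r, s) = 0"
    "\<And>r. r < n + 1 \<Longrightarrow> b $$ (r, r) \<noteq> 0"
proof -
  obtain t v where b: "b = t * v" "t \<in> torus n" "v \<in> unip_lower n"
    using assms by (auto simp: borel_minus_def)
  have "t \<in> carrier (SL n)" using b by (auto simp: torus_def)
  then show "b \<in> carrier (SL n)"
    using unip_lower_SL[OF b(3)] group.is_monoid[OF group_SL, THEN monoid.m_closed, of t n v]
    by (simp add: b(1))
  show "b $$ (r, s) = 0" if "r < s" "s < n + 1" for r s
    using that torus_mult_entry(1)[OF b(2) unip_lowerD(1)[OF b(3)]] unip_lowerD(2)[OF b(3)]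
    by (simp add: b(1))
  show "b $$ (r, r) \<noteq> 0" if "r < n + 1" for r
    using that torus_mult_entry(1)[OF b(2) unip_lowerD(1)[OF b(3)]] unip_lowerD(3)[OF b(3)]
      torusD(4)[OF b(2)] by (simp add: b(1))
qed

section \<open>Generation of U by the simple root subgroups\<close>

text \<open>This is the commutator relation of elementary matrices: the place (i, l) is reached from
  (i, k) and (k, l), the factors with -a and -1 being the inverses.\<close>

lemma addrow_commutator:
  fixes a :: complex
  assumes "i < m" "k < m" "l < m" "i \<noteq> k" "k \<noteq> l" "i \<noteq> l"
  shows "addrow_mat m a i l = addrow_mat m a i k * (addrow_mat m 1 k l *
    (addrow_mat m (- a) i k * addrow_mat m (- 1) k l))"
proof -
  have *: "addrow_mat m b i' k' * A = addrow b i' k' A" if "A \<in> carrier_mat m m" "k' < m" for b i' k' and A :: "complex mat"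
    by (rule addrow_mat_mult[OF that])
  show ?thesis
    using assms by (simp add: *) (intro eq_matI; auto)
qed

text \<open>Generators enter from the left only, so each induction step is a row operation; closure
  under arbitrary products is \<open>unip_gen_mult\<close>.\<close>

inductive_set unip_gen :: "nat \<Rightarrow> complex mat set" for n where
  one: "1\<^sub>m (n + 1) \<in> unip_gen n"
| step: "i \<in> {1..n} \<Longrightarrow> g \<in> unip_gen n \<Longrightarrow> x_root n i c * g \<in> unip_gen n"

lemma x_root_mult:
  "i \<in> {1..n} \<Longrightarrow> A \<in> carrier_mat (n + 1) k \<Longrightarrow> x_root n i c * A = addrow c (i - 1) i A"
  by (simp add: x_root_eq addrow_mat_mult)

lemma y_root_mult:
  "i \<in> {1..n} \<Longrightarrow> A \<in> carrier_mat (n + 1) k \<Longrightarrow> y_root n i c * A = addrow c i (i - 1) A"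
  by (simp add: y_root_eq addrow_mat_mult less_imp_diff_less)

lemma x_root_carrier [simp]: "i \<in> {1..n} \<Longrightarrow> x_root n i c \<in> carrier_mat (n + 1) (n + 1)"
  by (simp add: x_root_eq)

lemma y_root_carrier [simp]: "i \<in> {1..n} \<Longrightarrow> y_root n i c \<in> carrier_mat (n + 1) (n + 1)"
  by (simp add: y_root_eq)

lemma x_root_neg: "i \<in> {1..n} \<Longrightarrow> x_root n i c * x_root n i (- c) = 1\<^sub>m (n + 1)"
  unfolding x_root_eq by (rule addrow_mat_inv) auto

lemma y_root_neg: "i \<in> {1..n} \<Longrightarrow> y_root n i c * y_root n i (- c) = 1\<^sub>m (n + 1)"
  unfolding y_root_eq by (rule addrow_mat_inv) auto

lemma unip_gen_subset: "g \<in> unip_gen n \<Longrightarrow> g \<in> unip_upper n"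
proof (induction rule: unip_gen.induct)
  case one
  show ?case by (auto intro!: unip_upperI)
next
  case (step i g c)
  then show ?case
    using unip_upperD[OF step.IH] by (subst x_root_mult[OF step.hyps(1) unip_upperD(1)[OF step.IH]])
      (auto intro!: unip_upperI)
qed

lemma unip_gen_mult:
  assumes "g \<in> unip_gen n" "h \<in> unip_gen n"
  shows "g * h \<in> unip_gen n"
  using assms(1)
proof (induction rule: unip_gen.induct)
  case one
  then show ?case using unip_upperD(1)[OF unip_gen_subset[OF assms(2)]] assms(2) by simp
next
  case (step i g c)
  have "x_root n i c * g * h = x_root n i c * (g * h)"
    by (intro assoc_mult_mat[of _ "n+1" "n+1" _ "n+1" _ "n+1"] x_root_carrier step.hyps unip_upperD(1) unip_gen_subset assms(2))
  then show ?case using step unip_gen.step by simp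
qed

lemma x_root_unip_gen: "i \<in> {1..n} \<Longrightarrow> x_root n i c \<in> unip_gen n"
  using unip_gen.step[OF _ unip_gen.one, of i n c] right_mult_one_mat[OF x_root_carrier, of i n c] by simp

text \<open>Induction on the distance s - r from the diagonal: a place beyond the superdiagonal is a
  commutator through s - 1, formed from an elementary matrix closer to the diagonal and a simple
  root element.\<close>

lemma addrow_unip_gen:
  assumes "r < s" "s < n + 1"
  shows "addrow_mat (n + 1) a r s \<in> unip_gen n"
  using assms
proof (induction "s - r" arbitrary: s a rule: less_induct)
  case less
  show ?case
  proof (cases "s = r + 1")
    case True
    then show ?thesis using x_root_unip_gen[of s n a] less.prems by (simp add: x_root_eq)
  next
    case False
    let ?k = "s - 1"
    have k: "r < ?k" "?k < n + 1" "?k - r < s - r" using False less.prems by auto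
    have 1: "addrow_mat (n + 1) b r ?k \<in> unip_gen n" for b
      using less.hyps[OF k(3,1,2)] .
    have 2: "addrow_mat (n + 1) b ?k s \<in> unip_gen n" for b
      using x_root_unip_gen[of s n b] less.prems by (simp add: x_root_eq)
    have "addrow_mat (n + 1) a r s = addrow_mat (n + 1) a r ?k * (addrow_mat (n + 1) 1 ?k s *
      (addrow_mat (n + 1) (- a) r ?k * addrow_mat (n + 1) (- 1) ?k s))"
      using less.prems k by (intro addrow_commutator) auto
    then show ?thesis using 1 2 by (simp add: unip_gen_mult)
  qed
qed

text \<open>Induction on the number of nonzero entries above the diagonal: one suitable row
  operation clears one of them and keeps the others.\<close>

lemma unip_upper_gen: "u \<in> unip_upper n \<Longrightarrow> u \<in> unip_gen n"
proof (induction "card {(r, s). r < s \<and> s < n + 1 \<and> u $$ (r, s) \<noteq> 0}" arbitrary: u rule: less_induct)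
  case less
  define Z where "Z u = {(r, s). r < s \<and> s < n + 1 \<and> u $$ (r, s) \<noteq> (0::complex)}" for u
  have fin: "finite (Z u)" for u
    by (rule finite_subset[of _ "{..<n + 1} \<times> {..<n + 1}"]) (auto simp: Z_def)
  note u = unip_upperD[OF less.prems]
  show ?case
  proof (cases "Z u = {}")
    case True
    then have "u $$ (r, s) = 0" if "r < s" "s < n + 1" for r s
      using that unfolding Z_def by blast
    then have "u $$ (r, s) = (if r = s then 1 else 0)" if "r < n + 1" "s < n + 1" for r s
      using u(2,3) that by (cases r s rule: linorder_cases) simp_all
    then have "u = 1\<^sub>m (n + 1)"
      using u(1) by (intro eq_matI) simp_all
    then show ?thesis using unip_gen.one by simp
  next
    case False
    \<comment> \<open>In the lowest row that has a nonzero entry above the diagonal, the choice (r,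
      s) makes row \<open>s\<close> a unit row, so clearing (r, s) disturbs nothing else.\<close>
    define r where "r = Max (fst ` Z u)"
    have "r \<in> fst ` Z u" unfolding r_def using fin False by (intro Max_in) auto
    then obtain s where rs: "r < s" "s < n + 1" "u $$ (r, s) \<noteq> 0" by (auto simp: Z_def)
    have below: "u $$ (r', s') = 0" if "r < r'" "r' < s'" "s' < n + 1" for r' s'
    proof (rule ccontr)
      assume "u $$ (r', s') \<noteq> 0"
      then have "r' \<in> fst ` Z u" using that by (force simp: Z_def)
      then have "r' \<le> r" unfolding r_def using fin by simp
      then show False using that by simp
    qed
    define v where "v = addrow (- u $$ (r, s)) r s u"
    have v_entry: "v $$ (r', s') = (if r' = r \<and> s' = s then 0 else u $$ (r', s'))"
      if "r' < n + 1" "s' < n + 1" for r' s'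
    proof -
      have "u $$ (s, s') = (if s = s' then 1 else 0)"
        using u(2,3) that rs below[OF rs(1), of s'] by (cases s s' rule: linorder_cases) simp_all
      then show ?thesis using that u(1) rs(2) by (auto simp: v_def)
    qed
    have vc: "v \<in> carrier_mat (n + 1) (n + 1)" using u by (simp add: v_def)
    then have v: "v \<in> unip_upper n"
      using u rs by (intro unip_upperI) (auto simp: v_entry)
    have "Z v = Z u - {(r, s)}" using rs by (auto simp: Z_def v_entry split: if_splits)
    then have "card (Z v) < card (Z u)"
      using rs by (simp only:) (rule card_Diff1_less[OF fin], simp add: Z_def)
    then have "v \<in> unip_gen n" using less.hyps[of v] v by (simp add: Z_def)
    then have "addrow_mat (n + 1) (u $$ (r, s)) r s * v \<in> unip_gen n"
      by (rule unip_gen_mult[OF addrow_unip_gen[OF rs(1,2)]])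
    also have "addrow_mat (n + 1) (u $$ (r, s)) r s * v = u"
      using u vc rs by (subst addrow_mat_mult[OF vc rs(2)]) (auto simp: v_def intro!: eq_matI)
    finally show ?thesis .
  qed
qed

lemma unip_upper_mult: "u \<in> unip_upper n \<Longrightarrow> v \<in> unip_upper n \<Longrightarrow> u * v \<in> unip_upper n"
  using unip_gen_mult unip_gen_subset unip_upper_gen by blast

lemma unip_upper_inverse:
  assumes "u \<in> unip_upper n"
  shows "inv\<^bsub>SL n\<^esub> u \<in> unip_upper n"
  using unip_upper_gen[OF assms]
proof (induction rule: unip_gen.induct)
  case one
  show ?case using monoid.inv_one[OF group.is_monoid[OF group_SL], of n] unip_gen_subset[OF unip_gen.one]
    by simp
next
  case (step i g c)
  have x: "x_root n i c \<in> unip_upper n" for c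
    by (rule unip_gen_subset[OF x_root_unip_gen[OF step.hyps(1)]])
  have g: "g \<in> unip_upper n" by (rule unip_gen_subset[OF step.hyps(2)])
  have "inv\<^bsub>SL n\<^esub> (x_root n i c * g) = inv\<^bsub>SL n\<^esub> g * inv\<^bsub>SL n\<^esub> (x_root n i c)"
    using group.inv_mult_group[OF group_SL unip_upper_SL[OF x] unip_upper_SL[OF g]] by simp
  also have "inv\<^bsub>SL n\<^esub> (x_root n i c) = x_root n i (- c)"
    using x_root_neg[OF step.hyps(1), of "- c"] unip_upper_SL[OF x] by (intro inv_SL_eq) auto
  finally show ?case using unip_upper_mult[OF step.IH x] by simp
qed

section \<open>Generation of SL and the characters\<close>

text \<open>These are the elements on which the definition of \<open>eta\<close> prescribes values,
  so induction over \<open>SL_gen\<close> yields uniqueness. A step from the left is a row operation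
  or a scaling of rows.\<close>

inductive_set SL_gen :: "nat \<Rightarrow> complex mat set" for n where
  one: "1\<^sub>m (n + 1) \<in> SL_gen n"
| x: "i \<in> {1..n} \<Longrightarrow> g \<in> SL_gen n \<Longrightarrow> x_root n i c * g \<in> SL_gen n"
| y: "i \<in> {1..n} \<Longrightarrow> g \<in> SL_gen n \<Longrightarrow> y_root n i c * g \<in> SL_gen n"
| t: "t \<in> torus n \<Longrightarrow> g \<in> SL_gen n \<Longrightarrow> t * g \<in> SL_gen n"

lemma SL_mult_closed: "g \<in> carrier (SL n) \<Longrightarrow> h \<in> carrier (SL n) \<Longrightarrow> g * h \<in> carrier (SL n)"
  using monoid.m_closed[OF group.is_monoid[OF group_SL], of g n h] by simp

lemma x_root_SL: "i \<in> {1..n} \<Longrightarrow> x_root n i c \<in> carrier (SL n)"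
  using det_addrow_mat[of "i - 1" i "n + 1" c] x_root_carrier[of i n c] by (auto simp: x_root_eq)

lemma y_root_SL: "i \<in> {1..n} \<Longrightarrow> y_root n i c \<in> carrier (SL n)"
  using det_addrow_mat[of i "i - 1" "n + 1" c] y_root_carrier[of i n c] by (auto simp: y_root_eq)

lemma torus_SL: "t \<in> torus n \<Longrightarrow> t \<in> carrier (SL n)"
  by (simp add: torus_def)

text \<open>Multiplying by x_i(-c) undoes a row operation: to generate \<open>g\<close> it suffices
  to generate the matrix after one elimination step.\<close>

lemma SL_gen_x_cancel:
  assumes "i \<in> {1..n}" "g \<in> carrier_mat (n + 1) (n + 1)" "x_root n i c * g \<in> SL_gen n"
  shows "g \<in> SL_gen n"
proof -
  have "x_root n i (- c) * (x_root n i c * g) = (x_root n i (- c) * x_root n i c) * g"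
    by (rule assoc_mult_mat[symmetric, of _ "n+1" "n+1" _ "n+1" _ "n+1"]) (use assms x_root_carrier in auto)
  also have "\<dots> = g"
    using x_root_neg[OF assms(1), of "- c"] assms(2) by simp
  finally show ?thesis using SL_gen.x[OF assms(1,3), of "- c"] by simp
qed

lemma SL_gen_y_cancel:
  assumes "i \<in> {1..n}" "g \<in> carrier_mat (n + 1) (n + 1)" "y_root n i c * g \<in> SL_gen n"
  shows "g \<in> SL_gen n"
proof -
  have "y_root n i (- c) * (y_root n i c * g) = (y_root n i (- c) * y_root n i c) * g"
    by (rule assoc_mult_mat[symmetric, of _ "n+1" "n+1" _ "n+1" _ "n+1"]) (use assms y_root_carrier in auto)
  also have "\<dots> = g"
    using y_root_neg[OF assms(1), of "- c"] assms(2) by simp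
  finally show ?thesis using SL_gen.y[OF assms(1,3), of "- c"] by simp
qed

lemma unip_upper_SL_gen: "u \<in> unip_upper n \<Longrightarrow> u \<in> SL_gen n"
proof (drule unip_upper_gen, induction rule: unip_gen.induct)
  case one
  show ?case by (rule SL_gen.one)
qed (rule SL_gen.x)

lemma upper_triangular_SL_gen:
  assumes g: "g \<in> carrier (SL n)" and up: "\<And>r s. s < r \<Longrightarrow> r < n + 1 \<Longrightarrow> g $$ (r, s) = 0"
  shows "g \<in> SL_gen n"
proof -
  have gc: "g \<in> carrier_mat (n + 1) (n + 1)" using g by simp
  have "upper_triangular g" using up gc by auto
  then have d: "(\<Prod>i<n + 1. g $$ (i, i)) = 1"
    using det_upper_triangular[OF _ gc] prod_list_diag_mat[OF gc] g by simp
  obtain t u where tu: "t \<in> torus n" "u \<in> carrier_mat (n + 1) (n + 1)" "g = t * u"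
    "\<forall>i < n + 1. u $$ (i, i) = 1"
    "\<forall>i < n + 1. \<forall>k < n + 1. g $$ (i, k) = 0 \<longrightarrow> u $$ (i, k) = 0"
    using triangular_factor[OF gc d] by blast
  then have "u \<in> unip_upper n" using up by (intro unip_upperI) auto
  then show ?thesis using tu SL_gen.t unip_upper_SL_gen by simp
qed

text \<open>Gaussian elimination by adjacent row operations, column by column and from the bottom up.\<close>

lemma SL_gen_column_step:
  assumes k: "k < n + 1"
    and IH: "\<And>g. g \<in> carrier (SL n) \<Longrightarrow> (\<And>r s. s < r \<Longrightarrow> r < n + 1 \<Longrightarrow> s < k + 1 \<Longrightarrow> g $$ (r, s) = 0)
      \<Longrightarrow> g \<in> SL_gen n"
    and r: "k \<le> r" "r \<le> n"
    and g: "g \<in> carrier (SL n)" "\<And>r s. s < r \<Longrightarrow> r < n + 1 \<Longrightarrow> s < k \<Longrightarrow> g $$ (r, s) = 0"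
      "\<And>q. r < q \<Longrightarrow> q < n + 1 \<Longrightarrow> g $$ (q, k) = 0"
  shows "g \<in> SL_gen n"
  using r g
proof (induction r arbitrary: g rule: dec_induct)
  case base
  show ?case
  proof (rule IH[OF base(2)])
    fix r s assume "s < r" "r < n + 1" "s < k + 1"
    then show "g $$ (r, s) = 0"
      using base(3)[of s r] base(4)[of r] by (cases "s = k") auto
  qed
next
  case (step m)
  have gc: "g \<in> carrier_mat (n + 1) (n + 1)" using step.prems(2) by simp
  have i: "Suc m \<in> {1..n}" using step.prems by simp
  \<comment> \<open>With a nonzero pivot in row \<open>m\<close>, one element of the y-subgroup
    clears row m + 1 of column \<open>k\<close>; the columns before \<open>k\<close> vanish in both
    rows and stay so.\<close>
  have nonzero: "h \<in> SL_gen n"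
    if h: "h \<in> carrier (SL n)" "\<And>r s. s < r \<Longrightarrow> r < n + 1 \<Longrightarrow> s < k \<Longrightarrow> h $$ (r, s) = 0"
      "\<And>q. Suc m < q \<Longrightarrow> q < n + 1 \<Longrightarrow> h $$ (q, k) = 0" "h $$ (m, k) \<noteq> 0" for h
  proof -
    define c where "c = - h $$ (Suc m, k) / h $$ (m, k)"
    have hc: "h \<in> carrier_mat (n + 1) (n + 1)" using h(1) by simp
    have eq: "y_root n (Suc m) c * h = addrow c (Suc m) m h"
      using y_root_mult[OF i hc, of c] by simp
    have "y_root n (Suc m) c * h \<in> SL_gen n"
    proof (rule step.IH)
      show "y_root n (Suc m) c * h \<in> carrier (SL n)"
        by (rule SL_mult_closed[OF y_root_SL[OF i] h(1)])
      show "(y_root n (Suc m) c * h) $$ (r, s) = 0" if "s < r" "r < n + 1" "s < k" for r s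
        unfolding eq using that hc h(2)[of s r] h(2)[of s m] step.hyps by auto
      show "(y_root n (Suc m) c * h) $$ (q, k) = 0" if "m < q" "q < n + 1" for q
        unfolding eq using that hc k h(3)[of q] h(4) by (cases "q = Suc m") (auto simp: c_def)
    qed (use step.prems in simp)
    then show ?thesis by (rule SL_gen_y_cancel[OF i hc])
  qed
  show ?case
  proof (cases "g $$ (m, k) = 0")
    case False
    then show ?thesis using nonzero[of g] step.prems by blast
  next
    case True
    show ?thesis
    proof (cases "g $$ (Suc m, k) = 0")
      case True
      show ?thesis
      proof (rule step.IH)
        show "g $$ (q, k) = 0" if "m < q" "q < n + 1" for q
          using that True step.prems(4)[of q] by (cases "q = Suc m") auto
      qed (use step.prems in auto)
    next
      case False
      \<comment> \<open>The pivot vanishes but the entry below it does not: adding row m + 1 to row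
        \<open>m\<close> makes the pivot nonzero.\<close>
      have eq: "x_root n (Suc m) 1 * g = addrow 1 m (Suc m) g"
        using x_root_mult[OF i gc, of 1] by simp
      have "x_root n (Suc m) 1 * g \<in> SL_gen n"
      proof (rule nonzero)
        show "x_root n (Suc m) 1 * g \<in> carrier (SL n)"
          by (rule SL_mult_closed[OF x_root_SL[OF i] step.prems(2)])
        show "(x_root n (Suc m) 1 * g) $$ (r, s) = 0" if "s < r" "r < n + 1" "s < k" for r s
          unfolding eq using that gc step.prems(1) step.prems(3)[of s r] step.prems(3)[of s "Suc m"] step.hyps by auto
        show "(x_root n (Suc m) 1 * g) $$ (q, k) = 0" if "Suc m < q" "q < n + 1" for q
          unfolding eq using that gc k step.prems(4)[of q] by auto
        show "(x_root n (Suc m) 1 * g) $$ (m, k) \<noteq> 0"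
          unfolding eq using gc k i True False by auto
      qed
      then show ?thesis by (rule SL_gen_x_cancel[OF i gc])
    qed
  qed
qed

text \<open>Downward induction on the number \<open>k\<close> of cleared columns: for k = n + 1 the
  matrix is upper triangular, for k = 0 it is arbitrary.\<close>

lemma SL_generated: "g \<in> carrier (SL n) \<Longrightarrow> g \<in> SL_gen n"
proof -
  have "g \<in> SL_gen n" if "k \<le> n + 1" "g \<in> carrier (SL n)"
    "\<And>r s. s < r \<Longrightarrow> r < n + 1 \<Longrightarrow> s < k \<Longrightarrow> g $$ (r, s) = 0" for k g
    using that
  proof (induction k arbitrary: g rule: inc_induct)
    case base
    show ?case by (rule upper_triangular_SL_gen[OF base(1)], rule base(2)) simp_all
  next
    case (step k)
    show ?case
    proof (rule SL_gen_column_step[of k n n])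
      fix g assume g: "g \<in> carrier (SL n)"
        "\<And>r s. s < r \<Longrightarrow> r < n + 1 \<Longrightarrow> s < k + 1 \<Longrightarrow> g $$ (r, s) = 0"
      show "g \<in> SL_gen n" by (rule step.IH[OF g(1)], rule g(2)) simp_all
    qed (use step in auto)
  qed
  from this[of 0 g] show "g \<in> carrier (SL n) \<Longrightarrow> g \<in> SL_gen n" by simp
qed

section \<open>The characters of U\<close>

text \<open>In the sum for this entry of the product only the summands k = i - 1 and k = i survive,
  and each has one factor equal to 1.\<close>

lemma unip_upper_superdiagonal:
  assumes "u \<in> unip_upper n" "v \<in> unip_upper n" "i \<in> {1..n}"
  shows "(u * v) $$ (i - 1, i) = u $$ (i - 1, i) + v $$ (i - 1, i)"
proof -
  note u = unip_upperD[OF assms(1)] and v = unip_upperD[OF assms(2)]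
  obtain m where m: "i = Suc m" "m < n" using assms(3) by (cases i) auto
  have "(u * v) $$ (m, Suc m) = (\<Sum>k<n + 1. u $$ (m, k) * v $$ (k, Suc m))"
    using m by (intro index_mult_mat_sum[OF u(1) v(1)]) auto
  also have "\<dots> = (\<Sum>k \<in> {m, Suc m}. u $$ (m, k) * v $$ (k, Suc m))"
  proof (rule sum.mono_neutral_right)
    show "\<forall>k \<in> {..<n + 1} - {m, Suc m}. u $$ (m, k) * v $$ (k, Suc m) = 0"
    proof
      fix k assume "k \<in> {..<n + 1} - {m, Suc m}"
      then show "u $$ (m, k) * v $$ (k, Suc m) = 0"
        using u(2)[of k m] v(2)[of "Suc m" k] m by (cases "k < m") auto
    qed
  qed (use m in auto)
  also have "\<dots> = u $$ (m, Suc m) + v $$ (m, Suc m)"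
    using u(3) v(3) m by simp
  finally show ?thesis by (simp add: m)
qed

text \<open>The superdiagonal entry has all defining properties of \<open>chi\<close>; conversely
  these fix the values on the generators, and additivity carries them to all of U.\<close>

lemma chi_eq:
  assumes "u \<in> unip_upper n" "i \<in> {1..n}"
  shows "chi n i u = u $$ (i - 1, i)"
proof -
  let ?P = "\<lambda>f. f \<in> extensional (unip_upper n) \<and>
     (\<forall>u \<in> unip_upper n. \<forall>v \<in> unip_upper n. f (u * v) = f u + f v) \<and>
     (\<forall>j \<in> {1..n}. \<forall>c. f (x_root n j c) = (if i = j then c else (0::complex)))"
  let ?f = "restrict (\<lambda>u. u $$ (i - 1, i)) (unip_upper n)"
  have x: "x_root n j c \<in> unip_upper n" if "j \<in> {1..n}" for j c
    using that by (intro unip_gen_subset x_root_unip_gen)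
  have one: "1\<^sub>m (n + 1) \<in> unip_upper n" by (intro unip_gen_subset unip_gen.one)
  have "chi n i = ?f"
    unfolding chi_def
  proof (rule the_equality)
    show "?P ?f"
      using unip_upper_superdiagonal[OF _ _ assms(2)] unip_upper_mult x assms(2)
      by (auto simp: x_root_eq)
  next
    fix f assume f: "?P f"
    show "f = ?f"
    proof (rule extensionalityI)
      fix u assume "u \<in> unip_upper n"
      then have "u \<in> unip_gen n" by (rule unip_upper_gen)
      then show "f u = ?f u"
      proof (induction rule: unip_gen.induct)
        case one
        have "f (1\<^sub>m (n + 1) * 1\<^sub>m (n + 1)) = f (1\<^sub>m (n + 1)) + f (1\<^sub>m (n + 1))"
          using f \<open>1\<^sub>m (n + 1) \<in> unip_upper n\<close> by blast
        then show ?case using \<open>1\<^sub>m (n + 1) \<in> unip_upper n\<close> assms(2) by auto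
      next
        case (step j g c)
        have g: "g \<in> unip_upper n" using step.hyps(2) by (rule unip_gen_subset)
        have "f (x_root n j c * g) = f (x_root n j c) + f g"
          using f x[OF step.hyps(1)] g by blast
        also have "\<dots> = (if i = j then c else 0) + g $$ (i - 1, i)"
          using f step g by simp
        also have "(if i = j then c else 0) = x_root n j c $$ (i - 1, i)"
          using step.hyps(1) assms(2) by (auto simp: x_root_eq)
        also have "\<dots> + g $$ (i - 1, i) = (x_root n j c * g) $$ (i - 1, i)"
          by (rule unip_upper_superdiagonal[OF x[OF step.hyps(1)] g assms(2), symmetric])
        finally show ?case using unip_upper_mult[OF x[OF step.hyps(1)] g] by simp
      qed
    qed (use f in auto)
  qed
  then show ?thesis using assms by simp
qed

section \<open>The anti-automorphism and the projection to U\<close>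

text \<open>Conjugation by D = diag(1, -1, 1, ...), see \<open>alt_conj_eq_conj\<close>, in
  entrywise form; D itself may have determinant -1 and lie outside the group.\<close>

definition alt_conj :: "nat \<Rightarrow> complex mat \<Rightarrow> complex mat" where
  "alt_conj n A = mat (n + 1) (n + 1) (\<lambda>(r, s). (- 1) ^ (r + s) * A $$ (r, s))"

lemma alt_conj_carrier [simp]: "alt_conj n A \<in> carrier_mat (n + 1) (n + 1)"
  by (simp add: alt_conj_def)

lemma alt_conj_entry:
  "r < n + 1 \<Longrightarrow> s < n + 1 \<Longrightarrow> alt_conj n A $$ (r, s) = (- 1) ^ (r + s) * A $$ (r, s)"
  by (simp add: alt_conj_def)

lemma minus_one_power_square: "(- 1 :: complex) ^ k * (- 1) ^ k = 1"
  by (simp flip: power_mult_distrib)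

lemma alt_conj_alt_conj: "A \<in> carrier_mat (n + 1) (n + 1) \<Longrightarrow> alt_conj n (alt_conj n A) = A"
  by (intro eq_matI) (auto simp: alt_conj_def minus_one_power_square simp flip: mult.assoc)

lemma alt_conj_one: "alt_conj n (1\<^sub>m (n + 1)) = 1\<^sub>m (n + 1)"
  by (intro eq_matI) (auto simp: alt_conj_def power_add minus_one_power_square)

lemma alt_conj_mult:
  assumes A: "A \<in> carrier_mat (n + 1) (n + 1)" and B: "B \<in> carrier_mat (n + 1) (n + 1)"
  shows "alt_conj n (A * B) = alt_conj n A * alt_conj n B"
proof (rule eq_matI)
  fix r s
  assume "r < dim_row (alt_conj n A * alt_conj n B)" "s < dim_col (alt_conj n A * alt_conj n B)"
  then have rs: "r < n + 1" "s < n + 1" by (simp_all add: alt_conj_def)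
  have *: "(- 1) ^ (r + s) * (a * b) = (- 1) ^ (r + k) * a * ((- 1) ^ (k + s) * b)" for k and a b :: complex
    using minus_one_power_square[of k] by (simp add: power_add algebra_simps)
  show "alt_conj n (A * B) $$ (r, s) = (alt_conj n A * alt_conj n B) $$ (r, s)"
    unfolding alt_conj_entry[OF rs] index_mult_mat_sum[OF A B rs]
      index_mult_mat_sum[OF alt_conj_carrier alt_conj_carrier rs]
    by (simp only: sum_distrib_left, intro sum.cong refl) (simp only: alt_conj_entry rs * lessThan_iff)
qed (simp_all add: alt_conj_def)

lemma alt_conj_eq_conj:
  assumes A: "A \<in> carrier_mat (n + 1) (n + 1)"
  shows "alt_conj n A = mat_diag (n + 1) (\<lambda>i. (- 1) ^ i) * A * mat_diag (n + 1) (\<lambda>i. (- 1) ^ i)"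
proof -
  have 1: "mat_diag (n + 1) (\<lambda>i. (- 1) ^ i) * A \<in> carrier_mat (n + 1) (n + 1)"
    using mult_carrier_mat[OF mat_diag_dim A] .
  show ?thesis
    unfolding mat_diag_mult_right[OF 1] unfolding mat_diag_mult_left[OF A]
    by (intro eq_matI) (auto simp: alt_conj_def power_add)
qed

lemma alt_conj_SL: "A \<in> carrier (SL n) \<Longrightarrow> alt_conj n A \<in> carrier (SL n)"
proof -
  assume "A \<in> carrier (SL n)"
  then have A: "A \<in> carrier_mat (n + 1) (n + 1)" "det A = 1" by auto
  let ?D = "mat_diag (n + 1) (\<lambda>i. (- 1) ^ i) :: complex mat"
  have D: "?D \<in> carrier_mat (n + 1) (n + 1)" by simp
  have "?D * ?D = 1\<^sub>m (n + 1)" by (simp add: minus_one_power_square)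
  then have "det ?D * det ?D = 1" using det_mult[OF D D] by simp
  moreover have "det (alt_conj n A) = det ?D * det A * det ?D"
    unfolding alt_conj_eq_conj[OF A(1)] det_mult[OF mult_carrier_mat[OF D A(1)] D] det_mult[OF D A(1)] ..
  ultimately show ?thesis using A alt_conj_carrier by simp
qed

lemma inv_alt_conj:
  assumes "g \<in> carrier (SL n)"
  shows "inv\<^bsub>SL n\<^esub> (alt_conj n g) = alt_conj n (inv\<^bsub>SL n\<^esub> g)"
proof (rule inv_SL_eq)
  have "alt_conj n (inv\<^bsub>SL n\<^esub> g) * alt_conj n g = alt_conj n (inv\<^bsub>SL n\<^esub> g * g)"
    using assms inv_SL_closed[OF assms] by (intro alt_conj_mult[symmetric]) auto
  then show "alt_conj n (inv\<^bsub>SL n\<^esub> g) * alt_conj n g = 1\<^sub>m (n + 1)"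
    using inv_SL_mult(1)[OF assms] alt_conj_one by simp
qed (intro alt_conj_SL inv_SL_closed assms)+

lemma inv_x_root: "i \<in> {1..n} \<Longrightarrow> inv\<^bsub>SL n\<^esub> (x_root n i c) = x_root n i (- c)"
  using x_root_neg[of i n "- c"] by (intro inv_SL_eq x_root_SL) auto

lemma inv_y_root: "i \<in> {1..n} \<Longrightarrow> inv\<^bsub>SL n\<^esub> (y_root n i c) = y_root n i (- c)"
  using y_root_neg[of i n "- c"] by (intro inv_SL_eq y_root_SL) auto

lemma inv_torus:
  assumes t: "t \<in> torus n"
  shows "inv\<^bsub>SL n\<^esub> t = mat_diag (n + 1) (\<lambda>i. inverse (t $$ (i, i)))"
    "mat_diag (n + 1) (\<lambda>i. inverse (t $$ (i, i))) \<in> torus n"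
proof -
  let ?s = "mat_diag (n + 1) (\<lambda>i. inverse (t $$ (i, i)))"
  have tc: "t \<in> carrier_mat (n + 1) (n + 1)" using torusD[OF t] by simp
  have "upper_triangular t" using t tc by (auto simp: torus_def diagonal_mat_def)
  then have "(\<Prod>i<n + 1. t $$ (i, i)) = 1"
    using det_upper_triangular[OF _ tc] prod_list_diag_mat[OF tc] torusD(2)[OF t] by simp
  then have "(\<Prod>i<n + 1. inverse (t $$ (i, i))) = 1" using prod_inversef[of "\<lambda>i. t $$ (i, i)" "{..<n + 1}"] by (simp only: comp_def inverse_1)
  then show s: "?s \<in> torus n" by (rule torusI_diag)
  have "?s * t = mat_diag (n + 1) (\<lambda>i. inverse (t $$ (i, i)) * t $$ (i, i))"
    by (subst (2) torusD(3)[OF t]) (rule mat_diag_diag)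
  also have "\<dots> = 1\<^sub>m (n + 1)"
    using torusD(4)[OF t] by (intro eq_matI) (auto simp: mat_diag_def)
  finally show "inv\<^bsub>SL n\<^esub> t = ?s"
    using torus_SL[OF t] torus_SL[OF s] by (rule inv_SL_eq)
qed

lemma inv_SL_mult_distrib:
  "g \<in> carrier (SL n) \<Longrightarrow> h \<in> carrier (SL n) \<Longrightarrow>
    inv\<^bsub>SL n\<^esub> (g * h) = inv\<^bsub>SL n\<^esub> h * inv\<^bsub>SL n\<^esub> g"
  using group.inv_mult_group[OF group_SL, of g n h] by simp

lemma one_SL: "1\<^sub>m (n + 1) \<in> carrier (SL n)"
  by simp

text \<open>The map sending g to D g^-1 D reverses products, and the sign that D puts on a
  superdiagonal or subdiagonal entry undoes the sign from inverting x_i(c) or y_i(c). Any other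
  candidate agrees with it on the generators, hence everywhere.\<close>

lemma eta_eq:
  assumes "g \<in> carrier (SL n)"
  shows "eta n g = alt_conj n (inv\<^bsub>SL n\<^esub> g)"
proof -
  let ?G = "carrier (SL n)"
  let ?P = "\<lambda>h. h \<in> extensional ?G \<and> bij_betw h ?G ?G \<and>
     (\<forall>g \<in> ?G. \<forall>k \<in> ?G. h (g * k) = h k * h g) \<and>
     (\<forall>i \<in> {1..n}. \<forall>c. h (x_root n i c) = x_root n i c \<and> h (y_root n i c) = y_root n i c) \<and>
     (\<forall>t \<in> torus n. h t = inv\<^bsub>SL n\<^esub> t)"
  define f where "f = restrict (\<lambda>g. alt_conj n (inv\<^bsub>SL n\<^esub> g)) ?G"
  have f_eq: "f g = alt_conj n (inv\<^bsub>SL n\<^esub> g)" if "g \<in> ?G" for g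
    using that by (simp add: f_def)
  have f_closed: "f g \<in> ?G" if "g \<in> ?G" for g
    unfolding f_eq[OF that] by (intro alt_conj_SL inv_SL_closed that)
  have carr: "g \<in> carrier_mat (n + 1) (n + 1)" if "g \<in> ?G" for g using that by simp
  \<comment> \<open>Being an involution, the map is its own inverse, which later gives
    bijectivity.\<close>
  have f_f: "f (f g) = g" if "g \<in> ?G" for g
    unfolding f_eq[OF f_closed[OF that]] unfolding f_eq[OF that] inv_alt_conj[OF inv_SL_closed[OF that]]
    using group.inv_inv[OF group_SL that] alt_conj_alt_conj[OF carr[OF that]] by simp
  have f_mult: "f (g * k) = f k * f g" if "g \<in> ?G" "k \<in> ?G" for g k
    unfolding f_eq[OF that(1)] f_eq[OF that(2)] f_eq[OF SL_mult_closed[OF that]]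
      inv_SL_mult_distrib[OF that]
    by (intro alt_conj_mult carr inv_SL_closed that)
  have odd: "(- 1) ^ (i - Suc 0) * (- 1) ^ i = (- 1 :: complex)"
    "(- 1) ^ i * (- 1) ^ (i - Suc 0) = (- 1 :: complex)" if "i \<ge> 1" for i :: nat
    using that minus_one_power_square[of "i - 1"] by (cases i; simp)+
  have f_x: "f (x_root n i c) = x_root n i c" if "i \<in> {1..n}" for i c
  proof -
    have "alt_conj n (x_root n i (- c)) = x_root n i c"
      using that odd[of i] unfolding x_root_eq[OF that]
      by (intro eq_matI) (auto simp: alt_conj_def power_add minus_one_power_square)
    then show ?thesis by (simp only: f_eq[OF x_root_SL[OF that]] inv_x_root[OF that])
  qed
  have f_y: "f (y_root n i c) = y_root n i c" if "i \<in> {1..n}" for i c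
  proof -
    have "alt_conj n (y_root n i (- c)) = y_root n i c"
      using that odd[of i] unfolding y_root_eq[OF that]
      by (intro eq_matI) (auto simp: alt_conj_def power_add minus_one_power_square)
    then show ?thesis by (simp only: f_eq[OF y_root_SL[OF that]] inv_y_root[OF that])
  qed
  have f_t: "f t = inv\<^bsub>SL n\<^esub> t" if "t \<in> torus n" for t
    unfolding f_eq[OF torus_SL[OF that]] inv_torus(1)[OF that]
    by (intro eq_matI) (auto simp: alt_conj_def mat_diag_def power_add minus_one_power_square)
  have "eta n = f"
    unfolding eta_def
  proof (rule the_equality)
    have "bij_betw f ?G ?G"
      by (rule bij_betw_byWitness[of _ f]) (use f_f f_closed in auto)
    moreover have "f \<in> extensional ?G" by (simp add: f_def)
    ultimately show "?P f"
      using f_mult f_x f_y f_t by blast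
  next
    fix h assume h: "?P h"
    show "h = f"
    proof (rule extensionalityI)
      show "h \<in> extensional ?G" "f \<in> extensional ?G" using h by (auto simp: f_def)
      fix g assume "g \<in> ?G"
      then have "g \<in> SL_gen n" by (rule SL_generated)
      then have "g \<in> ?G \<and> h g = f g"
      proof (induction rule: SL_gen.induct)
        case one
        have "1\<^sub>m (n + 1) \<in> torus n" using torusI_diag[of "\<lambda>_. 1" n] by simp
        then show ?case using h f_t one_SL by metis
      next
        case (x i g c)
        then have "h (x_root n i c * g) = h g * h (x_root n i c)" using h x_root_SL by blast
        also have "\<dots> = f (x_root n i c * g)"
          using x h f_x f_mult[OF x_root_SL] by simp
        finally show ?case using x SL_mult_closed[OF x_root_SL] by simp
      next
        case (y i g c)
        then have "h (y_root n i c * g) = h g * h (y_root n i c)" using h y_root_SL by blast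
        also have "\<dots> = f (y_root n i c * g)"
          using y h f_y f_mult[OF y_root_SL] by simp
        finally show ?case using y SL_mult_closed[OF y_root_SL] by simp
      next
        case (t t g)
        then have "h (t * g) = h g * h t" using h torus_SL by blast
        also have "\<dots> = f (t * g)"
          using t h f_t f_mult[OF torus_SL] by simp
        finally show ?case using t SL_mult_closed[OF torus_SL] by simp
      qed
      then show "h g = f g" ..
    qed
  qed
  then show ?thesis using f_eq[OF assms] by simp
qed

section \<open>Uniqueness of the factorization in B^- U\<close>

text \<open>B^- and U meet only in the identity. Going down the rows, the earlier rows of
  \<open>w\<close> are unit rows, so the entry (r, s) of \<open>b * w\<close> is b_rr w_rs with b_rr
  nonzero.\<close>

lemma lower_times_unipotent_lower:
  assumes b: "b \<in> borel_minus n" and w: "w \<in> unip_upper n"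
    and low: "\<And>r s. r < s \<Longrightarrow> s < n + 1 \<Longrightarrow> (b * w) $$ (r, s) = 0"
  shows "w = 1\<^sub>m (n + 1)"
proof -
  have bc: "b \<in> carrier_mat (n + 1) (n + 1)" using borel_minusD(1)[OF b] by simp
  note w = unip_upperD[OF w]
  have zero: "w $$ (r, s) = 0" if "r < s" "s < n + 1" for r s
    using that
  proof (induction r rule: less_induct)
    case (less r)
    have "0 = (\<Sum>k<n + 1. b $$ (r, k) * w $$ (k, s))"
      using low[OF less.prems] less.prems by (subst index_mult_mat_sum[OF bc w(1), symmetric]) auto
    also have "\<dots> = (\<Sum>k \<in> {r}. b $$ (r, k) * w $$ (k, s))"
    proof (rule sum.mono_neutral_right)
      show "\<forall>k \<in> {..<n + 1} - {r}. b $$ (r, k) * w $$ (k, s) = 0"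
      proof
        fix k assume "k \<in> {..<n + 1} - {r}"
        then show "b $$ (r, k) * w $$ (k, s) = 0"
          using less.IH[of k] less.prems borel_minusD(2)[OF b, of r k] by (cases "k < r") auto
      qed
    qed (use less.prems in auto)
    finally show ?case using borel_minusD(3)[OF b, of r] less.prems by simp
  qed
  show ?thesis
  proof (rule eq_matI)
    fix r s assume "r < dim_row (1\<^sub>m (n + 1) :: complex mat)" "s < dim_col (1\<^sub>m (n + 1) :: complex mat)"
    then show "w $$ (r, s) = 1\<^sub>m (n + 1) $$ (r, s)"
      using w(2,3) zero by (cases r s rule: linorder_cases) simp_all
  qed (use w(1) in auto)
qed

text \<open>If b u = b' u', then b (u u'^-1) = b' is lower triangular, so u u'^-1 = 1 by
  \<open>lower_times_unipotent_lower\<close>.\<close>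

lemma pi_plus_eq:
  assumes b: "b \<in> borel_minus n" and u: "u \<in> unip_upper n"
  shows "pi_plus n (b * u) = u"
  unfolding pi_plus_def
proof (rule the_equality)
  show "u \<in> unip_upper n \<and> (\<exists>b' \<in> borel_minus n. b * u = b' * u)" using assms by blast
next
  fix u' assume "u' \<in> unip_upper n \<and> (\<exists>b' \<in> borel_minus n. b * u = b' * u')"
  then obtain b' where u': "u' \<in> unip_upper n" "b' \<in> borel_minus n" "b * u = b' * u'" by blast
  let ?i = "inv\<^bsub>SL n\<^esub> u'"
  have i: "?i \<in> unip_upper n" by (rule unip_upper_inverse[OF u'(1)])
  have c: "b \<in> carrier_mat (n + 1) (n + 1)" "b' \<in> carrier_mat (n + 1) (n + 1)"
    "u \<in> carrier_mat (n + 1) (n + 1)" "u' \<in> carrier_mat (n + 1) (n + 1)"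
    "?i \<in> carrier_mat (n + 1) (n + 1)"
    using borel_minusD(1)[OF b] borel_minusD(1)[OF u'(2)] unip_upperD(1) u u' i by auto
  have "b * (u * ?i) = b' * u' * ?i"
    using assoc_mult_mat[OF c(1,3,5)] u'(3) by simp
  also have "\<dots> = b' * (u' * ?i)" by (rule assoc_mult_mat[OF c(2,4,5)])
  also have "\<dots> = b'" using inv_SL_mult(2)[OF unip_upper_SL[OF u'(1)]] c(2) by simp
  finally have "u * ?i = 1\<^sub>m (n + 1)"
    using borel_minusD(2)[OF u'(2)] by (intro lower_times_unipotent_lower[OF b unip_upper_mult[OF u i]]) simp
  then have "u * ?i * u' = u'" using c(4) by simp
  moreover have "u * ?i * u' = u * (?i * u')" by (rule assoc_mult_mat[OF c(3,5,4)])
  ultimately show "u' = u" using inv_SL_mult(1)[OF unip_upper_SL[OF u'(1)]] c(3) by simp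
qed

section \<open>Density of the big cell and fundamental minors\<close>

text \<open>Continuity is tested along families of matrices with continuous entries, so no topology
  on matrices enters; the density argument uses the families sending z to x_i(z) g.\<close>

definition entry_continuous :: "nat \<Rightarrow> (complex mat \<Rightarrow> complex) \<Rightarrow> bool" where
  "entry_continuous n F \<longleftrightarrow> (\<forall>\<gamma> :: complex \<Rightarrow> complex mat.
     (\<forall>z. \<gamma> z \<in> carrier_mat (n + 1) (n + 1)) \<longrightarrow>
     (\<forall>r < n + 1. \<forall>s < n + 1. continuous_on UNIV (\<lambda>z. \<gamma> z $$ (r, s))) \<longrightarrow>
     continuous_on UNIV (\<lambda>z. F (\<gamma> z)))"

lemma poly_functions_continuous: "F \<in> poly_functions n \<Longrightarrow> entry_continuous n F"
  by (induction rule: poly_functions.induct)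
    (auto simp: entry_continuous_def intro: continuous_on_add continuous_on_mult)

lemma entry_continuous_mult_left:
  assumes F: "entry_continuous n F" and A: "A \<in> carrier_mat (n + 1) (n + 1)"
  shows "entry_continuous n (\<lambda>g. F (A * g))"
  unfolding entry_continuous_def
proof (intro allI impI)
  fix \<gamma> :: "complex \<Rightarrow> complex mat"
  assume \<gamma>: "\<forall>z. \<gamma> z \<in> carrier_mat (n + 1) (n + 1)"
    and cont: "\<forall>r < n + 1. \<forall>s < n + 1. continuous_on UNIV (\<lambda>z. \<gamma> z $$ (r, s))"
  have "continuous_on UNIV (\<lambda>z. (A * \<gamma> z) $$ (r, s))" if rs: "r < n + 1" "s < n + 1" for r s
  proof -
    show ?thesis
      unfolding index_mult_mat_sum[OF A \<gamma>[rule_format] rs]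
      by (intro continuous_on_sum continuous_on_mult_left cont[rule_format] rs) simp
  qed
  then show "continuous_on UNIV (\<lambda>z. F (A * \<gamma> z))"
    using F[unfolded entry_continuous_def, rule_format, of "\<lambda>z. A * \<gamma> z"] A \<gamma> by auto
qed

text \<open>A continuous function equals its limit at \<open>w\<close>, and that limit only sees the
  points other than \<open>w\<close>.\<close>

lemma continuous_zero_off_point:
  fixes H :: "complex \<Rightarrow> complex"
  assumes "continuous_on UNIV H" "\<And>z. z \<noteq> w \<Longrightarrow> H z = 0"
  shows "H w = 0"
proof -
  have "(H \<longlongrightarrow> H w) (at w)"
    using assms(1) by (simp add: continuous_on_def)
  moreover have "(H \<longlongrightarrow> 0) (at w)"
    by (rule tendsto_eventually) (simp add: eventually_at_filter assms(2))
  ultimately show ?thesis by (rule LIM_unique)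
qed

lemma borel_minus_mult:
  assumes a: "a \<in> borel_minus n" and b: "b \<in> borel_minus n"
  shows "a * b \<in> borel_minus n"
proof (rule borel_minusI)
  show "a * b \<in> carrier (SL n)"
    by (rule SL_mult_closed[OF borel_minusD(1)[OF a] borel_minusD(1)[OF b]])
  have c: "a \<in> carrier_mat (n + 1) (n + 1)" "b \<in> carrier_mat (n + 1) (n + 1)"
    using borel_minusD(1)[OF a] borel_minusD(1)[OF b] by auto
  fix r s assume rs: "r < s" "s < n + 1"
  have "a $$ (r, k) * b $$ (k, s) = 0" if "k < n + 1" for k
    using borel_minusD(2)[OF a, of r k] borel_minusD(2)[OF b, of k s] rs that by (cases "r < k") auto
  then have "(\<Sum>k<n + 1. a $$ (r, k) * b $$ (k, s)) = 0" by (intro sum.neutral) blast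
  then show "(a * b) $$ (r, s) = 0"
    using index_mult_mat_sum[OF c, of r s] rs by simp
qed

lemma unip_lower_borel: "v \<in> unip_lower n \<Longrightarrow> v \<in> borel_minus n"
  using unip_lower_SL unip_lowerD by (intro borel_minusI) auto

lemma torus_borel: "t \<in> torus n \<Longrightarrow> t \<in> borel_minus n"
  using torus_SL by (intro borel_minusI) (auto simp: torus_def diagonal_mat_def)

lemma y_root_borel: "i \<in> {1..n} \<Longrightarrow> y_root n i c \<in> borel_minus n"
  by (intro borel_minusI y_root_SL) (auto simp: y_root_eq)

lemma cell_left_mult:
  assumes "a \<in> borel_minus n" "g \<in> borel_minus_U n"
  shows "a * g \<in> borel_minus_U n"
proof -
  obtain b u where g: "b \<in> borel_minus n" "u \<in> unip_upper n" "g = b * u"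
    using assms(2) by (auto simp: borel_minus_U_def)
  have "a * g = (a * b) * u"
    unfolding g(3) using borel_minusD(1)[OF assms(1)] borel_minusD(1)[OF g(1)] unip_upperD(1)[OF g(2)]
    by (intro assoc_mult_mat[symmetric]) auto
  then show ?thesis using borel_minus_mult[OF assms(1) g(1)] g(2) by (auto simp: borel_minus_U_def)
qed

text \<open>
  With \<open>d = b\<^sub>i\<^sub>-\<^sub>1\<^sub>,\<^sub>i\<^sub>-\<^sub>1 + z b\<^sub>i\<^sub>,\<^sub>i\<^sub>-\<^sub>1\<close> invertible, clearing the only entry of \<open>x\<^sub>i(z) b\<close> above
  the diagonal by a column operation shows that \<open>x\<^sub>i(z) b u\<close> stays in the big cell.
\<close>

lemma cell_x_root_mult:
  assumes b: "b \<in> borel_minus n" and u: "u \<in> unip_upper n" and i: "i \<in> {1..n}"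
    and d: "b $$ (i - 1, i - 1) + z * b $$ (i, i - 1) \<noteq> 0"
  shows "x_root n i z * (b * u) \<in> borel_minus_U n"
proof -
  \<comment> \<open>The entry (i - 1, i) of x_i(z) b is z b_ii, and the column operation subtracts
    \<open>w\<close> times d from it; so \<open>w\<close> has to solve z b_ii = w d.\<close>
  define w where "w = z * b $$ (i, i) / (b $$ (i - 1, i - 1) + z * b $$ (i, i - 1))"
  have wd: "z * b $$ (i, i) = w * (b $$ (i - 1, i - 1) + z * b $$ (i, i - 1))"
    using d by (simp add: w_def)
  have bS: "b \<in> carrier (SL n)" by (rule borel_minusD(1)[OF b])
  then have bc: "b \<in> carrier_mat (n + 1) (n + 1)" by simp
  note xc = x_root_carrier[OF i] and uc = unip_upperD(1)[OF u]
  have xbc: "x_root n i z * b \<in> carrier_mat (n + 1) (n + 1)" by (rule mult_carrier_mat[OF xc bc])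
  have xb: "x_root n i z * b = addrow z (i - 1) i b" by (rule x_root_mult[OF i bc])
  have low: "x_root n i z * b * x_root n i (- w) \<in> borel_minus n"
  proof (rule borel_minusI)
    show "x_root n i z * b * x_root n i (- w) \<in> carrier (SL n)"
      by (intro SL_mult_closed x_root_SL i bS)
    fix r s assume rs: "r < s" "s < n + 1"
    have "(x_root n i z * b * x_root n i (- w)) $$ (r, s) =
      (x_root n i z * b) $$ (r, s) + (if s = i then - w * (x_root n i z * b) $$ (r, i - 1) else 0)"
      unfolding x_root_eq[OF i, of "- w"] using i rs
      by (intro mult_addrow_mat_right[OF xbc]) auto
    also have "\<dots> = 0"
      unfolding xb using rs i bc wd borel_minusD(2)[OF b, of r s] borel_minusD(2)[OF b, of i s]
        borel_minusD(2)[OF b, of r "i - 1"]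
      by (cases "s = i"; cases "r = i - 1") auto
    finally show "(x_root n i z * b * x_root n i (- w)) $$ (r, s) = 0" .
  qed
  have "x_root n i z * b * x_root n i (- w) * (x_root n i w * u)
      = x_root n i z * b * (x_root n i (- w) * (x_root n i w * u))"
    by (rule assoc_mult_mat[OF xbc xc mult_carrier_mat[OF xc uc]])
  also have "x_root n i (- w) * (x_root n i w * u) = x_root n i (- w) * x_root n i w * u"
    by (rule assoc_mult_mat[symmetric, OF xc xc uc])
  also have "\<dots> = u" using x_root_neg[OF i, of "- w"] uc by simp
  also have "x_root n i z * b * u = x_root n i z * (b * u)" by (rule assoc_mult_mat[OF xc bc uc])
  finally have "x_root n i z * (b * u) = x_root n i z * b * x_root n i (- w) * (x_root n i w * u)" ..
  moreover have "x_root n i w * u \<in> unip_upper n"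
    by (intro unip_upper_mult unip_gen_subset x_root_unip_gen i u)
  ultimately show ?thesis
    using low unfolding borel_minus_U_def by blast
qed

text \<open>Induction over the generators with \<open>F\<close> arbitrary, each generator being
  absorbed into \<open>F\<close>. Factors y_i and t preserve the cell; x_i(z) takes a given element
  out of it for at most one \<open>z\<close>, and continuity covers that value.\<close>

lemma big_cell_dense:
  assumes "g \<in> carrier (SL n)" "entry_continuous n F" "\<And>g. g \<in> borel_minus_U n \<Longrightarrow> F g = 0"
  shows "F g = 0"
  using SL_generated[OF assms(1)] assms(2,3)
proof (induction arbitrary: F rule: SL_gen.induct)
  case one
  have "1\<^sub>m (n + 1) * 1\<^sub>m (n + 1) \<in> borel_minus_U n"
  proof -
    have "1\<^sub>m (n + 1) \<in> borel_minus n" by (rule borel_minusI[OF one_SL]) simp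
    moreover have "1\<^sub>m (n + 1) \<in> unip_upper n" by (rule unip_gen_subset[OF unip_gen.one])
    ultimately show ?thesis unfolding borel_minus_U_def by blast
  qed
  then show ?case using one.prems(2) by simp
next
  case (y i g c)
  show ?case
    using y.IH[OF entry_continuous_mult_left[OF y.prems(1) y_root_carrier[OF y.hyps(1)]]]
      y.prems(2)[OF cell_left_mult[OF y_root_borel[OF y.hyps(1)]]] by blast
next
  case (t t g)
  show ?case
    using t.IH[OF entry_continuous_mult_left[OF t.prems(1) torusD(1)[OF t.hyps(1)]]]
      t.prems(2)[OF cell_left_mult[OF torus_borel[OF t.hyps(1)]]] by blast
next
  case (x i g c)
  note xc = x_root_carrier[OF x.hyps(1)]
  show ?case
  proof (rule x.IH[OF entry_continuous_mult_left[OF x.prems(1) xc]])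
    fix g assume "g \<in> borel_minus_U n"
    then obtain b u where g: "b \<in> borel_minus n" "u \<in> unip_upper n" "g = b * u"
      by (auto simp: borel_minus_U_def)
    have gc: "g \<in> carrier_mat (n + 1) (n + 1)"
      unfolding g(3) using borel_minusD(1)[OF g(1)] unip_upperD(1)[OF g(2)] by (intro mult_carrier_mat[of _ _ "n+1"]) auto
    define H where "H z = F (x_root n i z * g)" for z
    have "continuous_on UNIV (\<lambda>z. (x_root n i z * g) $$ (r, s))" if "r < n + 1" "s < n + 1" for r s
      unfolding x_root_mult[OF x.hyps(1) gc] using that gc
      by (cases "r = i - 1") (auto intro!: continuous_intros)
    then have cont: "continuous_on UNIV H"
      using x.prems(1)[unfolded entry_continuous_def, rule_format, of "\<lambda>z. x_root n i z * g"]
        mult_carrier_mat[OF x_root_carrier[OF x.hyps(1)] gc]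
      unfolding H_def by simp
    have zero: "H z = 0" if "b $$ (i - 1, i - 1) + z * b $$ (i, i - 1) \<noteq> 0" for z
      unfolding H_def g(3) by (rule x.prems(2)[OF cell_x_root_mult[OF g(1,2) x.hyps(1) that]])
    show "F (x_root n i c * g) = 0"
    proof (cases "b $$ (i - 1, i - 1) + c * b $$ (i, i - 1) = 0")
      case True
      have "i - 1 < n + 1" using x.hyps(1) by auto
      then have nz: "b $$ (i - 1, i - 1) \<noteq> 0" by (rule borel_minusD(3)[OF g(1)])
      \<comment> \<open>Here d vanishes at \<open>c\<close> although its constant term, a diagonal
        entry of \<open>b\<close>, does not; so d is not constant in \<open>z\<close> and is nonzero
        at every other point.\<close>
      have "H c = 0"
      proof (rule continuous_zero_off_point[OF cont])
        fix z assume "z \<noteq> c"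
        have "b $$ (i, i - 1) \<noteq> 0" using True nz by auto
        then have "z * b $$ (i, i - 1) \<noteq> c * b $$ (i, i - 1)" using \<open>z \<noteq> c\<close> by simp
        then have "b $$ (i - 1, i - 1) + z * b $$ (i, i - 1) \<noteq> b $$ (i - 1, i - 1) + c * b $$ (i, i - 1)"
          by (simp only: add_left_cancel not_False_eq_True)
        then have "b $$ (i - 1, i - 1) + z * b $$ (i, i - 1) \<noteq> 0" unfolding True .
        then show "H z = 0" by (rule zero)
      qed
      then show ?thesis by (simp add: H_def)
    next
      case False
      from zero[OF this] show ?thesis by (simp add: H_def)
    qed
  qed
qed

section \<open>Leading minors and fundamental weights\<close>

definition lead_minor :: "nat \<Rightarrow> complex mat \<Rightarrow> complex" where
  "lead_minor j g = det (mat j j (\<lambda>(r, s). g $$ (r, s)))"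

text \<open>The upper right block of \<open>A\<close> vanishes, so only the first \<open>j\<close>
  summands enter the leading block of the product.\<close>

lemma lead_minor_mult_lower:
  assumes A: "A \<in> carrier_mat m m" and B: "B \<in> carrier_mat m m" and j: "j \<le> m"
    and low: "\<And>r k. r < j \<Longrightarrow> j \<le> k \<Longrightarrow> k < m \<Longrightarrow> A $$ (r, k) = 0"
  shows "lead_minor j (A * B) = lead_minor j A * lead_minor j B"
proof -
  let ?a = "mat j j (\<lambda>(r, s). A $$ (r, s))" and ?b = "mat j j (\<lambda>(r, s). B $$ (r, s))"
  have ab: "?a \<in> carrier_mat j j" "?b \<in> carrier_mat j j" by auto
  have eq: "mat j j (\<lambda>(r, s). (A * B) $$ (r, s)) = ?a * ?b"
  proof (rule eq_matI)
    fix r s assume "r < dim_row (?a * ?b)" "s < dim_col (?a * ?b)"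
    then have rs: "r < j" "s < j" by auto
    have "(A * B) $$ (r, s) = (\<Sum>k<m. A $$ (r, k) * B $$ (k, s))"
      using rs j by (intro index_mult_mat_sum[OF A B]) auto
    also have "\<dots> = (\<Sum>k<j. A $$ (r, k) * B $$ (k, s))"
      using rs j low by (intro sum.mono_neutral_right) auto
    also have "\<dots> = (?a * ?b) $$ (r, s)"
      using index_mult_mat_sum[OF ab rs] rs by simp
    finally show "mat j j (\<lambda>(r, s). (A * B) $$ (r, s)) $$ (r, s) = (?a * ?b) $$ (r, s)"
      using rs by simp
  qed auto
  show ?thesis unfolding lead_minor_def eq by (rule det_mult[OF ab])
qed

lemma lead_minor_mult_upper:
  assumes A: "A \<in> carrier_mat m m" and B: "B \<in> carrier_mat m m" and j: "j \<le> m"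
    and up: "\<And>k s. s < j \<Longrightarrow> j \<le> k \<Longrightarrow> k < m \<Longrightarrow> B $$ (k, s) = 0"
  shows "lead_minor j (A * B) = lead_minor j A * lead_minor j B"
proof -
  let ?a = "mat j j (\<lambda>(r, s). A $$ (r, s))" and ?b = "mat j j (\<lambda>(r, s). B $$ (r, s))"
  have ab: "?a \<in> carrier_mat j j" "?b \<in> carrier_mat j j" by auto
  have eq: "mat j j (\<lambda>(r, s). (A * B) $$ (r, s)) = ?a * ?b"
  proof (rule eq_matI)
    fix r s assume "r < dim_row (?a * ?b)" "s < dim_col (?a * ?b)"
    then have rs: "r < j" "s < j" by auto
    have "(A * B) $$ (r, s) = (\<Sum>k<m. A $$ (r, k) * B $$ (k, s))"
      using rs j by (intro index_mult_mat_sum[OF A B]) auto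
    also have "\<dots> = (\<Sum>k<j. A $$ (r, k) * B $$ (k, s))"
      using rs j up by (intro sum.mono_neutral_right) auto
    also have "\<dots> = (?a * ?b) $$ (r, s)"
      using index_mult_mat_sum[OF ab rs] rs by simp
    finally show "mat j j (\<lambda>(r, s). (A * B) $$ (r, s)) $$ (r, s) = (?a * ?b) $$ (r, s)"
      using rs by simp
  qed auto
  show ?thesis unfolding lead_minor_def eq by (rule det_mult[OF ab])
qed

lemma lead_minor_lower_triangular:
  assumes "\<And>r s. r < s \<Longrightarrow> s < j \<Longrightarrow> A $$ (r, s) = 0"
  shows "lead_minor j A = (\<Prod>i<j. A $$ (i, i))"
proof -
  let ?a = "mat j j (\<lambda>(r, s). A $$ (r, s))"
  have a: "?a \<in> carrier_mat j j" by simp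
  have "det ?a = (\<Prod>i<j. ?a $$ (i, i))"
    unfolding prod_list_diag_mat[OF a, symmetric] by (rule det_lower_triangular[OF _ a]) (use assms in auto)
  then show ?thesis unfolding lead_minor_def by simp
qed

lemma lead_minor_upper_triangular:
  assumes "\<And>r s. s < r \<Longrightarrow> r < j \<Longrightarrow> A $$ (r, s) = 0"
  shows "lead_minor j A = (\<Prod>i<j. A $$ (i, i))"
proof -
  let ?a = "mat j j (\<lambda>(r, s). A $$ (r, s))"
  have a: "?a \<in> carrier_mat j j" by simp
  have "det ?a = (\<Prod>i<j. ?a $$ (i, i))"
    unfolding prod_list_diag_mat[OF a, symmetric] by (rule det_upper_triangular[of _ j]) (use assms in auto)
  then show ?thesis unfolding lead_minor_def by simp
qed

lemma poly_functions_sum: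
  "finite S \<Longrightarrow> (\<And>x. x \<in> S \<Longrightarrow> F x \<in> poly_functions n) \<Longrightarrow> (\<lambda>g. \<Sum>x\<in>S. F x g) \<in> poly_functions n"
  by (induction rule: finite_induct) (auto intro: poly_functions.intros)

lemma poly_functions_prod:
  "finite S \<Longrightarrow> (\<And>x. x \<in> S \<Longrightarrow> F x \<in> poly_functions n) \<Longrightarrow> (\<lambda>g. \<Prod>x\<in>S. F x g) \<in> poly_functions n"
  by (induction rule: finite_induct) (auto intro: poly_functions.intros)

lemma lead_minor_poly:
  assumes "j \<le> n + 1"
  shows "lead_minor j \<in> poly_functions n"
proof -
  have "lead_minor j = (\<lambda>g. \<Sum>p \<in> {p. p permutes {0..<j}}. signof p * (\<Prod>i = 0..<j. g $$ (i, p i)))"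
    unfolding lead_minor_def
    by (subst det_def'[of _ j], simp, intro ext sum.cong prod.cong refl arg_cong2[of _ _ _ _ "(*)"])
      (auto simp: permutes_in_image)
  also have "\<dots> \<in> poly_functions n"
  proof (intro poly_functions_sum poly_functions.mult poly_functions_prod poly_functions.const poly_functions.entry)
    fix p i assume "p \<in> {p. p permutes {0..<j}}" "i \<in> {0..<j}"
    then have "i < j" "p i \<in> {0..<j}"
      using permutes_in_image[of p "{0..<j}" i] by auto
    then show "i < n + 1" "p i < n + 1" using assms by auto
  qed (auto simp: finite_permutations)
  finally show ?thesis .
qed

lemma weight_char_fund:
  assumes "j \<in> {1..n}"
  shows "weight_char n (fund_weight j) t = (\<Prod>k<j. t $$ (k, k))"
proof -
  have "weight_char n (fund_weight j) t = (\<Prod>i = 1..n. if i = j then (\<Prod>k<i. t $$ (k, k)) else 1)"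
    unfolding weight_char_def fund_weight_def by (intro prod.cong) auto
  then show ?thesis using assms by simp
qed

lemma lead_minor_cell:
  assumes v: "v \<in> unip_lower n" and t: "t \<in> torus n" and u: "u \<in> unip_upper n" and j: "j \<in> {1..n}"
  shows "lead_minor j (v * t * u) = weight_char n (fund_weight j) t"
proof -
  note vD = unip_lowerD[OF v] and tD = torusD[OF t] and uD = unip_upperD[OF u]
  have vt: "v * t \<in> carrier_mat (n + 1) (n + 1)" using mult_carrier_mat[OF vD(1) tD(1)] .
  have jn: "j \<le> n + 1" using j by auto
  have "lead_minor j (v * t * u) = lead_minor j (v * t) * lead_minor j u"
    using uD(2) by (intro lead_minor_mult_upper[OF vt uD(1) jn]) auto
  also have "lead_minor j (v * t) = lead_minor j v * lead_minor j t"
    using vD(2) by (intro lead_minor_mult_lower[OF vD(1) tD(1) jn]) auto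
  also have "lead_minor j v = 1"
    using vD(2,3) jn by (subst lead_minor_lower_triangular) auto
  also have "lead_minor j u = 1"
    using uD(2,3) jn by (subst lead_minor_upper_triangular) auto
  also have "lead_minor j t = (\<Prod>k<j. t $$ (k, k))"
    using t jn by (intro lead_minor_lower_triangular) (auto simp: torus_def diagonal_mat_def)
  finally show ?thesis using weight_char_fund[OF j] by simp
qed

text \<open>\<open>borel_minus\<close> has the torus factor on the left, while the definition of
  \<open>Delta\<close> has it to the right of U^-; dividing columns instead of rows by the diagonal
  entries gives this order.\<close>

lemma borel_minus_lower_torus:
  assumes b: "b \<in> borel_minus n"
  shows "\<exists>v \<in> unip_lower n. \<exists>t \<in> torus n. b = v * t"
proof -
  have bc: "b \<in> carrier_mat (n + 1) (n + 1)" "det b = 1" using borel_minusD(1)[OF b] by auto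
  have d: "(\<Prod>i<n + 1. b $$ (i, i)) = 1"
    using det_lower_triangular[OF _ bc(1)] borel_minusD(2)[OF b] prod_list_diag_mat[OF bc(1)] bc(2) by simp
  define t where "t = mat_diag (n + 1) (\<lambda>i. b $$ (i, i))"
  define v where "v = mat (n + 1) (n + 1) (\<lambda>(r, s). b $$ (r, s) / b $$ (s, s))"
  have vc: "v \<in> carrier_mat (n + 1) (n + 1)" by (simp add: v_def)
  have "b = v * t" unfolding t_def mat_diag_mult_right[OF vc]
    using bc borel_minusD(3)[OF b] by (intro eq_matI) (auto simp: v_def)
  moreover have "v \<in> unip_lower n"
    using borel_minusD(2,3)[OF b] by (intro unip_lowerI[OF vc]) (auto simp: v_def)
  moreover have "t \<in> torus n" unfolding t_def by (rule torusI_diag[OF d])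
  ultimately show ?thesis by blast
qed

text \<open>The leading minor is a polynomial with the prescribed values on U^- T U. Any regular
  function with these values differs from it by a continuous function vanishing on the big cell,
  hence by zero.\<close>

lemma Delta_fund_weight:
  assumes g: "g \<in> carrier (SL n)" and j: "j \<in> {1..n}"
  shows "Delta n (fund_weight j) g = lead_minor j g"
proof -
  have poly: "lead_minor j \<in> poly_functions n" using j by (intro lead_minor_poly) auto
  have vtu: "v * t * u \<in> carrier (SL n)" if "v \<in> unip_lower n" "t \<in> torus n" "u \<in> unip_upper n" for v t u
    by (intro SL_mult_closed unip_lower_SL torus_SL unip_upper_SL that)
  have "Delta n (fund_weight j) = restrict (lead_minor j) (carrier (SL n))"
    unfolding Delta_def
  proof (rule the_equality)
    show "restrict (lead_minor j) (carrier (SL n)) \<in> regular_functions n \<and>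
     (\<forall>v \<in> unip_lower n. \<forall>t \<in> torus n. \<forall>u \<in> unip_upper n.
        restrict (lead_minor j) (carrier (SL n)) (v * t * u) = weight_char n (fund_weight j) t)"
      using vtu lead_minor_cell j imageI[OF poly, of "\<lambda>F. restrict F (carrier (SL n))"]
      by (simp add: regular_functions_def)
  next
    fix F assume F: "F \<in> regular_functions n \<and>
     (\<forall>v \<in> unip_lower n. \<forall>t \<in> torus n. \<forall>u \<in> unip_upper n. F (v * t * u) = weight_char n (fund_weight j) t)"
    then obtain P where P: "P \<in> poly_functions n" "F = restrict P (carrier (SL n))"
      by (auto simp: regular_functions_def)
    have "(\<lambda>g. P g + (- 1) * lead_minor j g) \<in> poly_functions n"
      by (intro poly_functions.intros P poly)
    then have cont: "entry_continuous n (\<lambda>g. P g + (- 1) * lead_minor j g)"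
      by (rule poly_functions_continuous)
    have cell: "P g + (- 1) * lead_minor j g = 0" if cell_g: "g \<in> borel_minus_U n" for g
    proof -
      obtain b u where b: "b \<in> borel_minus n" "u \<in> unip_upper n" "g = b * u"
        using cell_g by (auto simp: borel_minus_U_def)
      then obtain v t where vt: "v \<in> unip_lower n" "t \<in> torus n" "g = v * t * u"
        using borel_minus_lower_torus by blast
      have "P g = F g" using vtu[OF vt(1,2) b(2)] by (simp add: P(2) vt(3))
      also have "\<dots> = lead_minor j g"
        using F lead_minor_cell[OF vt(1,2) b(2) j] vt b(2) by simp
      finally show ?thesis by simp
    qed
    have "P g = lead_minor j g" if "g \<in> carrier (SL n)" for g
      using big_cell_dense[OF that cont cell] by simp
    then show "F = restrict (lead_minor j) (carrier (SL n))" unfolding P(2) by (rule restrict_ext)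
  qed
  then show ?thesis using g by simp
qed

section \<open>Inversions and reduced words\<close>

definition inversion_set :: "nat \<Rightarrow> (nat \<Rightarrow> nat) \<Rightarrow> (nat \<times> nat) set" where
  "inversion_set n w = {(a, b). 1 \<le> a \<and> a < b \<and> b \<le> n + 1 \<and> w b < w a}"

lemma finite_inversion_set [simp]: "finite (inversion_set n w)"
  by (rule finite_subset[of _ "{..n + 1} \<times> {..n + 1}"]) (auto simp: inversion_set_def)

lemma inversion_set_id: "inversion_set n id = {}"
  by (auto simp: inversion_set_def)

lemma simple_refl_apply:
  "simple_refl j x = (if x = j then j + 1 else if x = j + 1 then j else x)"
  by (simp add: simple_refl_def Transposition.transpose_def)

lemma simple_refl_permutes: "j \<in> {1..n} \<Longrightarrow> simple_refl j permutes {1..n + 1}"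
  unfolding simple_refl_def by (rule permutes_swap_id) auto

lemma simple_refl_idem: "simple_refl j \<circ> (simple_refl j \<circ> v) = v"
  by (rule ext) (auto simp: simple_refl_apply)

lemma permutes_preimage:
  assumes "v permutes {1..n + 1}" "x \<in> {1..n + 1 :: nat}"
  obtains a where "a \<in> {1..n + 1}" "v a = x"
  using assms by (metis permutes_in_image permutes_surj surjD)

text \<open>Left multiplication by s_j exchanges the values j and j + 1. No value lies between them,
  so only the pair of positions \<open>a\<close>, \<open>b\<close> carrying them changes its
  relative order.\<close>

lemma inversion_set_simple_refl:
  assumes v: "v permutes {1..n + 1}" and ab: "1 \<le> a" "1 \<le> b" "a \<le> n + 1" "b \<le> n + 1"
    and va: "v a = j" and vb: "v b = j + 1"
  shows "a < b \<Longrightarrow> inversion_set n (simple_refl j \<circ> v) = insert (a, b) (inversion_set n v)"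
    "a < b \<Longrightarrow> (a, b) \<notin> inversion_set n v"
    "b < a \<Longrightarrow> inversion_set n (simple_refl j \<circ> v) = inversion_set n v - {(b, a)}"
    "b < a \<Longrightarrow> (b, a) \<in> inversion_set n v"
proof -
  have inj: "v x = v y \<longleftrightarrow> x = y" for x y
    using permutes_inj[OF v] by (simp add: inj_eq)
  have j: "v x = j \<longleftrightarrow> x = a" "v x = j + 1 \<longleftrightarrow> x = b" for x
    using inj[of x a] inj[of x b] va vb by simp_all
  have *: "simple_refl j (v y) < simple_refl j (v x) \<longleftrightarrow> v y < v x"
    if "\<not> (x = a \<and> y = b)" "\<not> (x = b \<and> y = a)" for x y
    using that j[of x] j[of y] by (auto simp: simple_refl_apply)
  have "(x, y) \<in> inversion_set n (simple_refl j \<circ> v) \<longleftrightarrow> (x, y) \<in> inversion_set n v"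
    if "(x, y) \<noteq> (a, b)" "(x, y) \<noteq> (b, a)" for x y
    using *[of x y] that by (auto simp: inversion_set_def)
  moreover have "(a, b) \<in> inversion_set n (simple_refl j \<circ> v) \<longleftrightarrow> a < b" "(b, a) \<notin> inversion_set n (simple_refl j \<circ> v)"
    using ab va vb by (auto simp: inversion_set_def simple_refl_apply)
  moreover have inv: "(a, b) \<notin> inversion_set n v" "(b, a) \<in> inversion_set n v \<longleftrightarrow> b < a"
    using ab va vb by (auto simp: inversion_set_def)
  ultimately show "a < b \<Longrightarrow> inversion_set n (simple_refl j \<circ> v) = insert (a, b) (inversion_set n v)"
    "b < a \<Longrightarrow> inversion_set n (simple_refl j \<circ> v) = inversion_set n v - {(b, a)}"
    by (simp_all add: set_eq_iff split_paired_all) (metis less_asym)+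
  show "a < b \<Longrightarrow> (a, b) \<notin> inversion_set n v" "b < a \<Longrightarrow> (b, a) \<in> inversion_set n v"
    using inv by simp_all
qed

lemma is_word_Nil: "is_word n w [] \<longleftrightarrow> w = id"
  by (auto simp: is_word_def)

lemma is_word_Cons: "is_word n w (j # js) \<longleftrightarrow> j \<in> {1..n} \<and> (\<exists>v. is_word n v js \<and> w = simple_refl j \<circ> v)"
  by (auto simp: is_word_def)

lemma is_word_permutes: "is_word n w js \<Longrightarrow> w permutes {1..n + 1}"
proof (induction js arbitrary: w)
  case Nil
  then show ?case unfolding is_word_Nil by (simp only: permutes_id)
next
  case (Cons j js)
  then show ?case unfolding is_word_Cons using permutes_compose simple_refl_permutes by blast
qed

lemma card_inversion_set_simple_refl_le:
  assumes v: "v permutes {1..n + 1}" and j: "j \<in> {1..n}"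
  shows "card (inversion_set n (simple_refl j \<circ> v)) \<le> Suc (card (inversion_set n v))"
proof -
  obtain a where a: "a \<in> {1..n + 1}" "v a = j" using j by (auto intro: permutes_preimage[OF v, of j])
  obtain b where b: "b \<in> {1..n + 1}" "v b = j + 1" using j by (auto intro: permutes_preimage[OF v, of "j + 1"])
  have "a \<noteq> b" using a b by auto
  then consider "a < b" | "b < a" by linarith
  then show ?thesis
  proof cases
    case 1
    then show ?thesis using inversion_set_simple_refl[OF v _ _ _ _ a(2) b(2)] a b by simp
  next
    case 2
    then show ?thesis using inversion_set_simple_refl(3)[OF v _ _ _ _ a(2) b(2)] a b
      by (simp add: card_Diff1_le le_SucI)
  qed
qed

lemma inversions_le_word_length: "is_word n w js \<Longrightarrow> card (inversion_set n w) \<le> length js"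
proof (induction js arbitrary: w)
  case Nil
  then show ?case unfolding is_word_Nil by (simp only: inversion_set_id card.empty list.size)
next
  case (Cons j js)
  then obtain v where v: "j \<in> {1..n}" "is_word n v js" "w = simple_refl j \<circ> v"
    by (auto simp: is_word_Cons)
  have "card (inversion_set n w) \<le> Suc (card (inversion_set n v))"
    unfolding v(3) by (rule card_inversion_set_simple_refl_le[OF is_word_permutes[OF v(2)] v(1)])
  then show ?case using Cons.IH[OF v(2)] by simp
qed

lemma ascending_interval_mono:
  fixes u :: "nat \<Rightarrow> nat"
  assumes "\<And>j. j \<in> {1..n} \<Longrightarrow> u j < u (j + 1)" "1 \<le> x" "x < y" "y \<le> n + 1"
  shows "u x < u y"
  using assms(3,4)
proof (induction y)
  case (Suc y)
  then show ?case using assms(1)[of y] assms(2) by (cases "x = y") auto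
qed simp

text \<open>An increasing permutation satisfies x \<le> u x. The inverse is increasing too, and the
  same bound for it gives u x \<le> x; therefore \<open>ge\<close> is stated for an arbitrary
  permutation.\<close>

lemma ascending_permutation_id:
  assumes u: "u permutes {1..n + 1}" and asc: "\<And>x y :: nat. 1 \<le> x \<Longrightarrow> x < y \<Longrightarrow> y \<le> n + 1 \<Longrightarrow> u x < u y"
  shows "u = id"
proof -
  have ge: "x \<le> u x" if "\<And>x y :: nat. 1 \<le> x \<Longrightarrow> x < y \<Longrightarrow> y \<le> n + 1 \<Longrightarrow> u x < u y" "u permutes {1..n + 1}" "1 \<le> x" "x \<le> n + 1"
    for u :: "nat \<Rightarrow> nat" and x :: nat
    using that(3,4)
  proof (induction x rule: nat_induct_at_least)
    case base
    then show ?case using permutes_in_image[OF that(2), of 1] by auto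
  next
    case (Suc m)
    then show ?case using that(1)[of m "Suc m"] by simp
  qed
  have inv_asc: "inv_into UNIV u x < inv_into UNIV u y" if "1 \<le> x" "x < y" "y \<le> n + 1" for x y
  proof (rule ccontr)
    assume "\<not> inv_into UNIV u x < inv_into UNIV u y"
    moreover have "inv_into UNIV u x \<noteq> inv_into UNIV u y" using that permutes_inverses(1)[OF u] by (metis less_irrefl)
    ultimately have "inv_into UNIV u y < inv_into UNIV u x" by simp
    moreover have "inv_into UNIV u x \<in> {1..n + 1}" "inv_into UNIV u y \<in> {1..n + 1}"
      using permutes_in_image[OF permutes_inv[OF u]] that by auto
    ultimately have "u (inv_into UNIV u y) < u (inv_into UNIV u x)" using asc by auto
    then show False using permutes_inverses(1)[OF u] that by simp
  qed
  show "u = id"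
  proof
    fix x
    show "u x = id x"
    proof (cases "x \<in> {1..n + 1}")
      case True
      then have "u x \<in> {1..n + 1}" using permutes_in_image[OF u] by blast
      then have "u x \<le> inv_into UNIV u (u x)" using ge[OF inv_asc permutes_inv[OF u], of "u x"] by auto
      moreover have "x \<le> u x" using ge[OF asc u, of x] True by auto
      ultimately show ?thesis using permutes_inverses(2)[OF u, of x] by simp
    next
      case False
      then show ?thesis using permutes_not_in[OF u] by simp
    qed
  qed
qed

text \<open>Bubble sort on the values: as long as there is an inversion, some values j and j + 1
  occur in the wrong order, and exchanging them removes exactly one inversion.\<close>

lemma word_of_inversion_length:
  assumes "w permutes {1..n + 1}"
  shows "\<exists>js. is_word n w js \<and> length js = card (inversion_set n w)"
  using assms
proof (induction "card (inversion_set n w)" arbitrary: w)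
  case 0
  then have "inversion_set n w = {}" by simp
  moreover have "w x \<noteq> w y" if "x < y" for x y
    using permutes_inj[OF 0(2)] that by (simp add: inj_eq)
  ultimately have "w x < w y" if "1 \<le> x" "x < y" "y \<le> n + 1" for x y
    using that unfolding inversion_set_def by (metis (mono_tags, lifting) case_prodI empty_iff linorder_neqE_nat mem_Collect_eq)
  then have "w = id" by (rule ascending_permutation_id[OF 0(2)])
  then show ?case
    by (intro exI[of _ "[]"]) (simp only: is_word_Nil inversion_set_id card.empty list.size)
next
  case (Suc m)
  note w = Suc.prems
  \<comment> \<open>Otherwise the inverse would increase from each \<open>j\<close> to j + 1, hence
    throughout, and \<open>w\<close> would have no inversion.\<close>
  have "\<exists>j \<in> {1..n}. inv_into UNIV w (j + 1) < inv_into UNIV w j"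
  proof (rule ccontr)
    assume no: "\<not> ?thesis"
    have "inv_into UNIV w j < inv_into UNIV w (j + 1)" if "j \<in> {1..n}" for j
    proof -
      have "inv_into UNIV w j \<noteq> inv_into UNIV w (j + 1)" using permutes_inverses(1)[OF w] by (metis n_not_Suc_n Suc_eq_plus1)
      then show ?thesis using no that by force
    qed
    then have asc: "inv_into UNIV w x < inv_into UNIV w y" if "1 \<le> x" "x < y" "y \<le> n + 1" for x y
      using that by (rule ascending_interval_mono)
    have "inversion_set n w = {}"
    proof (rule equals0I)
      fix ab assume "ab \<in> inversion_set n w"
      then obtain a b where ab: "1 \<le> a" "a < b" "b \<le> n + 1" "w b < w a" by (auto simp: inversion_set_def)
      then have "inv_into UNIV w (w b) < inv_into UNIV w (w a)"
        using permutes_in_image[OF w, of a] permutes_in_image[OF w, of b] by (intro asc) auto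
      then show False using permutes_inverses(2)[OF w] ab by simp
    qed
    then show False using Suc.hyps(2) by simp
  qed
  then obtain j where j: "j \<in> {1..n}" "inv_into UNIV w (j + 1) < inv_into UNIV w j" by blast
  let ?v = "simple_refl j \<circ> w"
  have v: "?v permutes {1..n + 1}" by (rule permutes_compose[OF w simple_refl_permutes[OF j(1)]])
  define a b where "a = inv_into UNIV w j" and "b = inv_into UNIV w (j + 1)"
  have wab: "w a = j" "w b = j + 1"
    unfolding a_def b_def by (rule permutes_inverses(1)[OF w])+
  have "w a \<in> {1..n + 1}" "w b \<in> {1..n + 1}"
    unfolding wab using j(1) by simp_all
  then have "a \<in> {1..n + 1}" "b \<in> {1..n + 1}"
    by (simp_all only: permutes_in_image[OF w])
  then have ab: "1 \<le> a" "1 \<le> b" "a \<le> n + 1" "b \<le> n + 1" by simp_all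
  have "b < a" unfolding a_def b_def by (rule j(2))
  then have "inversion_set n ?v = inversion_set n w - {(b, a)}" "(b, a) \<in> inversion_set n w"
    using inversion_set_simple_refl(3,4)[OF w ab wab] by blast+
  then have "card (inversion_set n ?v) = m" using Suc.hyps(2) by simp
  then obtain js where js: "is_word n ?v js" "length js = m"
    using Suc.hyps(1)[OF _ v] by blast
  have "is_word n w (j # js)"
    unfolding is_word_Cons using j(1) js(1) simple_refl_idem[of j w, symmetric] by blast
  then show ?case using js Suc.hyps(2) by (intro exI[of _ "j # js"]) simp
qed

lemma weyl_length_eq:
  assumes "w permutes {1..n + 1}"
  shows "weyl_length n w = card (inversion_set n w)"
  unfolding weyl_length_def using word_of_inversion_length[OF assms] inversions_le_word_length
  by (intro Least_equality) auto

section \<open>The longest element\<close>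

text \<open>The reversal inverts every pair, so an element of maximal length does too. Such an
  element is decreasing; followed by the reversal it becomes increasing, hence the identity.\<close>

lemma longest_elt_eq: "longest_elt n = (\<lambda>i. if i \<in> {1..n + 1} then n + 2 - i else i)"
  (is "_ = ?w0")
proof -
  let ?P = "{(a, b). 1 \<le> a \<and> a < b \<and> b \<le> n + 1}"
  have finP: "finite ?P" by (rule finite_subset[of _ "{..n + 1} \<times> {..n + 1}"]) auto
  have w0: "?w0 permutes {1..n + 1}"
    by (rule bij_imp_permutes, rule bij_betw_byWitness[of _ ?w0]) auto
  have sub: "inversion_set n w \<subseteq> ?P" for w by (auto simp: inversion_set_def)
  have P: "inversion_set n ?w0 = ?P" by (auto simp: inversion_set_def)
  show ?thesis
    unfolding longest_elt_def
  proof (rule the_equality)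
    show "?w0 \<in> weyl_group n \<and> (\<forall>v \<in> weyl_group n. weyl_length n v \<le> weyl_length n ?w0)"
      using w0 P sub card_mono[OF finP] by (auto simp: weyl_group_def weyl_length_eq)
  next
    fix w assume "w \<in> weyl_group n \<and> (\<forall>v \<in> weyl_group n. weyl_length n v \<le> weyl_length n w)"
    then have w: "w permutes {1..n + 1}" and "weyl_length n ?w0 \<le> weyl_length n w"
      using w0 by (auto simp: weyl_group_def)
    then have "card ?P \<le> card (inversion_set n w)" using w0 P by (simp add: weyl_length_eq)
    then have "inversion_set n w = ?P" using card_seteq[OF finP sub] by blast
    then have dec: "w y < w x" if "1 \<le> x" "x < y" "y \<le> n + 1" for x y
      using that unfolding inversion_set_def by blast
    have "?w0 \<circ> w = id"
    proof (rule ascending_permutation_id[OF permutes_compose[OF w w0]])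
      fix x y assume xy: "1 \<le> x" "x < y" "y \<le> n + 1"
      then show "(?w0 \<circ> w) x < (?w0 \<circ> w) y"
        using dec[OF xy] permutes_in_image[OF w, of x] permutes_in_image[OF w, of y] by auto
    qed
    then have "?w0 \<circ> (?w0 \<circ> w) = ?w0" by simp
    moreover have "?w0 \<circ> (?w0 \<circ> w) = w" by (rule ext) auto
    ultimately show "w = ?w0" by simp
  qed
qed

section \<open>Lifts of Weyl group elements\<close>

lemma refl_lift_mult_left:
  assumes i: "i \<in> {1..n}" and A: "A \<in> carrier_mat (n + 1) (n + 1)" and rs: "r < n + 1" "s < n + 1"
  shows "(refl_lift n i * A) $$ (r, s) =
    (if r = i then A $$ (i - 1, s) else if r = i - 1 then - A $$ (i, s) else A $$ (r, s))"
proof -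
  obtain m where m: "i = Suc m" and "m < n" using i by (cases i) auto
  have "(refl_lift n i * A) $$ (r, s) = (\<Sum>k<n + 1. refl_lift n i $$ (r, k) * A $$ (k, s))"
    by (rule index_mult_mat_sum[OF refl_lift_carrier[OF i] A rs])
  also have "\<dots> = (\<Sum>k<n + 1. if k = (if r = i then i - 1 else if r = i - 1 then i else r)
      then (if r = i - 1 then - A $$ (k, s) else A $$ (k, s)) else 0)"
  proof (intro sum.cong refl)
    fix k assume "k \<in> {..<n + 1}"
    then have k: "k < n + 1" by simp
    show "refl_lift n i $$ (r, k) * A $$ (k, s) = (if k = (if r = i then i - 1 else if r = i - 1 then i else r)
      then (if r = i - 1 then - A $$ (k, s) else A $$ (k, s)) else 0)"
      unfolding refl_lift_entry[OF i rs(1) k] unfolding m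
      by (cases "r = Suc m"; cases "r = m"; cases "k = m"; cases "k = Suc m") simp_all
  qed
  also have "\<dots> = (if r = i then A $$ (i - 1, s) else if r = i - 1 then - A $$ (i, s) else A $$ (r, s))"
    unfolding m using rs \<open>m < n\<close>
    by (cases "r = Suc m"; cases "r = m") simp_all
  finally show ?thesis .
qed

lemma refl_lift_mult_right:
  assumes i: "i \<in> {1..n}" and A: "A \<in> carrier_mat (n + 1) (n + 1)" and rs: "r < n + 1" "s < n + 1"
  shows "(A * refl_lift n i) $$ (r, s) =
    (if s = i then - A $$ (r, i - 1) else if s = i - 1 then A $$ (r, i) else A $$ (r, s))"
proof -
  obtain m where m: "i = Suc m" and "m < n" using i by (cases i) auto
  have "(A * refl_lift n i) $$ (r, s) = (\<Sum>k<n + 1. A $$ (r, k) * refl_lift n i $$ (k, s))"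
    by (rule index_mult_mat_sum[OF A refl_lift_carrier[OF i] rs])
  also have "\<dots> = (\<Sum>k<n + 1. if k = (if s = i then i - 1 else if s = i - 1 then i else s)
      then (if s = i then - A $$ (r, k) else A $$ (r, k)) else 0)"
  proof (intro sum.cong refl)
    fix k assume "k \<in> {..<n + 1}"
    then have k: "k < n + 1" by simp
    show "A $$ (r, k) * refl_lift n i $$ (k, s) = (if k = (if s = i then i - 1 else if s = i - 1 then i else s)
      then (if s = i then - A $$ (r, k) else A $$ (r, k)) else 0)"
      unfolding refl_lift_entry[OF i k rs(2)] unfolding m
      by (cases "s = Suc m"; cases "s = m"; cases "k = m"; cases "k = Suc m") simp_all
  qed
  also have "\<dots> = (if s = i then - A $$ (r, i - 1) else if s = i - 1 then A $$ (r, i) else A $$ (r, s))"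
    unfolding m using rs \<open>m < n\<close>
    by (cases "s = Suc m"; cases "s = m") simp_all
  finally show ?thesis .
qed

section \<open>Closed form of the lifts\<close>

text \<open>These are the inversions with right position \<open>i\<close>; the parity of their
  number is the sign that the lift of \<open>w\<close> has in the column of
  \<open>i\<close>.\<close>

definition larger_before :: "(nat \<Rightarrow> nat) \<Rightarrow> nat \<Rightarrow> nat set" where
  "larger_before w i = {k. 1 \<le> k \<and> k < i \<and> w i < w k}"

definition signed_perm_mat :: "nat \<Rightarrow> (nat \<Rightarrow> nat) \<Rightarrow> complex mat" where
  "signed_perm_mat n w = mat (n + 1) (n + 1)
     (\<lambda>(r, s). if w (s + 1) = r + 1 then (- 1) ^ card (larger_before w (s + 1)) else 0)"

lemma signed_perm_mat_carrier: "signed_perm_mat n w \<in> carrier_mat (n + 1) (n + 1)"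
  by (simp add: signed_perm_mat_def)

lemma signed_perm_mat_dim [simp]:
  "dim_row (signed_perm_mat n w) = n + 1" "dim_col (signed_perm_mat n w) = n + 1"
  by (simp_all add: signed_perm_mat_def)

lemma signed_perm_mat_entry:
  "r < n + 1 \<Longrightarrow> s < n + 1 \<Longrightarrow> signed_perm_mat n w $$ (r, s) =
    (if w (s + 1) = r + 1 then (- 1) ^ card (larger_before w (s + 1)) else 0)"
  by (simp add: signed_perm_mat_def)

lemma finite_larger_before [simp]: "finite (larger_before w i)"
  by (rule finite_subset[of _ "{..i}"]) (auto simp: larger_before_def)

lemma signed_perm_mat_id: "signed_perm_mat n id = 1\<^sub>m (n + 1)"
proof -
  have "larger_before id i = {}" for i by (auto simp: larger_before_def)
  then show ?thesis by (intro eq_matI) (auto simp: signed_perm_mat_def)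
qed

text \<open>When s_j raises the length of v, only position \<open>b\<close> gains a larger
  predecessor, namely \<open>a\<close>. The resulting sign matches the entry -1 of
  \<open>refl_lift\<close>.\<close>

lemma signed_perm_mat_ascend:
  assumes v: "v permutes {1..n + 1}" and j: "j \<in> {1..n}" and ab: "v a = j" "v b = j + 1" "1 \<le> a" "a < b"
  shows "signed_perm_mat n (simple_refl j \<circ> v) = refl_lift n j * signed_perm_mat n v"
proof (rule eq_matI)
  let ?w = "simple_refl j \<circ> v"
  have inj: "v x = v y \<longleftrightarrow> x = y" for x y
    using permutes_inj[OF v] by (simp add: inj_eq)
  have vx: "v x \<noteq> j" if "x \<noteq> a" for x
    using inj[of x a] ab that by simp
  have vx': "v x \<noteq> j + 1" if "x \<noteq> b" for x
    using inj[of x b] ab that by simp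
  have wx: "?w x = v x" if "x \<noteq> a" "x \<noteq> b" for x
    using vx[OF that(1)] vx'[OF that(2)] by (simp add: simple_refl_apply)
  have wab: "?w a = j + 1" "?w b = j" using ab by (simp_all add: simple_refl_apply)
  have before_a: "larger_before ?w a = larger_before v a"
  proof (rule Set.set_eqI)
    fix x show "x \<in> larger_before ?w a \<longleftrightarrow> x \<in> larger_before v a"
      using wx[of x] vx'[of x] ab(3,4) unfolding larger_before_def mem_Collect_eq wab ab(1)
      by (cases "x < a") auto
  qed
  have before_b: "larger_before ?w b = insert a (larger_before v b)"
  proof (rule Set.set_eqI)
    fix x show "x \<in> larger_before ?w b \<longleftrightarrow> x \<in> insert a (larger_before v b)"
    proof (cases "x = a")
      case True
      then show ?thesis
        using ab(3,4) unfolding larger_before_def insert_iff mem_Collect_eq True wab by simp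
    next
      case False
      then show ?thesis
        using wx[of x] vx[of x] vx'[of x] unfolding larger_before_def insert_iff mem_Collect_eq wab ab(2)
        by (cases "x < b") auto
    qed
  qed
  have a_notin: "a \<notin> larger_before v b" using ab by (simp add: larger_before_def)
  have before: "larger_before ?w y = larger_before v y" if "y \<noteq> a" "y \<noteq> b" for y
  proof (rule Set.set_eqI)
    fix x
    have "v y < ?w x \<longleftrightarrow> v y < v x"
    proof -
      consider "x = a" | "x = b" | "x \<noteq> a" "x \<noteq> b" by blast
      then show ?thesis
      proof cases
        case 1
        show ?thesis unfolding 1 wab ab(1) using vx[OF that(1)] by linarith
      next
        case 2
        show ?thesis unfolding 2 wab ab(2) using vx[OF that(1)] vx'[OF that(2)] by linarith
      next
        case 3
        show ?thesis unfolding wx[OF 3] ..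
      qed
    qed
    then show "x \<in> larger_before ?w y \<longleftrightarrow> x \<in> larger_before v y"
      unfolding larger_before_def mem_Collect_eq wx[OF that] by blast
  qed
  fix r s assume "r < dim_row (refl_lift n j * signed_perm_mat n v)"
    "s < dim_col (refl_lift n j * signed_perm_mat n v)"
  then have rs: "r < n + 1" "s < n + 1"
    using refl_lift_carrier[OF j] signed_perm_mat_carrier[of n v] by auto
  have r1: "j - 1 < n + 1" "j < n + 1" using j by auto
  note R = refl_lift_mult_left[OF j signed_perm_mat_carrier rs, of v]
  note entries = signed_perm_mat_entry[OF rs] signed_perm_mat_entry[OF r1(1) rs(2)] signed_perm_mat_entry[OF r1(2) rs(2)]
  show "signed_perm_mat n ?w $$ (r, s) = (refl_lift n j * signed_perm_mat n v) $$ (r, s)"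
  proof (cases "s + 1 = a")
    case True
    show ?thesis unfolding R entries True before_a wab ab(1) using j by auto
  next
    case sa: False
    show ?thesis
    proof (cases "s + 1 = b")
      case True
      have "card (insert a (larger_before v b)) = Suc (card (larger_before v b))"
        using a_notin by simp
      then show ?thesis unfolding R entries True before_b wab ab(2) using j by auto
    next
      case False
      show ?thesis
        unfolding R entries before[OF sa False] wx[OF sa False]
        using vx[OF sa] vx'[OF False] j by auto
    qed
  qed
qed (use refl_lift_carrier[OF j] in auto)

lemma mat_prod_Cons: "mat_prod n (g # gs) = g * mat_prod n gs"
  by (simp add: mat_prod_def)

text \<open>The closed form depends on \<open>w\<close> alone, so all reduced words give the same
  product; this replaces an appeal to the braid relations. Tails of reduced words are reduced, and
  the first letter raises the length, as \<open>signed_perm_mat_ascend\<close> requires.\<close>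

lemma reduced_word_lift:
  assumes "is_reduced_word n w js"
  shows "mat_prod n (map (refl_lift n) js) = signed_perm_mat n w"
  using assms
proof (induction js arbitrary: w)
  case Nil
  then have "w = id" by (simp add: is_reduced_word_def is_word_Nil)
  then show ?case by (simp only: signed_perm_mat_id) (simp add: mat_prod_def)
next
  case (Cons j js)
  then have "is_word n w (j # js)" by (simp add: is_reduced_word_def)
  then obtain v where v: "j \<in> {1..n}" "is_word n v js" "w = simple_refl j \<circ> v"
    by (auto simp: is_word_Cons)
  have pv: "v permutes {1..n + 1}" by (rule is_word_permutes[OF v(2)])
  have pw: "w permutes {1..n + 1}" unfolding v(3) by (rule permutes_compose[OF pv simple_refl_permutes[OF v(1)]])
  have len: "card (inversion_set n w) = Suc (length js)"
    using Cons.prems weyl_length_eq[OF pw] by (simp add: is_reduced_word_def)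
  have le: "card (inversion_set n v) \<le> length js" by (rule inversions_le_word_length[OF v(2)])
  have "card (inversion_set n w) \<le> Suc (card (inversion_set n v))"
    unfolding v(3) by (rule card_inversion_set_simple_refl_le[OF pv v(1)])
  \<comment> \<open>A letter adds at most one inversion, and the count never exceeds the word
    length, so equality for the whole word forces equality for its tail.\<close>
  then have cv: "card (inversion_set n v) = length js" using len le by simp
  then have red: "is_reduced_word n v js"
    using v(2) weyl_length_eq[OF pv] by (simp add: is_reduced_word_def)
  obtain a where a: "a \<in> {1..n + 1}" "v a = j" using v(1) by (auto intro: permutes_preimage[OF pv, of j])
  obtain b where b: "b \<in> {1..n + 1}" "v b = j + 1" using v(1) by (auto intro: permutes_preimage[OF pv, of "j + 1"])
  have "\<not> b < a"
  proof
    assume "b < a"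
    then have "inversion_set n w \<subseteq> inversion_set n v"
      using inversion_set_simple_refl(3)[OF pv _ _ _ _ a(2) b(2)] a b v(3) by auto
    then have "card (inversion_set n w) \<le> card (inversion_set n v)" by (intro card_mono) auto
    then show False using len cv by simp
  qed
  moreover have "a \<noteq> b" using a b by auto
  ultimately have "a < b" by simp
  then have "signed_perm_mat n w = refl_lift n j * signed_perm_mat n v"
    unfolding v(3) using a(1) by (intro signed_perm_mat_ascend[OF pv v(1) a(2) b(2)]) auto
  then show ?case using Cons.IH[OF red] by (simp add: mat_prod_Cons)
qed

lemma weyl_lift_eq:
  assumes w: "w permutes {1..n + 1}"
  shows "weyl_lift n w = signed_perm_mat n w"
  unfolding weyl_lift_def
proof (rule the_equality)
  obtain js where "is_word n w js" "length js = card (inversion_set n w)"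
    using word_of_inversion_length[OF w] by blast
  then have "is_reduced_word n w js" using weyl_length_eq[OF w] by (simp add: is_reduced_word_def)
  then show "\<exists>js. is_reduced_word n w js \<and> signed_perm_mat n w = mat_prod n (map (refl_lift n) js)"
    using reduced_word_lift[symmetric] by blast
qed (use reduced_word_lift in blast)

lemma longest_elt_permutes: "longest_elt n permutes {1..n + 1}"
  unfolding longest_elt_eq
  by (rule bij_imp_permutes, rule bij_betw_byWitness[of _ "\<lambda>i. if i \<in> {1..n + 1} then n + 2 - i else i"]) auto

section \<open>Lifts of the longest element and its neighbours\<close>

definition w0_mat :: "nat \<Rightarrow> complex mat" where
  "w0_mat n = mat (n + 1) (n + 1) (\<lambda>(r, s). if r + s = n then (- 1) ^ s else 0)"

lemma w0_mat_carrier: "w0_mat n \<in> carrier_mat (n + 1) (n + 1)"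
  by (simp add: w0_mat_def)

text \<open>The reversal has larger values at all \<open>s\<close> positions before s + 1, hence the
  sign (-1)^s of column \<open>s\<close>.\<close>

lemma weyl_lift_longest: "weyl_lift n (longest_elt n) = w0_mat n"
proof -
  have card: "card (larger_before (longest_elt n) (s + 1)) = s" if "s < n + 1" for s
  proof -
    have "larger_before (longest_elt n) (s + 1) = {1..s}"
      using that by (auto simp: larger_before_def longest_elt_eq)
    then show ?thesis by simp
  qed
  show ?thesis
    unfolding weyl_lift_eq[OF longest_elt_permutes] w0_mat_def
    using card by (intro eq_matI) (auto simp: signed_perm_mat_def longest_elt_eq)
qed

lemma weyl_lift_id: "weyl_lift n id = 1\<^sub>m (n + 1)"
  using weyl_lift_eq[OF permutes_id, of n] signed_perm_mat_id by (simp only:)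

lemma weyl_lift_simple_refl:
  assumes "j \<in> {1..n}"
  shows "weyl_lift n (simple_refl j) = refl_lift n j"
proof -
  have "signed_perm_mat n (simple_refl j \<circ> id) = refl_lift n j * signed_perm_mat n id"
    using assms by (intro signed_perm_mat_ascend[OF permutes_id, where a = j and b = "j + 1"]) auto
  then have "signed_perm_mat n (simple_refl j) = refl_lift n j * 1\<^sub>m (n + 1)"
    by (simp only: comp_id signed_perm_mat_id)
  then show ?thesis
    using refl_lift_carrier[OF assms] weyl_lift_eq[OF simple_refl_permutes[OF assms]] by simp
qed

text \<open>Lengths add in w0 = (w0 s_i) s_i, so the lifts multiply; both sides are compared
  entrywise in closed form. The equation gives access to the inverse of the lift of w0 s_i.\<close>

lemma weyl_lift_longest_simple_refl:
  assumes i: "i \<in> {1..n}"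
  shows "weyl_lift n (longest_elt n \<circ> simple_refl i) * refl_lift n i = w0_mat n"
proof -
  let ?w = "longest_elt n \<circ> simple_refl i"
  have w: "?w permutes {1..n + 1}"
    by (rule permutes_compose[OF simple_refl_permutes[OF i] longest_elt_permutes])
  obtain m where m: "i = Suc m" "m < n" using i by (cases i) auto
  have val: "?w x = (if x = i then n - m else if x = i + 1 then n + 1 - m else n + 2 - x)"
    if "1 \<le> x" "x \<le> n + 1" for x
    using that m by (simp add: longest_elt_eq simple_refl_apply)
  \<comment> \<open>The positions i and i + 1 form the only pair that w0 s_i leaves in order, so
    position i + 1 has one larger predecessor less.\<close>
  have before: "larger_before ?w (s + 1) = (if s = i then {1..m} else {1..s})" if s: "s < n + 1" for s
  proof (rule Set.set_eqI)
    fix x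
    have "?w (s + 1) < ?w x \<longleftrightarrow> \<not> (s = i \<and> x = i)" if "1 \<le> x" "x < s + 1"
    proof -
      have x: "x \<le> n + 1" and s1: "1 \<le> s + 1" "s + 1 \<le> n + 1" using that s by auto
      show ?thesis
        unfolding val[OF that(1) x] val[OF s1] using that s m
        by (cases "s = m"; cases "s = i"; cases "x = i"; cases "x = i + 1"; simp; linarith)
    qed
    then show "x \<in> larger_before ?w (s + 1) \<longleftrightarrow> x \<in> (if s = i then {1..m} else {1..s})"
      unfolding larger_before_def mem_Collect_eq using m by auto
  qed
  have entry: "signed_perm_mat n ?w $$ (r, s) =
    (if s = i then (if r + m = n then (- 1) ^ m else 0)
     else if s = m then (if r + i = n then (- 1) ^ m else 0)
     else if r + s = n then (- 1) ^ s else 0)" if "r < n + 1" "s < n + 1" for r s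
  proof -
    have "?w (s + 1) = r + 1 \<longleftrightarrow> (if s = i then r + m = n else if s = m then r + i = n else r + s = n)"
      using val[of "s + 1"] that m by auto
    then show ?thesis
      unfolding signed_perm_mat_entry[OF that] before[OF that(2)] using m by simp
  qed
  show ?thesis
    unfolding weyl_lift_eq[OF w]
  proof (rule eq_matI)
    fix r s assume "r < dim_row (w0_mat n)" "s < dim_col (w0_mat n)"
    then have rs: "r < n + 1" "s < n + 1" using w0_mat_carrier[of n] by auto
    have i1: "i < n + 1" "i - 1 < n + 1" using i by auto
    show "(signed_perm_mat n ?w * refl_lift n i) $$ (r, s) = w0_mat n $$ (r, s)"
      unfolding refl_lift_mult_right[OF i signed_perm_mat_carrier rs] entry[OF rs] entry[OF rs(1) i1(1)]
        entry[OF rs(1) i1(2)]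
      using rs m by (cases "s = i"; cases "s = m") (simp_all add: w0_mat_def)
  qed (use refl_lift_carrier[OF i] signed_perm_mat_carrier[of n ?w] w0_mat_carrier[of n] in auto)
qed

section \<open>The parametrization\<close>

lemma coroot_torus:
  assumes i: "i \<in> {1..n}" and c: "c \<noteq> 0"
  shows "coroot n i c \<in> torus n"
proof -
  obtain m where m: "i = Suc m" "m < n" using i by (cases i) auto
  let ?f = "\<lambda>k. if k = m then c else if k = i then inverse c else 1"
  have "(\<Prod>k<n + 1. ?f k) = (\<Prod>k \<in> {m, i}. ?f k)"
    using m by (intro prod.mono_neutral_right) auto
  also have "\<dots> = 1" using m c by simp
  finally have "mat_diag (n + 1) ?f \<in> torus n" by (rule torusI_diag)
  moreover have "coroot n i c = mat_diag (n + 1) ?f"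
    using m by (intro eq_matI) (auto simp: coroot_def mat_diag_def)
  ultimately show ?thesis by simp
qed

lemma y_bold_SL:
  assumes "i \<in> {1..n}" "c \<noteq> 0"
  shows "y_bold n i c \<in> carrier (SL n)"
  unfolding y_bold_def using assms
  by (intro SL_mult_closed y_root_SL torus_SL coroot_torus) auto

text \<open>The coroot factor scales column \<open>m\<close> by 1/c, which turns the subdiagonal
  entry \<open>c\<close> of the y-factor into 1, and column m + 1 by \<open>c\<close>.\<close>

lemma y_bold_entry:
  assumes i: "Suc m \<in> {1..n}" and c: "c \<noteq> 0" and rs: "r < n + 1" "s < n + 1"
  shows "y_bold n (Suc m) c $$ (r, s) =
    (if r = s then (if r = m then inverse c else if r = Suc m then c else 1)
     else if r = Suc m \<and> s = m then 1 else 0)"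
proof -
  have t: "coroot n (Suc m) (inverse c) \<in> torus n" using coroot_torus[OF i] c by simp
  have "y_bold n (Suc m) c $$ (r, s) = y_root n (Suc m) c $$ (r, s) * coroot n (Suc m) (inverse c) $$ (s, s)"
    unfolding y_bold_def by (rule torus_mult_entry(2)[OF t y_root_carrier[OF i] rs])
  also have "coroot n (Suc m) (inverse c) $$ (s, s) = (if s = m then inverse c else if s = Suc m then c else 1)"
    using rs by (simp add: coroot_def)
  also have "y_root n (Suc m) c $$ (r, s) = (if r = s then 1 else if r = Suc m \<and> s = m then c else 0)"
    unfolding y_root_eq[OF i] using rs by simp
  finally show ?thesis using c by auto
qed

definition y_chain :: "nat \<Rightarrow> nat \<Rightarrow> (nat \<Rightarrow> complex) \<Rightarrow> complex mat" where
  "y_chain n m a = mat_prod n (map (\<lambda>l. y_bold n l (a l)) [1..<m + 1])"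

text \<open>With the convention a_0 = a_(m+1) = 1 the diagonal entries of a block are a_r / a_(r+1)
  in every row, including the first, the last and those beyond the block.\<close>

definition pad_one :: "nat \<Rightarrow> (nat \<Rightarrow> complex) \<Rightarrow> nat \<Rightarrow> complex" where
  "pad_one m a l = (if 1 \<le> l \<and> l \<le> m then a l else 1)"

lemma mat_prod_Nil: "mat_prod n [] = 1\<^sub>m (n + 1)"
  by (simp add: mat_prod_def)

lemma mat_prod_closed:
  "(\<And>g. g \<in> set gs \<Longrightarrow> g \<in> carrier (SL n)) \<Longrightarrow> mat_prod n gs \<in> carrier (SL n)"
proof (induction gs)
  case Nil
  then show ?case using one_SL by (simp add: mat_prod_def)
next
  case (Cons g gs)
  then show ?case unfolding mat_prod_Cons by (intro SL_mult_closed) auto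
qed

lemma mat_prod_append:
  assumes "\<And>g. g \<in> set gs \<Longrightarrow> g \<in> carrier (SL n)" "\<And>g. g \<in> set hs \<Longrightarrow> g \<in> carrier (SL n)"
  shows "mat_prod n (gs @ hs) = mat_prod n gs * mat_prod n hs"
  using assms(1)
proof (induction gs)
  case Nil
  have "mat_prod n hs \<in> carrier (SL n)" by (rule mat_prod_closed[OF assms(2)])
  then have "mat_prod n hs \<in> carrier_mat (n + 1) (n + 1)" by simp
  from left_mult_one_mat[OF this] show ?case by (simp only: mat_prod_Nil append_Nil)
next
  case (Cons g gs)
  have "g \<in> carrier (SL n)" "mat_prod n gs \<in> carrier (SL n)" "mat_prod n hs \<in> carrier (SL n)"
    using Cons.prems assms(2) by (auto intro: mat_prod_closed simp del: SL_simps)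
  then show ?case
    using Cons.IH Cons.prems assoc_mult_mat[of g "n+1" "n+1" "mat_prod n gs" "n+1" "mat_prod n hs" "n+1"]
    by (simp add: mat_prod_Cons)
qed

lemma y_chain_SL:
  assumes "m \<le> n" "\<forall>l \<in> {1..m}. a l \<noteq> 0"
  shows "y_chain n m a \<in> carrier (SL n)"
proof -
  have "y_bold n l (a l) \<in> carrier (SL n)" if "l \<in> {1..<m + 1}" for l
    using that assms by (intro y_bold_SL) auto
  then show ?thesis unfolding y_chain_def by (intro mat_prod_closed) auto
qed

lemma y_chain_Suc:
  assumes "Suc m \<le> n" "\<forall>l \<in> {1..Suc m}. a l \<noteq> 0"
  shows "y_chain n (Suc m) a = y_chain n m a * y_bold n (Suc m) (a (Suc m))"
proof -
  have yb: "y_bold n l (a l) \<in> carrier (SL n)" if "l \<in> {1..<Suc m + 1}" for l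
    using that assms by (intro y_bold_SL) auto
  have "y_chain n (Suc m) a = mat_prod n (map (\<lambda>l. y_bold n l (a l)) [1..<m + 1] @ [y_bold n (Suc m) (a (Suc m))])"
    by (simp add: y_chain_def)
  also have "\<dots> = y_chain n m a * mat_prod n [y_bold n (Suc m) (a (Suc m))]"
    unfolding y_chain_def using yb by (intro mat_prod_append) auto
  also have "mat_prod n [y_bold n (Suc m) (a (Suc m))] = y_bold n (Suc m) (a (Suc m))"
  proof -
    have "y_bold n (Suc m) (a (Suc m)) \<in> carrier (SL n)" by (rule yb) simp
    then have "y_bold n (Suc m) (a (Suc m)) \<in> carrier_mat (n + 1) (n + 1)" by simp
    from right_mult_one_mat[OF this] show ?thesis by (simp only: mat_prod_Nil mat_prod_Cons)
  qed
  finally show ?thesis .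
qed

text \<open>The new last factor scales columns \<open>m\<close> and m + 1 and adds the old column m
  + 1, a unit vector, to column \<open>m\<close>; this creates the next subdiagonal 1.\<close>

lemma y_chain_entry:
  assumes "m \<le> n" "\<forall>l \<in> {1..m}. a l \<noteq> 0" "r < n + 1" "s < n + 1"
  shows "y_chain n m a $$ (r, s) =
    (if r = s then pad_one m a r / pad_one m a (r + 1) else if r = s + 1 \<and> r \<le> m then 1 else 0)"
  using assms
proof (induction m arbitrary: r s)
  case 0
  then show ?case by (auto simp: y_chain_def mat_prod_def pad_one_def)
next
  case (Suc m)
  let ?c = "a (Suc m)"
  have i: "Suc m \<in> {1..n}" and c: "?c \<noteq> 0" and rs: "r < n + 1" "s < n + 1" using Suc.prems by auto
  have A: "y_chain n m a \<in> carrier_mat (n + 1) (n + 1)"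
    using y_chain_SL[of m n a] Suc.prems by simp
  have yc: "y_bold n (Suc m) ?c \<in> carrier_mat (n + 1) (n + 1)" using y_bold_SL[OF i c] by simp
  have IH: "y_chain n m a $$ (r, s) =
      (if r = s then pad_one m a r / pad_one m a (r + 1) else if r = s + 1 \<and> r \<le> m then 1 else 0)"
    if "r < n + 1" "s < n + 1" for r s
    using Suc.IH[OF _ _ that] Suc.prems by simp
  have m: "m < n + 1" "Suc m < n + 1" using i by auto
  have "y_chain n (Suc m) a $$ (r, s) = (\<Sum>k<n + 1. y_chain n m a $$ (r, k) * y_bold n (Suc m) ?c $$ (k, s))"
    unfolding y_chain_Suc[OF Suc.prems(1,2)] by (rule index_mult_mat_sum[OF A yc rs])
  also have "\<dots> = (\<Sum>k<n + 1. (if k = s then y_chain n m a $$ (r, k) *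
        (if s = m then inverse ?c else if s = Suc m then ?c else 1) else 0) +
      (if k = Suc m then (if s = m then y_chain n m a $$ (r, k) else 0) else 0))"
    by (intro sum.cong refl) (simp add: y_bold_entry[OF i c _ rs(2)])
  also have "\<dots> = y_chain n m a $$ (r, s) * (if s = m then inverse ?c else if s = Suc m then ?c else 1)
      + (if s = m then y_chain n m a $$ (r, Suc m) else 0)"
    unfolding sum.distrib using rs m by (simp only: sum.delta finite_lessThan lessThan_iff if_True)
  also have "\<dots> = (if r = s then pad_one (Suc m) a r / pad_one (Suc m) a (r + 1)
      else if r = s + 1 \<and> r \<le> Suc m then 1 else 0)"
    unfolding IH[OF rs] IH[OF rs(1) m(2)]
    by (auto simp: pad_one_def divide_inverse)
  finally show ?case .
qed

lemma y_chain_mult_entry: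
  assumes m: "m \<le> n" and a: "\<forall>l \<in> {1..m}. a l \<noteq> 0"
    and A: "A \<in> carrier_mat (n + 1) (n + 1)" and rs: "r < n + 1" "s < n + 1"
  shows "(y_chain n m a * A) $$ (r, s) = pad_one m a r / pad_one m a (r + 1) * A $$ (r, s)
    + (if 1 \<le> r \<and> r \<le> m then A $$ (r - 1, s) else 0)"
proof -
  have Q: "y_chain n m a \<in> carrier_mat (n + 1) (n + 1)" using y_chain_SL[OF m a] by simp
  have "(y_chain n m a * A) $$ (r, s) = (\<Sum>k<n + 1. y_chain n m a $$ (r, k) * A $$ (k, s))"
    by (rule index_mult_mat_sum[OF Q A rs])
  \<comment> \<open>For r = 0 the truncated difference r - 1 is 0 again; the guard 1 \<le> r
    switches that summand off.\<close>
  also have "\<dots> = (\<Sum>k<n + 1. (if k = r then pad_one m a r / pad_one m a (r + 1) * A $$ (k, s) else 0)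
      + (if k = r - 1 then (if 1 \<le> r \<and> r \<le> m then A $$ (k, s) else 0) else 0))"
  proof (intro sum.cong refl)
    fix k assume "k \<in> {..<n + 1}"
    then have k: "k < n + 1" by simp
    show "y_chain n m a $$ (r, k) * A $$ (k, s) = (if k = r then pad_one m a r / pad_one m a (r + 1) * A $$ (k, s) else 0)
      + (if k = r - 1 then (if 1 \<le> r \<and> r \<le> m then A $$ (k, s) else 0) else 0)"
      unfolding y_chain_entry[OF m a rs(1) k] by (cases "k = r"; cases "r = k + 1") auto
  qed
  also have "\<dots> = pad_one m a r / pad_one m a (r + 1) * A $$ (r, s)
    + (if 1 \<le> r \<and> r \<le> m then A $$ (r - 1, s) else 0)"
  proof -
    have "r - 1 < n + 1" using rs by simp
    then show ?thesis
      unfolding sum.distrib using rs by (simp only: sum.delta finite_lessThan lessThan_iff if_True)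
  qed
  finally show ?thesis .
qed

section \<open>Partial products of blocks\<close>

text \<open>The product of the last \<open>m\<close> blocks of \<open>Theta\<close>. Blocks are
  added on the left, so the next one has first index n - m and m + 1 factors.\<close>

primrec theta_part :: "nat \<Rightarrow> (int \<Rightarrow> nat \<Rightarrow> complex) \<Rightarrow> nat \<Rightarrow> complex mat" where
  "theta_part n c 0 = 1\<^sub>m (n + 1)"
| "theta_part n c (Suc m) = y_chain n (Suc m) (c (int n - int m)) * theta_part n c m"

locale theta_coordinates =
  fixes n :: nat and c :: "int \<Rightarrow> nat \<Rightarrow> complex"
  assumes nz: "\<And>k l. k \<ge> 1 \<Longrightarrow> l \<ge> 1 \<Longrightarrow> k + int l \<le> int n + 1 \<Longrightarrow> c k l \<noteq> 0"
begin

lemma row_nonzero: "Suc m \<le> n \<Longrightarrow> \<forall>l \<in> {1..Suc m}. c (int n - int m) l \<noteq> 0"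
  by (intro ballI nz) auto

lemma theta_part_SL: "m \<le> n \<Longrightarrow> theta_part n c m \<in> carrier (SL n)"
proof (induction m)
  case 0
  show ?case unfolding theta_part.simps(1) by (rule one_SL)
next
  case (Suc m)
  then show ?case
    unfolding theta_part.simps using row_nonzero by (intro SL_mult_closed y_chain_SL) auto
qed

lemma Theta_eq: "Theta n c = theta_part n c n"
proof -
  let ?F = "\<lambda>k. map (\<lambda>l. y_bold n l (c (int k) l)) [1..<n + 2 - k]"
  have SL: "g \<in> carrier (SL n)" if g: "g \<in> set (?F k)" and k: "1 \<le> k" for g k
  proof -
    obtain l where l: "l \<in> {1..<n + 2 - k}" "g = y_bold n l (c (int k) l)" using g by auto
    show ?thesis unfolding l(2) by (intro y_bold_SL nz) (use l(1) k in auto)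
  qed
  \<comment> \<open>The last \<open>m\<close> blocks carry the first indices n + 1 - m to n; the
    induction step prepends block n - m.\<close>
  have "mat_prod n (concat (map ?F [n + 1 - m..<n + 1])) = theta_part n c m" if "m \<le> n" for m
    using that
  proof (induction m)
    case 0
    show ?case by (simp add: mat_prod_def)
  next
    case (Suc m)
    have "[n + 1 - Suc m..<n + 1] = (n - m) # [n + 1 - m..<n + 1]"
    proof -
      have "n + 1 - Suc m = n - m" "n + 1 - m = Suc (n - m)" using Suc.prems by auto
      then show ?thesis using upt_conv_Cons[of "n - m" "n + 1"] by simp
    qed
    then have "mat_prod n (concat (map ?F [n + 1 - Suc m..<n + 1]))
        = mat_prod n (?F (n - m) @ concat (map ?F [n + 1 - m..<n + 1]))" by simp
    also have "\<dots> = mat_prod n (?F (n - m)) * mat_prod n (concat (map ?F [n + 1 - m..<n + 1]))"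
    proof (rule mat_prod_append)
      fix g assume "g \<in> set (?F (n - m))"
      then show "g \<in> carrier (SL n)" by (rule SL) (use Suc.prems in simp)
    next
      fix g assume "g \<in> set (concat (map ?F [n + 1 - m..<n + 1]))"
      then obtain k where "k \<in> set [n + 1 - m..<n + 1]" "g \<in> set (?F k)" by auto
      then show "g \<in> carrier (SL n)" using Suc.prems by (intro SL[of g k]) auto
    qed
    also have "mat_prod n (?F (n - m)) = y_chain n (Suc m) (c (int n - int m))"
    proof -
      have "n + 2 - (n - m) = Suc m + 1" "int (n - m) = int n - int m" using Suc.prems by auto
      then show ?thesis by (simp only: y_chain_def)
    qed
    finally show ?case using Suc.IH Suc.prems by simp
  qed
  from this[of n] show ?thesis by (simp add: Theta_def)
qed

text \<open>Only generators with index at most \<open>m\<close> occur, and these act within the rows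
  and columns 0 to m.\<close>

lemma theta_part_off_block:
  assumes "m \<le> n" "r < n + 1" "s < n + 1" "m < r \<or> m < s"
  shows "theta_part n c m $$ (r, s) = (if r = s then 1 else 0)"
  using assms
proof (induction m arbitrary: r s)
  case 0
  then show ?case by simp
next
  case (Suc m)
  have T: "theta_part n c m \<in> carrier_mat (n + 1) (n + 1)" using theta_part_SL[of m] Suc.prems(1) by simp
  note nzm = row_nonzero[OF Suc.prems(1)]
  have 1: "theta_part n c m $$ (r, s) = (if r = s then 1 else 0)"
    using Suc.IH[of r s] Suc.prems by auto
  have 2: "theta_part n c m $$ (r - 1, s) = 0" if "1 \<le> r" "r \<le> Suc m"
    using Suc.IH[of "r - 1" s] Suc.prems that by auto
  show ?case
    unfolding theta_part.simps y_chain_mult_entry[OF Suc.prems(1) nzm T Suc.prems(2,3)] 1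
    using 2 Suc.prems(4) by (auto simp: pad_one_def)
qed

text \<open>
  The row \<open>((-1)\<^sup>m\<^sup>-\<^sup>k / c\<^sub>n\<^sub>+\<^sub>1\<^sub>-\<^sub>m\<^sub>,\<^sub>k)\<^sub>k\<close> is annihilated by \<open>y_chain\<close> up to its last entry, so it is
  row \<open>m\<close> of the inverse of \<open>theta_part n c m\<close>.
\<close>

lemma theta_part_inverse_row:
  assumes m: "m \<le> n" and s: "s < n + 1"
  shows "(inv\<^bsub>SL n\<^esub> (theta_part n c m)) $$ (m, s) =
    (if s \<le> m then (- 1) ^ (m - s) / pad_one m (c (int n + 1 - int m)) s else 0)"
proof -
  let ?p = "pad_one m (c (int n + 1 - int m))"
  \<comment> \<open>Every row of \<open>Z\<close> is the candidate row, so that a row vector can be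
    handled by matrix products.\<close>
  define Z where "Z = mat (n + 1) (n + 1) (\<lambda>(r, s). if s \<le> m then (- 1) ^ (m - s) / ?p s else 0)"
  have Z: "Z \<in> carrier_mat (n + 1) (n + 1)" by (simp add: Z_def)
  have T: "theta_part n c m \<in> carrier (SL n)" by (rule theta_part_SL[OF m])
  then have Tc: "theta_part n c m \<in> carrier_mat (n + 1) (n + 1)" by simp
  let ?S = "inv\<^bsub>SL n\<^esub> (theta_part n c m)"
  have Sc: "?S \<in> carrier_mat (n + 1) (n + 1)" using inv_SL_closed[OF T] by simp
  have ZT: "(Z * theta_part n c m) $$ (r, s) = (if s = m then 1 else 0)" if rs: "r < n + 1" "s < n + 1" for r s
  proof (cases m)
    case 0
    then show ?thesis using rs right_mult_one_mat[OF Z] by (auto simp: Z_def pad_one_def)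
  next
    case (Suc m')
    have a: "int n + 1 - int m = int n - int m'" using Suc by simp
    have m': "Suc m' \<le> n" using m Suc by simp
    let ?Q = "y_chain n (Suc m') (c (int n - int m'))"
    note nzm = row_nonzero[OF m']
    have Q: "?Q \<in> carrier_mat (n + 1) (n + 1)" using y_chain_SL[OF m' nzm] by simp
    have T': "theta_part n c m' \<in> carrier_mat (n + 1) (n + 1)" using theta_part_SL[of m'] m' by simp
    have pnz: "?p l \<noteq> 0" for l using nzm unfolding a Suc by (auto simp: pad_one_def)
    \<comment> \<open>For k < m, entry \<open>k\<close> is a sum of two terms of opposite sign and
      equal size 1 / p_(k+1); at k = m only the first is left and equals 1 because p_(m+1) =
      1.\<close>
    have ZQ: "(Z * ?Q) $$ (r, k) = (if k = m then 1 else 0)" if k: "k < n + 1" for k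
    proof -
      have "(Z * ?Q) $$ (r, k) = (\<Sum>i<n + 1. Z $$ (r, i) * ?Q $$ (i, k))"
        by (rule index_mult_mat_sum[OF Z Q rs(1) k])
      also have "\<dots> = (\<Sum>i<n + 1. (if i = k then Z $$ (r, k) * (?p k / ?p (k + 1)) else 0)
          + (if i = Suc k then (if Suc k \<le> m then Z $$ (r, Suc k) else 0) else 0))"
      proof (intro sum.cong refl)
        fix i assume "i \<in> {..<n + 1}"
        then have i: "i < n + 1" by simp
        show "Z $$ (r, i) * ?Q $$ (i, k) = (if i = k then Z $$ (r, k) * (?p k / ?p (k + 1)) else 0)
          + (if i = Suc k then (if Suc k \<le> m then Z $$ (r, Suc k) else 0) else 0)"
          unfolding y_chain_entry[OF m' nzm i k] a Suc by auto
      qed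
      also have "\<dots> = Z $$ (r, k) * (?p k / ?p (k + 1)) + (if Suc k \<le> m then Z $$ (r, Suc k) else 0)"
        unfolding sum.distrib using k m by (auto simp: sum.delta simp del: lessThan_Suc sum.lessThan_Suc)
      also have "\<dots> = (if k = m then 1 else 0)"
      proof -
        consider "k < m" | "k = m" | "m < k" by linarith
        then show ?thesis
        proof cases
          case 1
          then have "m - k = Suc (m - Suc k)" by simp
          then show ?thesis using 1 rs(1) k m pnz by (simp add: Z_def)
        next
          case 2
          have "?p (m + 1) = 1" by (simp add: pad_one_def)
          then show ?thesis using 2 rs(1) k pnz[of m] by (simp add: Z_def)
        next
          case 3
          then show ?thesis using rs(1) k by (simp add: Z_def)
        qed
      qed
      finally show ?thesis .
    qed
    have "Z * theta_part n c m = Z * ?Q * theta_part n c m'"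
      unfolding Suc theta_part.simps by (rule assoc_mult_mat[OF Z Q T', symmetric])
    then have "(Z * theta_part n c m) $$ (r, s) = (\<Sum>k<n + 1. (Z * ?Q) $$ (r, k) * theta_part n c m' $$ (k, s))"
      using index_mult_mat_sum[OF mult_carrier_mat[OF Z Q] T' rs] by simp
    also have "\<dots> = (\<Sum>k<n + 1. if k = m then theta_part n c m' $$ (k, s) else 0)"
      using ZQ by (intro sum.cong) auto
    also have "\<dots> = theta_part n c m' $$ (m, s)" using m by (simp only: sum.delta finite_lessThan) simp
    also have "\<dots> = (if s = m then 1 else 0)"
      using theta_part_off_block[of m' m s] m rs Suc by auto
    finally show ?thesis .
  qed
  have "Z = Z * (theta_part n c m * ?S)" using inv_SL_mult(2)[OF T] right_mult_one_mat[OF Z] by simp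
  also have "\<dots> = Z * theta_part n c m * ?S" by (rule assoc_mult_mat[OF Z Tc Sc, symmetric])
  finally have ZTS: "Z = Z * theta_part n c m * ?S" .
  have m1: "m < n + 1" using m by simp
  have "Z $$ (m, s) = (\<Sum>k<n + 1. (Z * theta_part n c m) $$ (m, k) * ?S $$ (k, s))"
    by (subst ZTS, rule index_mult_mat_sum[OF mult_carrier_mat[OF Z Tc] Sc m1 s])
  also have "\<dots> = (\<Sum>k<n + 1. if k = m then ?S $$ (k, s) else 0)"
    using ZT[OF m1] by (intro sum.cong) auto
  also have "\<dots> = ?S $$ (m, s)" using m by (simp only: sum.delta finite_lessThan) simp
  finally show ?thesis using s m by (simp add: Z_def)
qed

text \<open>Row \<open>r\<close> of the partial product is a unit row, so its product with the
  inverse copies row \<open>r\<close> of the inverse, which must then be a row of the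
  identity.\<close>

lemma theta_part_inverse_off_block:
  assumes m: "m \<le> n" and rs: "r < n + 1" "s < n + 1" and off: "m < r"
  shows "(inv\<^bsub>SL n\<^esub> (theta_part n c m)) $$ (r, s) = (if r = s then 1 else 0)"
proof -
  have T: "theta_part n c m \<in> carrier (SL n)" by (rule theta_part_SL[OF m])
  then have Tc: "theta_part n c m \<in> carrier_mat (n + 1) (n + 1)" by simp
  let ?S = "inv\<^bsub>SL n\<^esub> (theta_part n c m)"
  have Sc: "?S \<in> carrier_mat (n + 1) (n + 1)" using inv_SL_closed[OF T] by simp
  have "(\<Sum>k<n + 1. theta_part n c m $$ (r, k) * ?S $$ (k, s)) = (theta_part n c m * ?S) $$ (r, s)"
    by (rule index_mult_mat_sum[OF Tc Sc rs, symmetric])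
  also have "\<dots> = (if r = s then 1 else 0)" unfolding inv_SL_mult(2)[OF T] using rs by simp
  finally have "(if r = s then 1 else 0) = (\<Sum>k<n + 1. theta_part n c m $$ (r, k) * ?S $$ (k, s))" ..
  also have "\<dots> = (\<Sum>k<n + 1. if k = r then ?S $$ (k, s) else 0)"
    using theta_part_off_block[OF m rs(1)] off by (intro sum.cong) auto
  also have "\<dots> = ?S $$ (r, s)" using rs by (simp only: sum.delta finite_lessThan) simp
  finally show ?thesis ..
qed

end

context theta_coordinates
begin

text \<open>
  Column \<open>m + 1\<close> of \<open>v\<close> is the solution \<open>q\<close> of \<open>theta_part n c (m + 1) q = (-1)\<^sup>m\<^sup>+\<^sup>1 e\<^sub>0\<close>, which is found
  in two steps: \<open>q = (theta_part n c m)\<^sup>-\<^sup>1 x\<close> with \<open>x\<close> read off the bidiagonal matrix \<open>y_chain\<close>.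
\<close>

lemma theta_part_column:
  assumes m: "Suc m \<le> n"
  shows "\<exists>q. (\<forall>r < n + 1. (\<Sum>k<n + 1. theta_part n c (Suc m) $$ (r, k) * q k) = (if r = 0 then (- 1) ^ Suc m else 0)) \<and>
    (\<forall>r < n + 1. Suc m < r \<longrightarrow> q r = 0) \<and> q (Suc m) = 1 \<and>
    q m = - (\<Sum>k<Suc m. c (int n - int m) (k + 1) / pad_one m (c (int n + 1 - int m)) k)"
proof -
  let ?p = "pad_one (Suc m) (c (int n - int m))"
  let ?T = "theta_part n c m"
  \<comment> \<open>Forward substitution in the bidiagonal system with right-hand side (-1)^(m+1)
    e_0; the scaling makes x_(m+1) = p_(m+2) = 1.\<close>
  define x where "x k = (if k \<le> Suc m then (- 1) ^ (Suc m - k) * ?p (k + 1) else 0)" for k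
  define X where "X = mat (n + 1) (n + 1) (\<lambda>(r, s). x r)"
  have X: "X \<in> carrier_mat (n + 1) (n + 1)" by (simp add: X_def)
  have mn: "m \<le> n" using m by simp
  have T: "?T \<in> carrier (SL n)" by (rule theta_part_SL[OF mn])
  then have Tc: "?T \<in> carrier_mat (n + 1) (n + 1)" by simp
  let ?S = "inv\<^bsub>SL n\<^esub> ?T"
  have Sc: "?S \<in> carrier_mat (n + 1) (n + 1)" using inv_SL_closed[OF T] by simp
  have SX: "?S * X \<in> carrier_mat (n + 1) (n + 1)" by (rule mult_carrier_mat[OF Sc X])
  note nzm = row_nonzero[OF m]
  let ?Q = "y_chain n (Suc m) (c (int n - int m))"
  have Q: "?Q \<in> carrier_mat (n + 1) (n + 1)" using y_chain_SL[OF m nzm] by simp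
  have pnz: "?p l \<noteq> 0" for l using nzm by (auto simp: pad_one_def)
  define q where "q k = (?S * X) $$ (k, 0)" for k
  have 0: "0 < n + 1" by simp
  have q_sum: "q r = (\<Sum>k<n + 1. ?S $$ (r, k) * x k)" if "r < n + 1" for r
    unfolding q_def index_mult_mat_sum[OF Sc X that 0]
    by (intro sum.cong) (auto simp: X_def)
  have "theta_part n c (Suc m) * (?S * X) = ?Q * (?T * (?S * X))"
    unfolding theta_part.simps by (rule assoc_mult_mat[OF Q Tc SX])
  also have "?T * (?S * X) = ?T * ?S * X" by (rule assoc_mult_mat[OF Tc Sc X, symmetric])
  also have "\<dots> = X" unfolding inv_SL_mult(2)[OF T] by (rule left_mult_one_mat[OF X])
  finally have TX: "theta_part n c (Suc m) * (?S * X) = ?Q * X" .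
  have T'c: "theta_part n c (Suc m) \<in> carrier_mat (n + 1) (n + 1)"
    using theta_part_SL[OF m] by simp
  have "(\<Sum>k<n + 1. theta_part n c (Suc m) $$ (r, k) * q k) = (if r = 0 then (- 1) ^ Suc m else 0)"
    if r: "r < n + 1" for r
  proof -
    have "(\<Sum>k<n + 1. theta_part n c (Suc m) $$ (r, k) * q k) = (theta_part n c (Suc m) * (?S * X)) $$ (r, 0)"
      unfolding index_mult_mat_sum[OF T'c SX r 0] q_def ..
    also have "\<dots> = ?p r / ?p (r + 1) * X $$ (r, 0) + (if 1 \<le> r \<and> r \<le> Suc m then X $$ (r - 1, 0) else 0)"
      unfolding TX by (rule y_chain_mult_entry[OF m nzm X r 0])
    also have "\<dots> = ?p r / ?p (r + 1) * x r + (if 1 \<le> r \<and> r \<le> Suc m then x (r - 1) else 0)"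
      using r by (simp add: X_def)
    also have "\<dots> = (if r = 0 then (- 1) ^ Suc m else 0)"
    proof -
      consider "r = 0" | k where "r = Suc k" "k \<le> m" | "Suc m < r"
        by (metis not0_implies_Suc not_less Suc_le_mono)
      then show ?thesis
      proof cases
        case 1
        have "?p 0 = 1" by (simp add: pad_one_def)
        then show ?thesis using 1 pnz[of 1] by (simp add: x_def)
      next
        case (2 k)
        then have "Suc m - k = Suc (m - k)" by simp
        then show ?thesis using 2 pnz[of "Suc (Suc k)"] by (simp add: x_def)
      next
        case 3
        then show ?thesis by (simp add: x_def)
      qed
    qed
    finally show ?thesis .
  qed
  \<comment> \<open>Below row \<open>m\<close> the inverse has unit rows, so \<open>q\<close> agrees
    with \<open>x\<close> there; this gives the entry 1 at m + 1 and zeros further down.\<close>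
  moreover have q_off: "q r = x r" if r: "r < n + 1" "m < r" for r
  proof -
    have "q r = (\<Sum>k<n + 1. if k = r then x k else 0)"
      unfolding q_sum[OF r(1)]
      using theta_part_inverse_off_block[OF mn r(1) _ r(2)] by (intro sum.cong) auto
    then show ?thesis using r(1) by (simp only: sum.delta finite_lessThan) simp
  qed
  \<comment> \<open>The alternating signs in row \<open>m\<close> of the inverse and in
    \<open>x\<close> multiply to -1 in every summand.\<close>
  moreover have "q m = - (\<Sum>k<Suc m. c (int n - int m) (k + 1) / pad_one m (c (int n + 1 - int m)) k)"
  proof -
    let ?p' = "pad_one m (c (int n + 1 - int m))"
    have "q m = (\<Sum>k<n + 1. ?S $$ (m, k) * x k)" using mn by (intro q_sum) simp
    also have "\<dots> = (\<Sum>k<Suc m. ?S $$ (m, k) * x k)"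
      using mn theta_part_inverse_row[OF mn] by (intro sum.mono_neutral_right) auto
    also have "\<dots> = (\<Sum>k<Suc m. - (c (int n - int m) (k + 1) / ?p' k))"
    proof (intro sum.cong refl)
      fix k assume "k \<in> {..<Suc m}"
      then have k: "k \<le> m" "k < n + 1" using mn by auto
      have "Suc m - k = Suc (m - k)" using k by simp
      then have "x k = - ((- 1) ^ (m - k) * c (int n - int m) (k + 1))"
        using k by (simp add: x_def pad_one_def)
      moreover have "(- 1 :: complex) ^ (m - k) * (- 1) ^ (m - k) = 1" by (rule minus_one_power_square)
      ultimately show "?S $$ (m, k) * x k = - (c (int n - int m) (k + 1) / ?p' k)"
        unfolding theta_part_inverse_row[OF mn k(2)] using k(1) by (simp flip: mult.assoc)
    qed
    finally show ?thesis by (simp add: sum_negf)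
  qed
  moreover have "x (Suc m) = 1" by (simp add: x_def pad_one_def)
  ultimately show ?thesis using m by (intro exI[of _ q]) (auto simp: x_def)
qed

text \<open>Invariant of the construction: T_m v = u w0 on the first m + 1 columns, with w0 of size
  m + 1 and with \<open>u\<close>, \<open>v\<close> trivial beyond. A new block Q on the left
  replaces u by Q u with its columns shifted one place, because m - i becomes m + 1 - i, and adds
  one column to \<open>v\<close>. This \<open>v\<close> is the inverse of the right factor of
  \<open>Theta\<close>, hence the minus sign in its superdiagonal.\<close>

lemma theta_part_factorization:
  assumes "m \<le> n"
  shows "\<exists>u \<in> unip_upper n. \<exists>v \<in> unip_upper n.
    (\<forall>r < n + 1. \<forall>i \<le> m. (theta_part n c m * v) $$ (r, i) = (- 1) ^ i * u $$ (r, m - i)) \<and>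
    (\<forall>r s. m < s \<and> s < n + 1 \<and> r < s \<longrightarrow> u $$ (r, s) = 0 \<and> v $$ (r, s) = 0) \<and>
    (\<forall>i. 1 \<le> i \<and> i \<le> m \<longrightarrow>
      v $$ (i - 1, i) = - (\<Sum>k<i. c (int n + 1 - int i) (k + 1) / (if k = 0 then 1 else c (int n + 2 - int i) k)) \<and>
      u $$ (i - 1, i) = (\<Sum>l<i. (if l = 0 then 1 else c (int n - int m + int i - int l) l)
        / c (int n - int m + int i - int l) (l + 1)))"
  using assms
proof (induction m)
  case 0
  have "1\<^sub>m (n + 1) \<in> unip_upper n" by (rule unip_gen_subset[OF unip_gen.one])
  then show ?case by (intro bexI[of _ "1\<^sub>m (n + 1)"]) auto
next
  case (Suc m)
  note m = Suc.prems
  obtain u v where u: "u \<in> unip_upper n" and v: "v \<in> unip_upper n"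
    and uv: "\<And>r i. r < n + 1 \<Longrightarrow> i \<le> m \<Longrightarrow> (theta_part n c m * v) $$ (r, i) = (- 1) ^ i * u $$ (r, m - i)"
    and off: "\<And>r s. m < s \<Longrightarrow> s < n + 1 \<Longrightarrow> r < s \<Longrightarrow> u $$ (r, s) = 0 \<and> v $$ (r, s) = 0"
    and sup: "\<And>i. 1 \<le> i \<Longrightarrow> i \<le> m \<Longrightarrow>
      v $$ (i - 1, i) = - (\<Sum>k<i. c (int n + 1 - int i) (k + 1) / (if k = 0 then 1 else c (int n + 2 - int i) k)) \<and>
      u $$ (i - 1, i) = (\<Sum>l<i. (if l = 0 then 1 else c (int n - int m + int i - int l) l)
        / c (int n - int m + int i - int l) (l + 1))"
    using Suc.IH[OF Suc_leD[OF m]] by blast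
  obtain q where q: "\<And>r. r < n + 1 \<Longrightarrow> (\<Sum>k<n + 1. theta_part n c (Suc m) $$ (r, k) * q k) = (if r = 0 then (- 1) ^ Suc m else 0)"
    and q0: "\<And>r. r < n + 1 \<Longrightarrow> Suc m < r \<Longrightarrow> q r = 0" and q1: "q (Suc m) = 1"
    and qm: "q m = - (\<Sum>k<Suc m. c (int n - int m) (k + 1) / pad_one m (c (int n + 1 - int m)) k)"
    using theta_part_column[OF m] by blast
  note uD = unip_upperD[OF u] and vD = unip_upperD[OF v]
  note nzm = row_nonzero[OF m]
  let ?p = "pad_one (Suc m) (c (int n - int m))"
  let ?Q = "y_chain n (Suc m) (c (int n - int m))"
  have Q: "?Q \<in> carrier_mat (n + 1) (n + 1)" using y_chain_SL[OF m nzm] by simp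
  have Tc: "theta_part n c m \<in> carrier_mat (n + 1) (n + 1)" using theta_part_SL[of m] m by simp
  have T'c: "theta_part n c (Suc m) \<in> carrier_mat (n + 1) (n + 1)" using theta_part_SL[OF m] by simp
  have pnz: "?p l \<noteq> 0" for l using nzm by (auto simp: pad_one_def)
  \<comment> \<open>Column 0 is the unit vector that the equation for \<open>q\<close> delivers;
    columns 1 to m + 1 are those of Q u moved by one place.\<close>
  define u' where "u' = mat (n + 1) (n + 1)
    (\<lambda>(r, s). if s = 0 \<or> Suc m < s then (if r = s then 1 else 0) else (?Q * u) $$ (r, s - 1))"
  define v' where "v' = mat (n + 1) (n + 1) (\<lambda>(r, s). if s = Suc m then q r else v $$ (r, s))"
  have u'_entry: "u' $$ (r, Suc s) = ?p r / ?p (r + 1) * u $$ (r, s) + (if 1 \<le> r \<and> r \<le> Suc m then u $$ (r - 1, s) else 0)"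
    if "r < n + 1" "s \<le> m" for r s
    using that m y_chain_mult_entry[OF m nzm uD(1) that(1), of s] by (simp add: u'_def)
  have u'_other: "u' $$ (r, s) = (if r = s then 1 else 0)" if "r < n + 1" "s < n + 1" "s = 0 \<or> Suc m < s" for r s
    using that by (simp add: u'_def)
  have u'_unip: "u' \<in> unip_upper n"
  proof (rule unip_upperI)
    show "u' \<in> carrier_mat (n + 1) (n + 1)" by (simp add: u'_def)
    fix r assume r: "r < n + 1"
    show "u' $$ (r, r) = 1"
    proof (cases "r = 0 \<or> Suc m < r")
      case True
      then show ?thesis using u'_other[OF r r] by simp
    next
      case False
      then obtain k where k: "r = Suc k" "k \<le> m" by (cases r) auto
      then show ?thesis using u'_entry[OF r k(2)] uD(2)[of k r] uD(3)[of k] r by simp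
    qed
  next
    fix r s assume rs: "s < r" "r < n + 1"
    show "u' $$ (r, s) = 0"
    proof (cases "s = 0 \<or> Suc m < s")
      case True
      then show ?thesis using u'_other[of r s] rs by simp
    next
      case False
      then obtain k where k: "s = Suc k" "k \<le> m" by (cases s) auto
      then show ?thesis using u'_entry[OF rs(2) k(2)] uD(2)[of k r] uD(2)[of k "r - 1"] rs by auto
    qed
  qed
  have v'_entry: "v' $$ (r, s) = (if s = Suc m then q r else v $$ (r, s))" if "r < n + 1" "s < n + 1" for r s
    using that by (simp add: v'_def)
  have v'c: "v' \<in> carrier_mat (n + 1) (n + 1)" by (simp add: v'_def)
  have v'_unip: "v' \<in> unip_upper n"
  proof (rule unip_upperI[OF v'c])
    show "v' $$ (r, r) = 1" if "r < n + 1" for r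
      unfolding v'_entry[OF that that] using q1 vD(3)[OF that] by simp
    show "v' $$ (r, s) = 0" if "s < r" "r < n + 1" for r s
    proof -
      have s: "s < n + 1" using that by simp
      show ?thesis unfolding v'_entry[OF that(2) s] using q0[OF that(2)] vD(2)[OF that] that by simp
    qed
  qed
  have main: "(theta_part n c (Suc m) * v') $$ (r, i) = (- 1) ^ i * u' $$ (r, Suc m - i)"
    if r: "r < n + 1" and i: "i \<le> Suc m" for r i
  proof (cases "i = Suc m")
    case True
    have "(theta_part n c (Suc m) * v') $$ (r, i) = (\<Sum>k<n + 1. theta_part n c (Suc m) $$ (r, k) * v' $$ (k, i))"
      using i m by (intro index_mult_mat_sum[OF T'c v'c r]) simp
    also have "\<dots> = (\<Sum>k<n + 1. theta_part n c (Suc m) $$ (r, k) * q k)"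
      using True m by (intro sum.cong) (auto simp: v'_entry)
    also have "\<dots> = (- 1) ^ i * u' $$ (r, Suc m - i)"
      unfolding q[OF r] using True u'_other[OF r, of 0] by simp
    finally show ?thesis .
  next
    case False
    then have im: "i \<le> m" "i < n + 1" using i m by auto
    have Tv: "theta_part n c m * v \<in> carrier_mat (n + 1) (n + 1)" by (rule mult_carrier_mat[OF Tc vD(1)])
    have "(theta_part n c (Suc m) * v') $$ (r, i) = (\<Sum>k<n + 1. theta_part n c (Suc m) $$ (r, k) * v' $$ (k, i))"
      by (rule index_mult_mat_sum[OF T'c v'c r im(2)])
    also have "\<dots> = (\<Sum>k<n + 1. theta_part n c (Suc m) $$ (r, k) * v $$ (k, i))"
      using im False by (intro sum.cong) (auto simp: v'_entry)
    also have "\<dots> = (theta_part n c (Suc m) * v) $$ (r, i)"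
      by (rule index_mult_mat_sum[OF T'c vD(1) r im(2), symmetric])
    also have "theta_part n c (Suc m) * v = ?Q * (theta_part n c m * v)"
      unfolding theta_part.simps by (rule assoc_mult_mat[OF Q Tc vD(1)])
    also have "(?Q * (theta_part n c m * v)) $$ (r, i) = ?p r / ?p (r + 1) * ((- 1) ^ i * u $$ (r, m - i))
        + (if 1 \<le> r \<and> r \<le> Suc m then (- 1) ^ i * u $$ (r - 1, m - i) else 0)"
      unfolding y_chain_mult_entry[OF m nzm Tv r im(2)] uv[OF r im(1)]
      using uv[of "r - 1" i] r im by simp
    also have "\<dots> = (- 1) ^ i * u' $$ (r, Suc (m - i))"
      unfolding u'_entry[OF r diff_le_self[of m i]] by (simp add: algebra_simps)
    also have "Suc (m - i) = Suc m - i" using im by simp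
    finally show ?thesis .
  qed
  have off': "u' $$ (r, s) = 0 \<and> v' $$ (r, s) = 0" if "Suc m < s" "s < n + 1" "r < s" for r s
    using that u'_other[of r s] off[of s r] by (simp add: v'_entry)
  have sup_v: "v' $$ (i - 1, i) = - (\<Sum>k<i. c (int n + 1 - int i) (k + 1) / (if k = 0 then 1 else c (int n + 2 - int i) k))"
    if i: "1 \<le> i" "i \<le> Suc m" for i
  proof (cases "i = Suc m")
    case False
    then show ?thesis using sup[of i] i m by (simp add: v'_entry)
  next
    case True
    have "(\<Sum>k<Suc m. c (int n - int m) (k + 1) / pad_one m (c (int n + 1 - int m)) k)
        = (\<Sum>k<Suc m. c (int n - int m) (k + 1) / (if k = 0 then 1 else c (int n + 1 - int m) k))"
      by (intro sum.cong refl) (auto simp: pad_one_def)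
    then have "v' $$ (m, Suc m) = - (\<Sum>k<Suc m. c (int n - int m) (k + 1) / (if k = 0 then 1 else c (int n + 1 - int m) k))"
      using qm m by (simp only: v'_entry) (simp add: v'_entry)
    moreover have "int n + 1 - int i = int n - int m" "int n + 2 - int i = int n + 1 - int m" using True by simp_all
    ultimately show ?thesis by (simp only: True diff_Suc_1)
  qed
  have sup_u: "u' $$ (i - 1, i) = (\<Sum>l<i. (if l = 0 then 1 else c (int n - int (Suc m) + int i - int l) l)
        / c (int n - int (Suc m) + int i - int l) (l + 1))" if i: "1 \<le> i" "i \<le> Suc m" for i
  proof -
    obtain k where k: "i = Suc k" "k \<le> m" using i by (cases i) auto
    have kn: "k < n + 1" using k m by simp
    \<comment> \<open>The diagonal entry of Q contributes the new monomial; its subdiagonal 1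
      carries the old superdiagonal entry one place further.\<close>
    have "u' $$ (k, Suc k) = ?p k / ?p (k + 1) + (if 1 \<le> k then u $$ (k - 1, k) else 0)"
      unfolding u'_entry[OF kn k(2)] using uD(3)[OF kn] k m by simp
    also have "(if 1 \<le> k then u $$ (k - 1, k) else 0) = (\<Sum>l<k. (if l = 0 then 1 else c (int n - int m + int k - int l) l)
        / c (int n - int m + int k - int l) (l + 1))"
      using sup[of k] k by (cases k) auto
    also have "?p k / ?p (k + 1) = (if k = 0 then 1 else c (int n - int m) k) / c (int n - int m) (k + 1)"
      using k by (auto simp: pad_one_def)
    finally have "u' $$ (k, Suc k) = (\<Sum>l<Suc k. (if l = 0 then 1 else c (int n - int m + int k - int l) l)
        / c (int n - int m + int k - int l) (l + 1))"
      by simp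
    moreover have "int n - int (Suc m) + int i = int n - int m + int k" using k by simp
    ultimately show ?thesis by (simp only: k(1) diff_Suc_1)
  qed
  show ?case
  proof (rule bexI[OF _ u'_unip], rule bexI[OF _ v'_unip], intro conjI allI impI)
    fix r i assume "r < n + 1" "i \<le> Suc m"
    then show "(theta_part n c (Suc m) * v') $$ (r, i) = (- 1) ^ i * u' $$ (r, Suc m - i)" by (rule main)
  next
    fix r s assume "Suc m < s \<and> s < n + 1 \<and> r < s"
    then show "u' $$ (r, s) = 0" "v' $$ (r, s) = 0" using off' by blast+
  next
    fix i assume i: "1 \<le> i \<and> i \<le> Suc m"
    show "v' $$ (i - 1, i) = - (\<Sum>k<i. c (int n + 1 - int i) (k + 1) / (if k = 0 then 1 else c (int n + 2 - int i) k))"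
      using i by (intro sup_v) simp_all
    show "u' $$ (i - 1, i) = (\<Sum>l<i. (if l = 0 then 1 else c (int n - int (Suc m) + int i - int l) l)
        / c (int n - int (Suc m) + int i - int l) (l + 1))"
      using i by (intro sup_u) simp_all
  qed
qed

end

section \<open>The monomial crystal\<close>

lemma lookup_Yvar: "Poly_Mapping.lookup (Yvar m i) x = (if x = (m, i) then 1 else 0)"
  by (auto simp: Yvar_def lookup_single when_def)

text \<open>Only the neighbours of k + 1 have nonzero Cartan entries. By the choice of
  \<open>p\<close> the lower neighbour appears with first index m + 1 and the upper one, which
  exists since k + 1 < n, with first index m.\<close>

lemma Amon_eq:
  assumes p: "\<And>i k. i \<in> {1..n} \<Longrightarrow> k \<in> {1..n} \<Longrightarrow> i < k \<Longrightarrow> p i k = 1"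
    "\<And>i k. i \<in> {1..n} \<Longrightarrow> k \<in> {1..n} \<Longrightarrow> i > k \<Longrightarrow> p i k = 0"
    and k: "Suc k < n"
  shows "Amon n p m (Suc k) = Yvar m (Suc k) + Yvar (m + 1) (Suc k)
    - (if k = 0 then 0 else Yvar (m + 1) k) - Yvar m (Suc (Suc k))"
proof -
  have single_neg: "Poly_Mapping.single x (- 1) = - Poly_Mapping.single x (1 :: int)" for x :: "int \<times> nat"
    by (simp add: single_uminus)
  have "(\<Sum>j \<in> {1..n} - {Suc k}. Poly_Mapping.single (m + p j (Suc k), j) (cartan j (Suc k)))
      = (\<Sum>j \<in> {1..n} - {Suc k}. (if j = k then - Yvar (m + 1) k else 0) + (if j = Suc (Suc k) then - Yvar m (Suc (Suc k)) else 0))"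
    using k by (intro sum.cong refl) (auto simp: cartan_def Yvar_def single_neg p)
  also have "\<dots> = (if k = 0 then 0 else - Yvar (m + 1) k) - Yvar m (Suc (Suc k))"
    unfolding sum.distrib using k by (simp add: sum.delta)
  finally show ?thesis by (simp add: Amon_def)
qed

text \<open>In the strings the next operator meets a monomial with only one variable of its own
  index, so the partial sums jump once, at \<open>q\<close>.\<close>

lemma partial_exp_single:
  assumes "\<forall>m. m \<noteq> q \<longrightarrow> Poly_Mapping.lookup Y (m, i) = 0"
  shows "partial_exp Y i K = (if q \<le> K then Poly_Mapping.lookup Y (q, i) else 0)"
proof -
  have "partial_exp Y i K = (\<Sum>m \<in> (if q \<le> K then {q} else {}). Poly_Mapping.lookup Y (m, i))"
    unfolding partial_exp_def
  proof (rule sum.mono_neutral_left)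
    show "{m. m \<le> K \<and> (m, i) \<in> Poly_Mapping.keys Y} \<subseteq> (if q \<le> K then {q} else {})"
      using assms by (auto simp: in_keys_iff)
  qed (auto simp: in_keys_iff)
  then show ?thesis by simp
qed

lemma crys_wt_single:
  assumes "\<forall>m. m \<noteq> q \<longrightarrow> Poly_Mapping.lookup Y (m, i) = 0"
  shows "crys_wt Y i = Poly_Mapping.lookup Y (q, i)"
proof -
  have "crys_wt Y i = (\<Sum>m \<in> {q}. Poly_Mapping.lookup Y (m, i))"
    unfolding crys_wt_def
  proof (rule sum.mono_neutral_left)
    show "{m. (m, i) \<in> Poly_Mapping.keys Y} \<subseteq> {q}"
      using assms by (auto simp: in_keys_iff)
  qed (auto simp: in_keys_iff)
  then show ?thesis by simp
qed

lemma crys_phi_single: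
  assumes "\<forall>m. m \<noteq> q \<longrightarrow> Poly_Mapping.lookup Y (m, i) = 0"
  shows "crys_phi i Y = max 0 (Poly_Mapping.lookup Y (q, i))"
proof -
  have "range (partial_exp Y i) = {0, Poly_Mapping.lookup Y (q, i)}"
  proof
    show "range (partial_exp Y i) \<subseteq> {0, Poly_Mapping.lookup Y (q, i)}"
      using partial_exp_single[OF assms] by auto
    have "partial_exp Y i (q - 1) = 0" "partial_exp Y i q = Poly_Mapping.lookup Y (q, i)"
      using partial_exp_single[OF assms] by auto
    then show "{0, Poly_Mapping.lookup Y (q, i)} \<subseteq> range (partial_exp Y i)"
      by (metis empty_subsetI insert_subset rangeI)
  qed
  then show ?thesis by (simp add: crys_phi_def)
qed

lemma crys_f_single:
  assumes "\<forall>m. m \<noteq> q \<longrightarrow> Poly_Mapping.lookup Y (m, i) = 0" "Poly_Mapping.lookup Y (q, i) = 1"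
  shows "crys_f n p i Y = Some (Y - Amon n p q i)"
proof -
  have phi: "crys_phi i Y = 1" using crys_phi_single[OF assms(1)] assms(2) by simp
  have "crys_nf i Y = q"
    unfolding crys_nf_def phi using partial_exp_single[OF assms(1)] assms(2)
    by (intro Least_equality) (auto split: if_splits)
  then show ?thesis by (simp add: crys_f_def phi)
qed

text \<open>The partial sums fall from 0 to -1 at \<open>q\<close>, so their maximum 0 is last
  attained at q - 1; hence each raising operator in the string moves the first index down by
  one.\<close>

lemma crys_e_single:
  assumes "\<forall>m. m \<noteq> q \<longrightarrow> Poly_Mapping.lookup Y (m, i) = 0" "Poly_Mapping.lookup Y (q, i) = - 1"
  shows "crys_e n p i Y = Some (Y + Amon n p (q - 1) i)"
proof -
  have phi: "crys_phi i Y = 0" using crys_phi_single[OF assms(1)] assms(2) by simp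
  have eps: "crys_eps i Y = 1" using crys_wt_single[OF assms(1)] assms(2) by (simp add: crys_eps_def phi)
  have "crys_ne i Y = q - 1"
    unfolding crys_ne_def phi using partial_exp_single[OF assms(1)] assms(2)
    by (intro Greatest_equality) (auto split: if_splits)
  then show ?thesis by (simp add: crys_e_def eps)
qed

text \<open>At stage \<open>k\<close> the only variable of index k + 1 is Y_(m,k+1), so A_(m,k+1) is
  divided out; its factors Y_(m,k+1) and 1 / Y_(m+1,k) cancel the old monomial, and one of the same
  shape remains.\<close>

lemma crys_f_string_Yvar:
  assumes p: "\<And>i k. i \<in> {1..n} \<Longrightarrow> k \<in> {1..n} \<Longrightarrow> i < k \<Longrightarrow> p i k = 1"
    "\<And>i k. i \<in> {1..n} \<Longrightarrow> k \<in> {1..n} \<Longrightarrow> i > k \<Longrightarrow> p i k = 0"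
    and "k < n"
  shows "crys_f_string n p k (Yvar m 1) = Some (Yvar m (Suc k) - (if k = 0 then 0 else Yvar (m + 1) k))"
  using assms(3)
proof (induction k)
  case 0
  then show ?case by simp
next
  case (Suc k)
  let ?Y = "Yvar m (Suc k) - (if k = 0 then 0 else Yvar (m + 1) k)"
  have "crys_f n p (Suc k) ?Y = Some (?Y - Amon n p m (Suc k))"
    by (rule crys_f_single) (auto simp: lookup_minus lookup_Yvar)
  also have "?Y - Amon n p m (Suc k) = Yvar m (Suc (Suc k)) - Yvar (m + 1) (Suc k)"
    using Amon_eq[of n p k m] p Suc.prems by (simp add: algebra_simps)
  finally show ?case using Suc by simp
qed

text \<open>Stage \<open>k\<close> has the single variable Y_(q,k+1) of index k + 1, with q = m - k
  and exponent -1. Multiplication by A_(q-1,k+1) cancels the old variables and leaves the same shape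
  at q - 1.\<close>

lemma crys_e_string_Yvar:
  assumes p: "\<And>i k. i \<in> {1..n} \<Longrightarrow> k \<in> {1..n} \<Longrightarrow> i < k \<Longrightarrow> p i k = 1"
    "\<And>i k. i \<in> {1..n} \<Longrightarrow> k \<in> {1..n} \<Longrightarrow> i > k \<Longrightarrow> p i k = 0"
    and "k < n"
  shows "crys_e_string n p k (- Yvar m 1) =
    Some ((if k = 0 then 0 else Yvar (m - int k) k) - Yvar (m - int k) (Suc k))"
  using assms(3)
proof (induction k)
  case 0
  then show ?case by simp
next
  case (Suc k)
  let ?q = "m - int k"
  let ?Y = "(if k = 0 then 0 else Yvar ?q k) - Yvar ?q (Suc k)"
  have "crys_e n p (Suc k) ?Y = Some (?Y + Amon n p (?q - 1) (Suc k))"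
    by (rule crys_e_single) (auto simp: lookup_minus lookup_Yvar)
  also have "?Y + Amon n p (?q - 1) (Suc k) = Yvar (?q - 1) (Suc k) - Yvar (?q - 1) (Suc (Suc k))"
  proof -
    have "Amon n p (?q - 1) (Suc k) = Yvar (?q - 1) (Suc k) + Yvar (?q - 1 + 1) (Suc k)
        - (if k = 0 then 0 else Yvar (?q - 1 + 1) k) - Yvar (?q - 1) (Suc (Suc k))"
      by (rule Amon_eq) (use p Suc.prems in simp_all)
    then show ?thesis unfolding diff_add_cancel by simp
  qed
  also have "?q - 1 = m - int (Suc k)" by simp
  finally show ?case using Suc by simp
qed

section \<open>Evaluation of monomials\<close>

lemma mon_value_superset:
  assumes "finite S" "Poly_Mapping.keys Y \<subseteq> S"
  shows "mon_value c Y = (\<Prod>(m, i) \<in> S. c m i powi Poly_Mapping.lookup Y (m, i))"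
  unfolding mon_value_def using assms
  by (intro prod.mono_neutral_left) (auto simp: in_keys_iff)

lemma mon_value_Yvar: "mon_value c (Yvar m i) = c m i"
proof -
  have "Poly_Mapping.keys (Yvar m i) \<subseteq> {(m, i)}"
    by (auto simp: in_keys_iff lookup_Yvar split: if_splits)
  from mon_value_superset[OF _ this, of c] show ?thesis by (simp add: lookup_Yvar)
qed

lemma mon_value_neg_Yvar: "mon_value c (- Yvar m i) = inverse (c m i)"
proof -
  have "Poly_Mapping.keys (- Yvar m i) \<subseteq> {(m, i)}"
    by (auto simp: in_keys_iff lookup_Yvar split: if_splits)
  from mon_value_superset[OF _ this, of c] show ?thesis by (simp add: lookup_Yvar)
qed

text \<open>For equal variables the exponents cancel and the value is 1, whereas a zero coordinate
  divided by itself is 0 by convention; distinctness excludes this case.\<close>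

lemma mon_value_diff_Yvar:
  assumes "(m, i) \<noteq> (q, k)"
  shows "mon_value c (Yvar m i - Yvar q k) = c m i / c q k"
proof -
  have "Poly_Mapping.keys (Yvar m i - Yvar q k) \<subseteq> {(m, i), (q, k)}"
    by (auto simp: in_keys_iff lookup_Yvar lookup_minus split: if_splits)
  from mon_value_superset[OF _ this, of c] show ?thesis
    using assms by (auto simp: lookup_Yvar lookup_minus divide_inverse)
qed

section \<open>Generalized minors of the factorization\<close>

lemma SL_assoc:
  "a \<in> carrier (SL n) \<Longrightarrow> b \<in> carrier (SL n) \<Longrightarrow> d \<in> carrier (SL n) \<Longrightarrow> a * b * d = a * (b * d)"
  using monoid.m_assoc[OF group.is_monoid[OF group_SL], of a n b d] by simp

lemma SL_carrier_mat: "g \<in> carrier (SL n) \<Longrightarrow> g \<in> carrier_mat (n + 1) (n + 1)"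
  by simp

lemma refl_lift_SL: "i \<in> {1..n} \<Longrightarrow> refl_lift n i \<in> carrier (SL n)"
  unfolding refl_lift_def by (intro SL_mult_closed x_root_SL y_root_SL)

lemma weyl_lift_SL:
  assumes w: "w permutes {1..n + 1}"
  shows "weyl_lift n w \<in> carrier (SL n)"
proof -
  obtain js where js: "is_word n w js" "length js = card (inversion_set n w)"
    using word_of_inversion_length[OF w] by blast
  then have "is_reduced_word n w js" using weyl_length_eq[OF w] by (simp add: is_reduced_word_def)
  then have "weyl_lift n w = mat_prod n (map (refl_lift n) js)"
    unfolding weyl_lift_eq[OF w] by (rule reduced_word_lift[symmetric])
  moreover have "mat_prod n (map (refl_lift n) js) \<in> carrier (SL n)"
  proof (rule mat_prod_closed)
    fix g assume "g \<in> set (map (refl_lift n) js)"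
    then obtain j where "j \<in> set js" "g = refl_lift n j" by auto
    then show "g \<in> carrier (SL n)" using js(1) refl_lift_SL[of j n] by (auto simp: is_word_def simp del: SL_simps)
  qed
  ultimately show ?thesis by simp
qed

lemma w0_mat_SL: "w0_mat n \<in> carrier (SL n)"
  using weyl_lift_SL[OF longest_elt_permutes, of n] unfolding weyl_lift_longest .

lemma w0_mat_mult_right:
  assumes A: "A \<in> carrier_mat (n + 1) (n + 1)" and rs: "r < n + 1" "s < n + 1"
  shows "(A * w0_mat n) $$ (r, s) = (- 1) ^ s * A $$ (r, n - s)"
proof -
  have "(A * w0_mat n) $$ (r, s) = (\<Sum>k<n + 1. A $$ (r, k) * w0_mat n $$ (k, s))"
    by (rule index_mult_mat_sum[OF A w0_mat_carrier rs])
  also have "\<dots> = (\<Sum>k<n + 1. if k = n - s then (- 1) ^ s * A $$ (r, k) else 0)"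
    using rs by (intro sum.cong refl) (auto simp: w0_mat_def)
  also have "\<dots> = (- 1) ^ s * A $$ (r, n - s)" by (simp only: sum.delta finite_lessThan) simp
  finally show ?thesis .
qed

lemma inv_w0_mat: "inv\<^bsub>SL n\<^esub> (w0_mat n) = mat (n + 1) (n + 1) (\<lambda>(r, s). if r + s = n then (- 1) ^ r else 0)"
  (is "_ = ?V")
proof (rule inv_SL_eq)
  have V: "?V \<in> carrier_mat (n + 1) (n + 1)" by simp
  show 1: "?V * w0_mat n = 1\<^sub>m (n + 1)"
  proof (rule eq_matI)
    fix r s assume "r < dim_row (1\<^sub>m (n + 1) :: complex mat)" "s < dim_col (1\<^sub>m (n + 1) :: complex mat)"
    then have rs: "r < n + 1" "s < n + 1" by auto
    show "(?V * w0_mat n) $$ (r, s) = 1\<^sub>m (n + 1) $$ (r, s)"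
      unfolding w0_mat_mult_right[OF V rs] using rs by (auto simp: minus_one_power_square)
  qed (use w0_mat_carrier[of n] in auto)
  show "w0_mat n \<in> carrier (SL n)" by (rule w0_mat_SL)
  have "det ?V * det (w0_mat n) = 1"
    using det_mult[OF V w0_mat_carrier] unfolding 1 by simp
  then have "det ?V = 1" using w0_mat_SL[of n] by simp
  then show "?V \<in> carrier (SL n)" using V by (simp only: SL_simps mem_Collect_eq)
qed

lemma inv_w0_mat_mult_left:
  assumes A: "A \<in> carrier_mat (n + 1) (n + 1)" and rs: "r < n + 1" "s < n + 1"
  shows "(inv\<^bsub>SL n\<^esub> (w0_mat n) * A) $$ (r, s) = (- 1) ^ r * A $$ (n - r, s)"
proof -
  let ?V = "mat (n + 1) (n + 1) (\<lambda>(r, s). if r + s = n then (- 1) ^ r else 0) :: complex mat"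
  have V: "?V \<in> carrier_mat (n + 1) (n + 1)" by simp
  have "(inv\<^bsub>SL n\<^esub> (w0_mat n) * A) $$ (r, s) = (\<Sum>k<n + 1. ?V $$ (r, k) * A $$ (k, s))"
    unfolding inv_w0_mat by (rule index_mult_mat_sum[OF V A rs])
  also have "\<dots> = (\<Sum>k<n + 1. if k = n - r then (- 1) ^ r * A $$ (k, s) else 0)"
    using rs by (intro sum.cong refl) auto
  also have "\<dots> = (- 1) ^ r * A $$ (n - r, s)" by (simp only: sum.delta finite_lessThan) simp
  finally show ?thesis .
qed

text \<open>Up to signs, conjugation by w0 turns a matrix by 180 degrees; it exchanges upper and
  lower triangular matrices and sends the entry at (j - 1, j) to (n + 1 - j, n - j).\<close>

lemma conj_w0_entry:
  assumes A: "A \<in> carrier_mat (n + 1) (n + 1)" and rs: "r < n + 1" "s < n + 1"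
  shows "(inv\<^bsub>SL n\<^esub> (w0_mat n) * (A * w0_mat n)) $$ (r, s) = (- 1) ^ (r + s) * A $$ (n - r, n - s)"
proof -
  have "n - r < n + 1" by simp
  then show ?thesis
    unfolding inv_w0_mat_mult_left[OF mult_carrier_mat[OF A w0_mat_carrier] rs]
      w0_mat_mult_right[OF A _ rs(2)] by (simp add: power_add w0_mat_mult_right[OF A _ rs(2)])
qed

text \<open>In view of \<open>eta_eq\<close> this says that \<open>eta\<close> fixes the lift of the
  longest element: inversion changes the signs (-1)^s into (-1)^r, and D supplies
  (-1)^(r+s).\<close>

lemma alt_conj_inv_w0: "alt_conj n (inv\<^bsub>SL n\<^esub> (w0_mat n)) = w0_mat n"
  unfolding inv_w0_mat
  by (intro eq_matI) (auto simp: alt_conj_def w0_mat_def power_add mult.commute minus_one_power_square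
    simp flip: mult.assoc)

lemma alt_conj_unip: "u \<in> unip_upper n \<Longrightarrow> alt_conj n u \<in> unip_upper n"
  using unip_upperD[of u n]
  by (intro unip_upperI) (auto simp: alt_conj_def power_add minus_one_power_square)

lemma inv_unip_superdiagonal:
  assumes u: "u \<in> unip_upper n" and i: "i \<in> {1..n}"
  shows "(inv\<^bsub>SL n\<^esub> u) $$ (i - 1, i) = - u $$ (i - 1, i)"
proof -
  have "(u * inv\<^bsub>SL n\<^esub> u) $$ (i - 1, i) = u $$ (i - 1, i) + (inv\<^bsub>SL n\<^esub> u) $$ (i - 1, i)"
    by (rule unip_upper_superdiagonal[OF u unip_upper_inverse[OF u] i])
  moreover have "(u * inv\<^bsub>SL n\<^esub> u) $$ (i - 1, i) = 0"
    unfolding inv_SL_mult(2)[OF unip_upper_SL[OF u]] using i by auto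
  ultimately show ?thesis by (simp add: eq_neg_iff_add_eq_0 add.commute)
qed

lemma conj_w0_borel:
  assumes a: "a \<in> carrier (SL n)" and up: "\<And>r s. s < r \<Longrightarrow> r < n + 1 \<Longrightarrow> a $$ (r, s) = 0"
  shows "inv\<^bsub>SL n\<^esub> (w0_mat n) * (a * w0_mat n) \<in> borel_minus n"
proof (rule borel_minusI)
  show "inv\<^bsub>SL n\<^esub> (w0_mat n) * (a * w0_mat n) \<in> carrier (SL n)"
    by (intro SL_mult_closed inv_SL_closed w0_mat_SL a)
  fix r s assume rs: "r < s" "s < n + 1"
  then have r: "r < n + 1" and "n - s < n - r" "n - r < n + 1" by auto
  then show "(inv\<^bsub>SL n\<^esub> (w0_mat n) * (a * w0_mat n)) $$ (r, s) = 0"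
    unfolding conj_w0_entry[OF SL_carrier_mat[OF a] r rs(2)] by (simp add: up)
qed

lemma conj_w0_unip_lower:
  assumes u: "u \<in> unip_upper n"
  shows "inv\<^bsub>SL n\<^esub> (w0_mat n) * (u * w0_mat n) \<in> unip_lower n"
proof (rule unip_lowerI)
  have b: "inv\<^bsub>SL n\<^esub> (w0_mat n) * (u * w0_mat n) \<in> borel_minus n"
    by (rule conj_w0_borel[OF unip_upper_SL[OF u] unip_upperD(2)[OF u]])
  then show "inv\<^bsub>SL n\<^esub> (w0_mat n) * (u * w0_mat n) \<in> carrier_mat (n + 1) (n + 1)"
    by (intro SL_carrier_mat borel_minusD(1))
  show "(inv\<^bsub>SL n\<^esub> (w0_mat n) * (u * w0_mat n)) $$ (r, s) = 0" if "r < s" "s < n + 1" for r s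
    by (rule borel_minusD(2)[OF b that])
  show "(inv\<^bsub>SL n\<^esub> (w0_mat n) * (u * w0_mat n)) $$ (r, r) = 1" if "r < n + 1" for r
  proof -
    have "n - r < n + 1" by simp
    then show ?thesis
      unfolding conj_w0_entry[OF unip_upperD(1)[OF u] that that]
      by (simp add: unip_upperD(3)[OF u] power_add minus_one_power_square)
  qed
qed

section \<open>Characters and minors of u w0 v\<close>

text \<open>Regrouping as (w0^-1 (t u) w0) v puts the first factor into B^-, so the projection is
  \<open>v\<close>.\<close>

lemma chi_pi_plus_w0:
  assumes u: "u \<in> unip_upper n" and v: "v \<in> unip_upper n" and t: "t \<in> torus n" and j: "j \<in> {1..n}"
  defines "g \<equiv> inv\<^bsub>SL n\<^esub> (w0_mat n) * (t * (u * (w0_mat n * v)))"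
  shows "g \<in> borel_minus_U n" "chi n j (pi_plus n g) = v $$ (j - 1, j)"
proof -
  let ?b = "inv\<^bsub>SL n\<^esub> (w0_mat n) * ((t * u) * w0_mat n)"
  note mem = unip_upper_SL[OF u] unip_upper_SL[OF v] torus_SL[OF t] w0_mat_SL inv_SL_closed[OF w0_mat_SL]
  have g: "g = ?b * v"
    unfolding g_def by (simp only: SL_assoc[where n = n] SL_mult_closed mem)
  have "?b \<in> borel_minus n"
  proof (rule conj_w0_borel[OF SL_mult_closed[OF mem(3,1)]])
    fix r s assume rs: "s < r" "r < n + 1"
    then have s: "s < n + 1" by simp
    show "(t * u) $$ (r, s) = 0"
      unfolding torus_mult_entry(1)[OF t unip_upperD(1)[OF u] rs(2) s] using unip_upperD(2)[OF u rs] by simp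
  qed
  then show "g \<in> borel_minus_U n" "chi n j (pi_plus n g) = v $$ (j - 1, j)"
    using v chi_eq[OF v j] pi_plus_eq[OF _ v] unfolding g borel_minus_U_def by auto
qed

text \<open>The lower unipotent factor w0^-1 u w0 has leading minor 1. The lift of s_j brings column
  \<open>j\<close> into place j - 1, so the leading block of v times this lift is upper triangular
  with v_(j-1,j) as last diagonal entry and ones before it.\<close>

lemma gen_minor_w0_simple_refl:
  assumes u: "u \<in> unip_upper n" and v: "v \<in> unip_upper n" and j: "j \<in> {1..n}"
  shows "gen_minor n (longest_elt n) (simple_refl j) (fund_weight j) (u * (w0_mat n * v)) = v $$ (j - 1, j)"
proof -
  let ?L = "inv\<^bsub>SL n\<^esub> (w0_mat n) * (u * w0_mat n)" and ?R = "refl_lift n j"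
  note mem = unip_upper_SL[OF u] unip_upper_SL[OF v] w0_mat_SL inv_SL_closed[OF w0_mat_SL] refl_lift_SL[OF j]
  have L: "?L \<in> unip_lower n" by (rule conj_w0_unip_lower[OF u])
  note LD = unip_lowerD[OF L] and vD = unip_upperD[OF v]
  have vR: "v * ?R \<in> carrier_mat (n + 1) (n + 1)"
    by (rule mult_carrier_mat[OF vD(1) refl_lift_carrier[OF j]])
  have jn: "j \<le> n + 1" using j by auto
  have g: "inv\<^bsub>SL n\<^esub> (w0_mat n) * (u * (w0_mat n * v)) * ?R = ?L * (v * ?R)"
    by (simp only: SL_assoc[where n = n] SL_mult_closed mem)
  have "gen_minor n (longest_elt n) (simple_refl j) (fund_weight j) (u * (w0_mat n * v)) = lead_minor j (?L * (v * ?R))"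
    unfolding gen_minor_def weyl_lift_longest weyl_lift_simple_refl[OF j] g
    by (intro Delta_fund_weight j SL_mult_closed mem)
  also have "\<dots> = lead_minor j ?L * lead_minor j (v * ?R)"
    using LD(2) by (intro lead_minor_mult_lower[OF LD(1) vR jn]) auto
  also have "lead_minor j ?L = (\<Prod>i<j. ?L $$ (i, i))"
    using LD(2) jn by (intro lead_minor_lower_triangular) auto
  also have "\<dots> = 1" using LD(3) jn by (intro prod.neutral) auto
  also have "lead_minor j (v * ?R) = v $$ (j - 1, j)"
  proof -
    obtain m where m: "j = Suc m" "m < n" using j by (cases j) auto
    have entry: "(v * ?R) $$ (r, s) = (if s = m then v $$ (r, j) else v $$ (r, s))" if "r < j" "s < j" for r s
    proof -
      have rs: "r < n + 1" "s < n + 1" using that m by auto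
      show ?thesis unfolding refl_lift_mult_right[OF j vD(1) rs] using that m by simp
    qed
    have "lead_minor j (v * ?R) = (\<Prod>i<j. (v * ?R) $$ (i, i))"
    proof (rule lead_minor_upper_triangular)
      fix r s assume rs: "s < r" "r < j"
      then have "s < j" "s \<noteq> m" "r < n + 1" using m by auto
      then show "(v * ?R) $$ (r, s) = 0" using entry[OF rs(2)] vD(2)[OF rs(1)] by simp
    qed
    also have "\<dots> = (\<Prod>i<j. if i = m then v $$ (m, j) else 1)"
      using entry vD(3) jn by (intro prod.cong) auto
    also have "\<dots> = v $$ (m, j)" using m by simp
    finally show ?thesis by (simp add: m)
  qed
  finally show ?thesis by simp
qed

text \<open>As \<open>eta\<close> reverses the factors and fixes w0, it sends t u w0 v to eta(v) w0
  eta(u) t^-1. Conjugating the unipotent factor by \<open>t\<close> multiplies its superdiagonal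
  entry by the simple root.\<close>

lemma chi_pi_plus_w0_eta:
  assumes u: "u \<in> unip_upper n" and v: "v \<in> unip_upper n" and t: "t \<in> torus n" and j: "j \<in> {1..n}"
  defines "g \<equiv> inv\<^bsub>SL n\<^esub> (w0_mat n) * eta n (t * (u * (w0_mat n * v)))"
  shows "g \<in> borel_minus_U n" "chi n j (pi_plus n g) = simple_root j t * u $$ (j - 1, j)"
proof -
  let ?i = "\<lambda>g. inv\<^bsub>SL n\<^esub> g" and ?w = "w0_mat n"
  note mem0 = unip_upper_SL[OF u] unip_upper_SL[OF v] torus_SL[OF t] w0_mat_SL[of n]
  note mem = mem0 mem0[THEN inv_SL_closed]
  define v1 where "v1 = alt_conj n (?i v)"
  define u1 where "u1 = alt_conj n (?i u)"
  define ti where "ti = ?i t"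
  have v1: "v1 \<in> unip_upper n" unfolding v1_def by (intro alt_conj_unip unip_upper_inverse v)
  have u1: "u1 \<in> unip_upper n" unfolding u1_def by (intro alt_conj_unip unip_upper_inverse u)
  have ti: "ti \<in> torus n" unfolding ti_def inv_torus(1)[OF t] by (rule inv_torus(2)[OF t])
  note mem1 = mem unip_upper_SL[OF v1] unip_upper_SL[OF u1] torus_SL[OF ti]
  have ti_alt: "alt_conj n ti = ti"
    unfolding ti_def inv_torus(1)[OF t]
    by (intro eq_matI) (auto simp: alt_conj_def mat_diag_def power_add minus_one_power_square)
  have "eta n (t * (u * (?w * v))) = alt_conj n (?i (t * (u * (?w * v))))"
    by (intro eta_eq SL_mult_closed mem)
  also have "?i (t * (u * (?w * v))) = ?i v * (?i ?w * (?i u * ti))"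
    unfolding ti_def by (simp only: inv_SL_mult_distrib SL_assoc[where n = n] SL_mult_closed mem)
  also have "alt_conj n \<dots> = v1 * (?w * (u1 * ti))"
    unfolding v1_def u1_def
    by (subst alt_conj_mult, (intro SL_carrier_mat SL_mult_closed mem1; fail), (intro SL_carrier_mat SL_mult_closed mem1; fail),
        subst alt_conj_mult, (intro SL_carrier_mat SL_mult_closed mem1; fail), (intro SL_carrier_mat SL_mult_closed mem1; fail),
        subst alt_conj_mult, (intro SL_carrier_mat SL_mult_closed mem1; fail), (intro SL_carrier_mat SL_mult_closed mem1; fail))
      (simp only: alt_conj_inv_w0 ti_alt)
  finally have eta: "eta n (t * (u * (?w * v))) = v1 * (?w * (u1 * ti))" .
  have "ti * t = 1\<^sub>m (n + 1)" unfolding ti_def by (rule inv_SL_mult(1)[OF mem(3)])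
  moreover have "u1 * ti \<in> carrier_mat (n + 1) (n + 1)" by (intro SL_carrier_mat SL_mult_closed mem1)
  ultimately have u1ti: "ti * t * (u1 * ti) = u1 * ti" by (simp only: left_mult_one_mat)
  \<comment> \<open>Inserting t^-1 t splits \<open>g\<close> into a lower triangular factor ending
    in t^-1 and the unipotent factor t u1 t^-1.\<close>
  have "g = ?i ?w * (v1 * (?w * (ti * t * (u1 * ti))))" unfolding g_def eta u1ti ..
  also have "\<dots> = ?i ?w * (v1 * ?w) * ti * (t * (u1 * ti))"
    by (simp only: SL_assoc[where n = n] SL_mult_closed mem1)
  finally have g: "g = ?i ?w * (v1 * ?w) * ti * (t * (u1 * ti))" .
  have b: "?i ?w * (v1 * ?w) * ti \<in> borel_minus n"
    by (rule borel_minus_mult[OF unip_lower_borel[OF conj_w0_unip_lower[OF v1]] torus_borel[OF ti]])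
  have entry: "(t * (u1 * ti)) $$ (r, s) = t $$ (r, r) * u1 $$ (r, s) * inverse (t $$ (s, s))"
    if rs: "r < n + 1" "s < n + 1" for r s
    unfolding torus_mult_entry(1)[OF t SL_carrier_mat[OF SL_mult_closed[OF unip_upper_SL[OF u1] torus_SL[OF ti]]] rs]
      torus_mult_entry(2)[OF ti unip_upperD(1)[OF u1] rs]
    using rs by (simp add: ti_def inv_torus(1)[OF t] mat_diag_def)
  have u2: "t * (u1 * ti) \<in> unip_upper n"
  proof (rule unip_upperI)
    show "t * (u1 * ti) \<in> carrier_mat (n + 1) (n + 1)" by (intro SL_carrier_mat SL_mult_closed mem1)
    show "(t * (u1 * ti)) $$ (r, s) = 0" if "s < r" "r < n + 1" for r s
      using entry[of r s] unip_upperD(2)[OF u1 that] that by simp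
    show "(t * (u1 * ti)) $$ (r, r) = 1" if "r < n + 1" for r
      using entry[of r r] unip_upperD(3)[OF u1 that] torusD(4)[OF t that] that by simp
  qed
  obtain m where m: "j = Suc m" "m < n" using j by (cases j) auto
  \<comment> \<open>Inversion and conjugation by D each change the sign of a superdiagonal
    entry.\<close>
  have "u1 $$ (j - 1, j) = u $$ (j - 1, j)"
    unfolding u1_def using inv_unip_superdiagonal[OF u j] m by (simp add: alt_conj_entry)
  then have "(t * (u1 * ti)) $$ (j - 1, j) = simple_root j t * u $$ (j - 1, j)"
    using entry[of "j - 1" j] m by (simp add: simple_root_def divide_inverse)
  then show "g \<in> borel_minus_U n" "chi n j (pi_plus n g) = simple_root j t * u $$ (j - 1, j)"
    using b u2 chi_eq[OF u2 j] pi_plus_eq[OF b u2] unfolding g borel_minus_U_def by auto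
qed

text \<open>Conjugation by w0 carries the superdiagonal place of \<open>j\<close> to the subdiagonal
  place of i = n + 1 - j, which explains the index. The inverse lift of w0 s_i is the lift of s_i
  times w0^-1; the lift of s_i moves row i of w0^-1 u w0 into row i - 1 with a minus sign, and the
  leading block stays lower triangular.\<close>

lemma gen_minor_w0_simple_refl_id:
  assumes u: "u \<in> unip_upper n" and v: "v \<in> unip_upper n" and j: "j \<in> {1..n}"
  shows "gen_minor n (longest_elt n \<circ> simple_refl (n + 1 - j)) id (fund_weight (n + 1 - j)) (u * (w0_mat n * v))
    = u $$ (j - 1, j)"
proof -
  define i where "i = n + 1 - j"
  have i: "i \<in> {1..n}" using j by (auto simp: i_def)
  obtain m where m: "i = Suc m" "m < n" using i by (cases i) auto
  have jm: "n - i = j - 1" "n - m = j" using j m by (auto simp: i_def)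
  let ?W = "weyl_lift n (longest_elt n \<circ> simple_refl i)" and ?R = "refl_lift n i"
  let ?L = "inv\<^bsub>SL n\<^esub> (w0_mat n) * (u * w0_mat n)"
  have W: "?W \<in> carrier (SL n)"
    by (intro weyl_lift_SL permutes_compose simple_refl_permutes longest_elt_permutes i)
  note mem0 = unip_upper_SL[OF u] unip_upper_SL[OF v] w0_mat_SL[of n] refl_lift_SL[OF i] W
  note mem = mem0 mem0[THEN inv_SL_closed]
  have "?R * inv\<^bsub>SL n\<^esub> (w0_mat n) = ?R * inv\<^bsub>SL n\<^esub> ?R * inv\<^bsub>SL n\<^esub> ?W"
    unfolding weyl_lift_longest_simple_refl[OF i, symmetric]
    by (simp only: inv_SL_mult_distrib SL_assoc[where n = n] SL_mult_closed mem)
  also have "\<dots> = inv\<^bsub>SL n\<^esub> ?W"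
    unfolding inv_SL_mult(2)[OF mem(4)] by (rule left_mult_one_mat[OF SL_carrier_mat[OF mem(10)]])
  finally have invW: "inv\<^bsub>SL n\<^esub> ?W = ?R * inv\<^bsub>SL n\<^esub> (w0_mat n)" ..
  have L: "?L \<in> unip_lower n" by (rule conj_w0_unip_lower[OF u])
  note LD = unip_lowerD[OF L] and vD = unip_upperD[OF v]
  have RL: "?R * ?L \<in> carrier_mat (n + 1) (n + 1)"
    by (rule mult_carrier_mat[OF refl_lift_carrier[OF i] LD(1)])
  have "i \<le> n + 1" using i by auto
  have "inv\<^bsub>SL n\<^esub> ?W * (u * (w0_mat n * v)) * 1\<^sub>m (n + 1) = inv\<^bsub>SL n\<^esub> ?W * (u * (w0_mat n * v))"
    by (rule right_mult_one_mat[OF SL_carrier_mat]) (intro SL_mult_closed mem)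
  also have "\<dots> = ?R * ?L * v"
    unfolding invW by (simp only: SL_assoc[where n = n] SL_mult_closed mem)
  finally have g: "inv\<^bsub>SL n\<^esub> ?W * (u * (w0_mat n * v)) * 1\<^sub>m (n + 1) = ?R * ?L * v" .
  have "gen_minor n (longest_elt n \<circ> simple_refl i) id (fund_weight i) (u * (w0_mat n * v)) = lead_minor i (?R * ?L * v)"
    unfolding gen_minor_def weyl_lift_id g
    by (intro Delta_fund_weight i SL_mult_closed mem)
  also have "\<dots> = lead_minor i (?R * ?L) * lead_minor i v"
    using vD(2) by (intro lead_minor_mult_upper[OF RL vD(1) \<open>i \<le> n + 1\<close>]) auto
  also have "lead_minor i v = (\<Prod>k<i. v $$ (k, k))"
    using vD(2) \<open>i \<le> n + 1\<close> by (intro lead_minor_upper_triangular) auto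
  also have "\<dots> = 1" using vD(3) \<open>i \<le> n + 1\<close> by (intro prod.neutral) auto
  also have "lead_minor i (?R * ?L) = - ?L $$ (i, m)"
  proof -
    have entry: "(?R * ?L) $$ (r, s) = (if r = m then - ?L $$ (i, s) else ?L $$ (r, s))" if "r < i" "s < i" for r s
    proof -
      have rs: "r < n + 1" "s < n + 1" using that m by auto
      show ?thesis unfolding refl_lift_mult_left[OF i LD(1) rs] using that m by simp
    qed
    have "lead_minor i (?R * ?L) = (\<Prod>k<i. (?R * ?L) $$ (k, k))"
    proof (rule lead_minor_lower_triangular)
      fix r s assume rs: "r < s" "s < i"
      then have "r < i" "r \<noteq> m" "s < n + 1" using m by auto
      then show "(?R * ?L) $$ (r, s) = 0" using entry[of r s] LD(2)[OF rs(1)] rs by simp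
    qed
    also have "\<dots> = (\<Prod>k<i. if k = m then - ?L $$ (i, m) else 1)"
      using entry LD(3) \<open>i \<le> n + 1\<close> by (intro prod.cong) auto
    also have "\<dots> = - ?L $$ (i, m)" using m by simp
    finally show ?thesis .
  qed
  \<comment> \<open>The sign (-1)^(i+m) = -1 of the conjugation cancels the one from the lift of
    s_i.\<close>
  also have "?L $$ (i, m) = (- 1) ^ (i + m) * u $$ (n - i, n - m)"
    using m by (intro conj_w0_entry[OF unip_upperD(1)[OF u]]) auto
  also have "(- 1 :: complex) ^ (i + m) = - 1"
    unfolding m using minus_one_power_square[of m] by (simp add: power_add)
  finally show ?thesis
    unfolding jm i_def[symmetric] by (simp only: mult_minus_left minus_minus mult_1_left mult_1_right)
qed

section \<open>The factorization of Theta and the crystal sums\<close>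

text \<open>For m = n the invariant of \<open>theta_part_factorization\<close> reads Theta v = u w0.
  Moving \<open>v\<close> to the other side inverts it, which removes the minus sign from its
  superdiagonal entries.\<close>

lemma (in theta_coordinates) Theta_factorization:
  assumes j: "j \<in> {1..n}"
  obtains u v where "u \<in> unip_upper n" "v \<in> unip_upper n" "Theta n c = u * (w0_mat n * v)"
    "v $$ (j - 1, j) =
      (\<Sum>k<j. c (int n + 1 - int j) (k + 1) / (if k = 0 then 1 else c (int n + 2 - int j) k))"
    "u $$ (j - 1, j) =
      (\<Sum>k<j. (if k = 0 then 1 else c (int j - int k) k) / c (int j - int k) (k + 1))"
proof -
  obtain u v where u: "u \<in> unip_upper n" and v: "v \<in> unip_upper n"
    and uv: "\<forall>r < n + 1. \<forall>i \<le> n. (theta_part n c n * v) $$ (r, i) = (- 1) ^ i * u $$ (r, n - i)"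
    and sup: "\<forall>i. 1 \<le> i \<and> i \<le> n \<longrightarrow>
      v $$ (i - 1, i) = - (\<Sum>k<i. c (int n + 1 - int i) (k + 1) / (if k = 0 then 1 else c (int n + 2 - int i) k)) \<and>
      u $$ (i - 1, i) = (\<Sum>l<i. (if l = 0 then 1 else c (int n - int n + int i - int l) l)
        / c (int n - int n + int i - int l) (l + 1))"
    using theta_part_factorization[OF order_refl] by blast
  note mem = theta_part_SL[OF order_refl] unip_upper_SL[OF u] unip_upper_SL[OF v] w0_mat_SL[of n]
    inv_SL_closed[OF unip_upper_SL[OF v]]
  have "theta_part n c n * v = u * w0_mat n"
  proof (rule eq_matI)
    fix r s assume "r < dim_row (u * w0_mat n)" "s < dim_col (u * w0_mat n)"
    then have rs: "r < n + 1" "s < n + 1" using unip_upperD(1)[OF u] w0_mat_carrier[of n] by auto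
    show "(theta_part n c n * v) $$ (r, s) = (u * w0_mat n) $$ (r, s)"
      unfolding w0_mat_mult_right[OF unip_upperD(1)[OF u] rs] using uv rs by simp
  qed (use SL_carrier_mat[OF mem(1)] unip_upperD(1)[OF u] unip_upperD(1)[OF v] w0_mat_carrier[of n] in auto)
  then have "theta_part n c n * v * inv\<^bsub>SL n\<^esub> v = u * w0_mat n * inv\<^bsub>SL n\<^esub> v" by simp
  then have "theta_part n c n * (v * inv\<^bsub>SL n\<^esub> v) = u * (w0_mat n * inv\<^bsub>SL n\<^esub> v)"
    by (simp only: SL_assoc[where n = n] SL_mult_closed mem)
  then have fac: "Theta n c = u * (w0_mat n * inv\<^bsub>SL n\<^esub> v)"
    unfolding Theta_eq inv_SL_mult(2)[OF mem(3)] right_mult_one_mat[OF SL_carrier_mat[OF mem(1)]] .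
  show ?thesis
  proof (rule that[OF u unip_upper_inverse[OF v] fac])
    have j': "1 \<le> j \<and> j \<le> n" using j by simp
    show "(inv\<^bsub>SL n\<^esub> v) $$ (j - 1, j) =
      (\<Sum>k<j. c (int n + 1 - int j) (k + 1) / (if k = 0 then 1 else c (int n + 2 - int j) k))"
      unfolding inv_unip_superdiagonal[OF v j] using sup j' by simp
    show "u $$ (j - 1, j) = (\<Sum>k<j. (if k = 0 then 1 else c (int j - int k) k) / c (int j - int k) (k + 1))"
      by (rule sup[unfolded diff_self add_0_left, rule_format, OF j', THEN conjunct2])
  qed
qed

lemma f_string_sum:
  assumes p: "\<And>i k. i \<in> {1..n} \<Longrightarrow> k \<in> {1..n} \<Longrightarrow> i < k \<Longrightarrow> p i k = 1"
    "\<And>i k. i \<in> {1..n} \<Longrightarrow> k \<in> {1..n} \<Longrightarrow> i > k \<Longrightarrow> p i k = 0"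
    and j: "j \<in> {1..n}"
  shows "(\<Sum>k = 0..j - 1. crys_value c (crys_f_string n p k (Yvar m 1)))
    = (\<Sum>k<j. c m (k + 1) / (if k = 0 then 1 else c (m + 1) k))"
proof (rule sum.cong)
  show "{0..j - 1} = {..<j}" using j by auto
  fix k assume "k \<in> {..<j}"
  then have k: "k < n" using j by simp
  have str: "crys_f_string n p k (Yvar m 1) = Some (Yvar m (Suc k) - (if k = 0 then 0 else Yvar (m + 1) k))"
    by (rule crys_f_string_Yvar) (use p k in simp_all)
  show "crys_value c (crys_f_string n p k (Yvar m 1)) = c m (k + 1) / (if k = 0 then 1 else c (m + 1) k)"
    unfolding str by (simp add: crys_value_def mon_value_Yvar mon_value_diff_Yvar)
qed

lemma e_string_sum:
  assumes p: "\<And>i k. i \<in> {1..n} \<Longrightarrow> k \<in> {1..n} \<Longrightarrow> i < k \<Longrightarrow> p i k = 1"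
    "\<And>i k. i \<in> {1..n} \<Longrightarrow> k \<in> {1..n} \<Longrightarrow> i > k \<Longrightarrow> p i k = 0"
    and j: "j \<in> {1..n}"
  shows "(\<Sum>k = 0..j - 1. crys_value c (crys_e_string n p k (- Yvar m 1)))
    = (\<Sum>k<j. (if k = 0 then 1 else c (m - int k) k) / c (m - int k) (k + 1))"
proof (rule sum.cong)
  show "{0..j - 1} = {..<j}" using j by auto
  fix k assume "k \<in> {..<j}"
  then have k: "k < n" using j by simp
  have str: "crys_e_string n p k (- Yvar m 1) =
      Some ((if k = 0 then 0 else Yvar (m - int k) k) - Yvar (m - int k) (Suc k))"
    by (rule crys_e_string_Yvar) (use p k in simp_all)
  show "crys_value c (crys_e_string n p k (- Yvar m 1)) =
      (if k = 0 then 1 else c (m - int k) k) / c (m - int k) (k + 1)"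
    unfolding str by (simp add: crys_value_def mon_value_neg_Yvar mon_value_diff_Yvar divide_inverse)
qed

theorem proposition6p3:
  fixes n j :: nat
    and p :: "nat \<Rightarrow> nat \<Rightarrow> int"
    and c :: "int \<Rightarrow> nat \<Rightarrow> complex"
    and t :: "complex mat"
  assumes "n \<ge> 1"
    and "\<And>i k. i \<in> {1..n} \<Longrightarrow> k \<in> {1..n} \<Longrightarrow> i < k \<Longrightarrow> p i k = 1"
    and "\<And>i k. i \<in> {1..n} \<Longrightarrow> k \<in> {1..n} \<Longrightarrow> i > k \<Longrightarrow> p i k = 0"
    and "\<And>k l. k \<ge> 1 \<Longrightarrow> l \<ge> 1 \<Longrightarrow> k + int l \<le> int n + 1 \<Longrightarrow> c k l \<noteq> 0"
    and "j \<in> {1..n}"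
    and "t \<in> torus n"
  shows "(inv\<^bsub>SL n\<^esub> (weyl_lift n (longest_elt n)) * (t * Theta n c) \<in> borel_minus_U n \<and>
      chi n j (pi_plus n (inv\<^bsub>SL n\<^esub> (weyl_lift n (longest_elt n)) * (t * Theta n c)))
        = gen_minor n (longest_elt n) (simple_refl j) (fund_weight j) (Theta n c) \<and>
      gen_minor n (longest_elt n) (simple_refl j) (fund_weight j) (Theta n c)
        = (\<Sum>k = 0..j - 1. crys_value c (crys_f_string n p k (Yvar (int n - int j + 1) 1))))
    \<and>
     (inv\<^bsub>SL n\<^esub> (weyl_lift n (longest_elt n)) * eta n (t * Theta n c) \<in> borel_minus_U n \<and>
      chi n j (pi_plus n (inv\<^bsub>SL n\<^esub> (weyl_lift n (longest_elt n)) * eta n (t * Theta n c)))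
        = simple_root j t *
          gen_minor n (longest_elt n \<circ> simple_refl (n + 1 - j)) id (fund_weight (n + 1 - j)) (Theta n c) \<and>
      simple_root j t *
          gen_minor n (longest_elt n \<circ> simple_refl (n + 1 - j)) id (fund_weight (n + 1 - j)) (Theta n c)
        = simple_root j t *
          (\<Sum>k = 0..j - 1. crys_value c (crys_e_string n p k (- Yvar (int j) 1))))"
proof -
  note p = assms(2,3) and j = assms(5) and t = assms(6)
  interpret theta_coordinates n c by unfold_locales (rule assms(4))
  obtain u v where u: "u \<in> unip_upper n" and v: "v \<in> unip_upper n" and fac: "Theta n c = u * (w0_mat n * v)"
    and sv: "v $$ (j - 1, j) =
      (\<Sum>k<j. c (int n + 1 - int j) (k + 1) / (if k = 0 then 1 else c (int n + 2 - int j) k))"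
    and su: "u $$ (j - 1, j) =
      (\<Sum>k<j. (if k = 0 then 1 else c (int j - int k) k) / c (int j - int k) (k + 1))"
    using Theta_factorization[OF j] by blast
  have m: "int n + 1 - int j = int n - int j + 1" "int n + 2 - int j = int n - int j + 1 + 1" by simp_all
  have "(\<Sum>k = 0..j - 1. crys_value c (crys_f_string n p k (Yvar (int n - int j + 1) 1))) = v $$ (j - 1, j)"
    unfolding sv m by (rule f_string_sum) (fact p j)+
  moreover have "(\<Sum>k = 0..j - 1. crys_value c (crys_e_string n p k (- Yvar (int j) 1))) = u $$ (j - 1, j)"
    unfolding su by (rule e_string_sum) (fact p j)+
  ultimately show ?thesis
    unfolding fac weyl_lift_longest
    using chi_pi_plus_w0[OF u v t j] gen_minor_w0_simple_refl[OF u v j]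
      chi_pi_plus_w0_eta[OF u v t j] gen_minor_w0_simple_refl_id[OF u v j]
    by (simp only: simp_thms)
qed

end
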